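(* Let $X$ be a standard Markov process on $E$ which has the Inversion Property with continuous characteristics $(I,h,v)$. Let $D\subset E_h=\{x\in E:0<h(x)<\infty\}$ be an open set. If $H\ge0$ is a continuous function which is excessive on $D$, then the function $\mathcal K H(x)=h(x)\,H(I(x))$ is excessive on the set $I(D)$.
   Context: State space: $S\subset\mathbb R^n$ is an unbounded locally compact set with $0\in S$, and $E=S\cup\{\infty\}$ is its Alexandroff one-point compactification, with its Borel $\sigma$-field. Write $\mathring S$ for the interior of $S$, $\mathring E=\mathring S\setminus\{0\}$ ("the interior of $E$") and $\partial E=E\setminus\mathring E=\partial S\cup\{0,\infty\}$. Functions considered in connection with the Kelvin transform $\mathcal K$ are taken equal to $0$ on $\partial E$. Process: $X=((X_t)_{t\ge0},(\mathbb P_x)_{x\in E})$ is a standard Markov process on $E$ (in the sense of Blumenthal and Getoor): strong Markov, right-continuous with left limits, quasi-left-continuous on $[0,\zeta)$, where $\zeta=\inf\{s>0: X_s\notin\mathring S\setminus\{0\}\}$ is the lifetime. $X$ is absorbed at $\partial S\cup\{0,\infty\}$: it is sent to $0$ when it leaves $\mathring S\setminus\{0\}$ through $\partial S\cup\{0\}$ and to $\infty$ otherwise. $X$ is irreducible: from any point of $\mathring S\setminus\{0\}$ it reaches any nonempty open subset of $E$ with positive probability. Excessive functions and Doob transform: a Borel function $h\ge 0$ on $E$ is excessive if $\mathbb E_xh(X_t)\le h(x)$ for all $x,t$ and $\lim_{t\to0+}\mathbb E_xh(X_t)=h(x)$ for all $x$. It is excessive on an open set $D$ if it is excessive for $X$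 killed when it exits $D$. The Doob $h$-transform $X^h$ is the (sub-)Markov process with semigroup $P^h_t(x,dy)=\frac{h(y)}{h(x)}Q^h_t(x,dy)$ for $x\in E_h$ and $0$ for $x\notin E_h$, where $Q^h_t$ is the semigroup of $X$ killed on exiting $E_h$. Inversion Property: $X$ has the Inversion Property (IP) with characteristics $(I,h,v)$ if $I\neq\mathrm{Id}$ is an involution of $E$, $h\ge0$ is an $X$-excessive function on $E$ with $0<h<\infty$ on $\mathring E$, $v$ is a positive continuous function and, for every $x\in E$, the process $(I(X_{\gamma_t}),t\ge0)$ with $X_0=x$ has the same law as $(X^h_t,t\ge0)$ with $X^h_0=I(x)$. Here $\gamma_t$ is the inverse of $A_t=\int_0^tv^{-1}(X_s)\,ds$ and $X^h$ is killed when it exits $\mathring E$. The characteristics are called continuous if $I$ and $h$ are continuous on $\mathring E$. *)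

theory Defs
  imports "HOL-Probability.Probability"
begin

section \<open>The state space\<close>

text \<open>
  The point at infinity is \<^term>\<open>None\<close>; a point \<open>x\<close> of \<open>S\<close> is \<^term>\<open>Some x\<close>.
\<close>

definition one_point :: "(real ^ 'n) set \<Rightarrow> (real ^ 'n) option topology" where
  "one_point S = Alexandroff_compactification (top_of_set S)"

definition state_space :: "(real ^ 'n) set \<Rightarrow> (real ^ 'n) option set" where
  "state_space S = topspace (one_point S)"

definition state_interior :: "(real ^ 'n) set \<Rightarrow> (real ^ 'n) option set" where
  "state_interior S = Some ` (interior S - {0})"

definition state_boundary :: "(real ^ 'n) set \<Rightarrow> (real ^ 'n) option set" where
  "state_boundary S = state_space S - state_interior S"

definition state_borel :: "(real ^ 'n) set \<Rightarrow> (real ^ 'n) option measure" where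
  "state_borel S = sigma (state_space S) {U. openin (one_point S) U}"

lemma state_space_eq: "state_space S = insert None (Some ` S)"
  by (simp add: state_space_def one_point_def)


section \<open>Standard Markov processes\<close>

definition exit_time :: "(real \<Rightarrow> 'w \<Rightarrow> 'e) \<Rightarrow> 'e set \<Rightarrow> 'w \<Rightarrow> ennreal" where
  "exit_time X D \<omega> = Inf (ennreal ` {s. 0 < s \<and> X s \<omega> \<notin> D})"

definition lifetime ::
  "(real ^ 'n) set \<Rightarrow> (real \<Rightarrow> 'w \<Rightarrow> (real ^ 'n) option) \<Rightarrow> 'w \<Rightarrow> ennreal" where
  "lifetime S X = exit_time X (state_interior S)"

text \<open>
  Standard processes in the sense of Blumenthal and Getoor, on the compactification of \<open>S\<close>, absorbed
  outside the interior, and irreducible.  Time is a nonnegative real; stopping times take values in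
  \<^typ>\<open>ennreal\<close>, which is therefore the index type of the filtration.  The points of the boundary
  play the role of the cemetery, so that no further point is adjoined and all \<open>P x\<close> have mass one.
  Translation operators are not needed to express the strong Markov property below and are left out.
\<close>

locale standard_process = filtration "space M" F
  for M :: "'w measure" and F :: "ennreal \<Rightarrow> 'w measure" +
  fixes S :: "(real ^ 'n) set"
    and X :: "real \<Rightarrow> 'w \<Rightarrow> (real ^ 'n) option"
    and P :: "(real ^ 'n) option \<Rightarrow> 'w measure"
  assumes unbounded: "\<not> bounded S"
    and locally_compact: "locally compact S"
    and zero_in: "0 \<in> S"
    \<comment> \<open>the underlying measurable space and the filtration\<close>
    and prob: "\<And>x. x \<in> state_space S \<Longrightarrow> prob_space (P x)"
    and sets_P: "\<And>x. x \<in> state_space S \<Longrightarrow> sets (P x) = sets M"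
    and sets_F: "\<And>t. sets (F t) \<subseteq> sets M"
    and F_right_continuous: "\<And>t. t < \<top> \<Longrightarrow> (\<Inter>s\<in>{t<..}. sets (F s)) = sets (F t)"
    \<comment> \<open>Completeness with respect to the laws \<open>P\<^sub>\<mu> = \<integral> P\<^sub>x d\<mu>(x)\<close> for all initial laws \<open>\<mu>\<close>;
        \<open>P\<^sub>\<mu> N = 0\<close> is expressed by \<open>P\<^sub>x N = 0\<close> for \<open>\<mu>\<close>-almost all \<open>x\<close>.\<close>
    and F_complete: "\<And>t A. t < \<top> \<Longrightarrow> A \<subseteq> space M \<Longrightarrow>
      (\<And>\<mu>. prob_space \<mu> \<Longrightarrow> sets \<mu> = sets (state_borel S) \<Longrightarrow>
         \<exists>B\<in>sets (F t). \<exists>N\<in>sets M. (A - B) \<union> (B - A) \<subseteq> N \<and> (AE x in \<mu>. emeasure (P x) N = 0)) \<Longrightarrow>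
      A \<in> sets (F t)"
    and adapted: "\<And>t. 0 \<le> t \<Longrightarrow> X t \<in> F (ennreal t) \<rightarrow>\<^sub>M state_borel S"
    and transition_measurable: "\<And>t B. 0 \<le> t \<Longrightarrow> B \<in> sets (state_borel S) \<Longrightarrow>
      (\<lambda>x. emeasure (P x) {\<omega>\<in>space M. X t \<omega> \<in> B}) \<in> borel_measurable (state_borel S)"
    and normal: "\<And>x. x \<in> state_space S \<Longrightarrow> AE \<omega> in P x. X 0 \<omega> = x"
    \<comment> \<open>path properties\<close>
    and right_continuous: "\<And>x. x \<in> state_space S \<Longrightarrow>
      AE \<omega> in P x. \<forall>t\<ge>0. limitin (one_point S) (\<lambda>s. X s \<omega>) (X t \<omega>) (at_right t)"
    and left_limits: "\<And>x. x \<in> state_space S \<Longrightarrow>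
      AE \<omega> in P x. \<forall>t>0. ennreal t < lifetime S X \<omega> \<longrightarrow>
        (\<exists>l. limitin (one_point S) (\<lambda>s. X s \<omega>) l (at_left t))"
    and strong_markov: "\<And>x T A s B. x \<in> state_space S \<Longrightarrow> stopping_time F T \<Longrightarrow>
      A \<in> sets (pre_sigma T) \<Longrightarrow> 0 \<le> s \<Longrightarrow> B \<in> sets (state_borel S) \<Longrightarrow>
      emeasure (P x) {\<omega>\<in>A. T \<omega> < \<top> \<and> X (enn2real (T \<omega>) + s) \<omega> \<in> B} =
      (\<integral>\<^sup>+\<omega>. emeasure (P (X (enn2real (T \<omega>)) \<omega>)) {\<omega>'\<in>space M. X s \<omega>' \<in> B} *
             indicator {\<omega>\<in>A. T \<omega> < \<top>} \<omega> \<partial>P x)"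
    and quasi_left_continuous: "\<And>x T. x \<in> state_space S \<Longrightarrow> (\<And>k. stopping_time F (T k)) \<Longrightarrow>
      (\<And>\<omega>. \<omega> \<in> space M \<Longrightarrow> incseq (\<lambda>k. T k \<omega>)) \<Longrightarrow>
      AE \<omega> in P x. (SUP k. T k \<omega>) < lifetime S X \<omega> \<longrightarrow>
        limitin (one_point S) (\<lambda>k. X (enn2real (T k \<omega>)) \<omega>)
          (X (enn2real (SUP k. T k \<omega>)) \<omega>) sequentially"
    \<comment> \<open>absorption\<close>
    and absorbed: "\<And>x. x \<in> state_space S \<Longrightarrow>
      AE \<omega> in P x. \<forall>s\<ge>0. \<forall>t\<ge>s. X s \<omega> \<in> state_boundary S \<longrightarrow> X t \<omega> = X s \<omega>"
    \<comment> \<open>The place through which the interior is left is read off from the left limit at the lifetime;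
        when that limit is an interior point or does not exist, it is read off from \<open>X\<close> itself.\<close>
    and sent_to: "\<And>x. x \<in> state_interior S \<Longrightarrow>
      AE \<omega> in P x. lifetime S X \<omega> < \<top> \<longrightarrow>
        (let z = enn2real (lifetime S X \<omega>) in
           X z \<omega> \<in> {Some 0, None} \<and>
           (\<forall>l. limitin (one_point S) (\<lambda>s. X s \<omega>) l (at_left z) \<longrightarrow>
              (l \<in> state_boundary S - {None} \<longrightarrow> X z \<omega> = Some 0) \<and>
              (l = None \<longrightarrow> X z \<omega> = None)))"
    and irreducible: "\<And>x U. x \<in> state_interior S \<Longrightarrow> openin (one_point S) U \<Longrightarrow> U \<noteq> {} \<Longrightarrow>
      \<not> (AE \<omega> in P x. \<forall>t\<ge>0. X t \<omega> \<notin> U)"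


section \<open>Excessive functions\<close>

text \<open>
  Events such as \<open>t < exit_time X D\<close> need not belong to the \<open>\<sigma>\<close>-algebra of \<open>P x\<close> for every \<open>D\<close>,
  hence the completion.
\<close>

definition killed_semigroup ::
  "('e \<Rightarrow> 'w measure) \<Rightarrow> (real \<Rightarrow> 'w \<Rightarrow> 'e) \<Rightarrow> 'e set \<Rightarrow> real \<Rightarrow> ('e \<Rightarrow> ennreal) \<Rightarrow> 'e \<Rightarrow> ennreal" where
  "killed_semigroup P X D t f x =
     (\<integral>\<^sup>+\<omega>. f (X t \<omega>) * indicator {\<omega>. ennreal t < exit_time X D \<omega>} \<omega> \<partial>completion (P x))"

definition excessive_on ::
  "(real ^ 'n) set \<Rightarrow> ((real ^ 'n) option \<Rightarrow> 'w measure) \<Rightarrow> (real \<Rightarrow> 'w \<Rightarrow> (real ^ 'n) option) \<Rightarrow>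
   (real ^ 'n) option set \<Rightarrow> ((real ^ 'n) option \<Rightarrow> ennreal) \<Rightarrow> bool" where
  "excessive_on S P X D f \<longleftrightarrow>
     f \<in> borel_measurable (restrict_space (state_borel S) D) \<and>
     (\<forall>x\<in>D. \<forall>t\<ge>0. killed_semigroup P X D t f x \<le> f x) \<and>
     (\<forall>x\<in>D. ((\<lambda>t. killed_semigroup P X D t f x) \<longlongrightarrow> f x) (at_right 0))"

definition excessive ::
  "(real ^ 'n) set \<Rightarrow> ((real ^ 'n) option \<Rightarrow> 'w measure) \<Rightarrow> (real \<Rightarrow> 'w \<Rightarrow> (real ^ 'n) option) \<Rightarrow>
   ((real ^ 'n) option \<Rightarrow> ennreal) \<Rightarrow> bool" where
  "excessive S P X f \<longleftrightarrow>
     f \<in> borel_measurable (state_borel S) \<and>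
     (\<forall>x\<in>state_space S. \<forall>t\<ge>0. (\<integral>\<^sup>+\<omega>. f (X t \<omega>) \<partial>P x) \<le> f x) \<and>
     (\<forall>x\<in>state_space S. ((\<lambda>t. \<integral>\<^sup>+\<omega>. f (X t \<omega>) \<partial>P x) \<longlongrightarrow> f x) (at_right 0))"


section \<open>Doob transform and Inversion Property\<close>

definition positivity_set ::
  "(real ^ 'n) set \<Rightarrow> ((real ^ 'n) option \<Rightarrow> ennreal) \<Rightarrow> (real ^ 'n) option set" where
  "positivity_set S h = {x \<in> state_space S. 0 < h x \<and> h x < \<top>}"

definition doob_semigroup ::
  "(real ^ 'n) set \<Rightarrow> ((real ^ 'n) option \<Rightarrow> 'w measure) \<Rightarrow> (real \<Rightarrow> 'w \<Rightarrow> (real ^ 'n) option) \<Rightarrow>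
   ((real ^ 'n) option \<Rightarrow> ennreal) \<Rightarrow> real \<Rightarrow> ((real ^ 'n) option \<Rightarrow> ennreal) \<Rightarrow>
   (real ^ 'n) option \<Rightarrow> ennreal" where
  "doob_semigroup S P X h t f x =
     (if x \<in> positivity_set S h
      then killed_semigroup P X (positivity_set S h) t (\<lambda>y. h y * f y) x / h x
      else 0)"

text \<open>
  \<open>doob_fdd S P X h 0 [(t\<^sub>1, B\<^sub>1), \<dots>, (t\<^sub>k, B\<^sub>k)] y\<close> is the probability that the \<open>h\<close>-transform started
  at \<open>y\<close> is in \<open>B\<^sub>i\<close> at time \<open>t\<^sub>i\<close> for all \<open>i\<close>, where \<open>0 \<le> t\<^sub>1 \<le> \<dots> \<le> t\<^sub>k\<close>.
\<close>

fun doob_fdd ::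
  "(real ^ 'n) set \<Rightarrow> ((real ^ 'n) option \<Rightarrow> 'w measure) \<Rightarrow> (real \<Rightarrow> 'w \<Rightarrow> (real ^ 'n) option) \<Rightarrow>
   ((real ^ 'n) option \<Rightarrow> ennreal) \<Rightarrow> real \<Rightarrow> (real \<times> (real ^ 'n) option set) list \<Rightarrow>
   (real ^ 'n) option \<Rightarrow> ennreal" where
  "doob_fdd S P X h s [] y = 1"
| "doob_fdd S P X h s ((t, B) # bs) y =
     doob_semigroup S P X h (t - s) (\<lambda>z. indicator B z * doob_fdd S P X h t bs z) y"

definition additive_functional ::
  "(real \<Rightarrow> 'w \<Rightarrow> 'e) \<Rightarrow> ('e \<Rightarrow> real) \<Rightarrow> real \<Rightarrow> 'w \<Rightarrow> ennreal" where
  "additive_functional X v t \<omega> = (\<integral>\<^sup>+s\<in>{0..t}. ennreal (1 / v (X s \<omega>)) \<partial>lborel)"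

definition time_change ::
  "(real \<Rightarrow> 'w \<Rightarrow> 'e) \<Rightarrow> ('e \<Rightarrow> real) \<Rightarrow> real \<Rightarrow> 'w \<Rightarrow> ennreal" where
  "time_change X v t \<omega> = Inf (ennreal ` {s. 0 \<le> s \<and> ennreal t < additive_functional X v s \<omega>})"

text \<open>
  Equality in law is equality of all finite-dimensional distributions.  The \<open>h\<close>-transform in question
  is killed when it exits the interior, so both processes are compared on Borel subsets of the
  interior only, everything outside counting as dead.  As \<open>X\<close> is absorbed in the boundary, its
  \<open>h\<close>-transform never returns to the interior after leaving it, and restricting its
  finite-dimensional distributions to the interior thus is the same as killing it.
  The time-changed process is dead, too, when \<open>time_change\<close> is infinite.  The function \<open>v\<close> is
  positive and continuous on the interior (as for \<open>v x = \<bar>x\<bar>\<^sup>2\<close>); its values on the boundary do not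
  matter.
\<close>

definition inversion_property ::
  "(real ^ 'n) set \<Rightarrow> ((real ^ 'n) option \<Rightarrow> 'w measure) \<Rightarrow> (real \<Rightarrow> 'w \<Rightarrow> (real ^ 'n) option) \<Rightarrow>
   ((real ^ 'n) option \<Rightarrow> (real ^ 'n) option) \<Rightarrow> ((real ^ 'n) option \<Rightarrow> ennreal) \<Rightarrow>
   ((real ^ 'n) option \<Rightarrow> real) \<Rightarrow> bool" where
  "inversion_property S P X I h v \<longleftrightarrow>
     (\<forall>x\<in>state_space S. I x \<in> state_space S \<and> I (I x) = x) \<and>
     (\<exists>x\<in>state_space S. I x \<noteq> x) \<and>
     excessive S P X h \<and>
     (\<forall>x\<in>state_interior S. 0 < h x \<and> h x < \<top>) \<and>
     (\<forall>x\<in>state_interior S. 0 < v x) \<and>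
     continuous_map (subtopology (one_point S) (state_interior S)) euclidean v \<and>
     (\<forall>x\<in>state_space S. \<forall>bs.
        sorted (0 # map fst bs) \<longrightarrow>
        (\<forall>(t, B)\<in>set bs. B \<in> sets (state_borel S) \<and> B \<subseteq> state_interior S) \<longrightarrow>
        emeasure (completion (P x))
          {\<omega>\<in>space (P x). \<forall>(t, B)\<in>set bs.
             time_change X v t \<omega> < \<top> \<and> I (X (enn2real (time_change X v t \<omega>)) \<omega>) \<in> B} =
        doob_fdd S P X h 0 bs (I x))"

definition continuous_characteristics ::
  "(real ^ 'n) set \<Rightarrow> ((real ^ 'n) option \<Rightarrow> (real ^ 'n) option) \<Rightarrow>
   ((real ^ 'n) option \<Rightarrow> ennreal) \<Rightarrow> bool" where
  "continuous_characteristics S I h \<longleftrightarrow>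
     continuous_map (subtopology (one_point S) (state_interior S)) (one_point S) I \<and>
     continuous_map (subtopology (one_point S) (state_interior S)) euclidean h"

definition kelvin ::
  "('e \<Rightarrow> 'e) \<Rightarrow> ('e \<Rightarrow> ennreal) \<Rightarrow> ('e \<Rightarrow> ennreal) \<Rightarrow> 'e \<Rightarrow> ennreal" where
  "kelvin I h f x = h x * f (I x)"

end

theory Submission
  imports Defs
begin

text \<open>
  Let \<open>y = I x\<close>.  By the Inversion Property, \<open>h x\<close> times the expectation of \<open>H\<close> at the time-changed
  process \<open>X\<close> started at \<open>y\<close> and killed outside \<open>D\<close> is the killed semigroup on \<open>I ` D\<close> applied to the
  Kelvin transform of \<open>H\<close>, taken at \<open>x\<close>.  Along \<open>X\<close> the function \<open>H\<close> is a right-continuous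
  supermartingale up to the exit from \<open>D\<close>, so optional stopping at the time change bounds this by
  \<open>h x * H y\<close>.  Convergence as the time tends to 0 then only needs a lower bound, which is Fatou's
  lemma, as the Kelvin transform is continuous on the interior.  Points of the boundary cause no
  trouble because \<open>I\<close> preserves the interior: otherwise \<open>X\<close> would be constant from some interior
  point on, contradicting irreducibility.
\<close>

subsection \<open>Topology and paths\<close>

text \<open>The Inversion Property gives finite-dimensional distributions only, while killing
  outside an open set looks at a continuum of times, and neither exit events nor the time change
  need be measurable. Killing is therefore expressed by the condition that the path lies in a
  relatively closed set at all dyadic fractions of the time. This is a decreasing limit of cylinder
  events, to which the Inversion Property and the Markov property apply. Two gaps remain. Dyadic
  times of the time-changed process must control \<open>X\<close> itself; they do because the
  additive functional increases strictly, where finite, as long as the path is in the interior. And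
  a path in I(D) must stay up to time \<open>t\<close> in one member of a compact exhaustion, which
  is a matter of its left limits. Only an inequality is carried through the law identity, because an
  event that fails to be measurable still yields an upper bound for the h-transform; the
  supermartingale inequality points the same way.\<close>

lemma openin_one_point_Some:
  assumes "open W" "W \<subseteq> S"
  shows "openin (one_point S) (Some ` W)"
  using assms by (simp add: one_point_def open_subset)

lemma openin_state_interior: "openin (one_point S) (state_interior S)"
  unfolding state_interior_def
  using interior_subset by (intro openin_one_point_Some open_Diff) auto

lemma state_interior_subset: "state_interior S \<subseteq> state_space S"
  using interior_subset[of S] by (auto simp: state_interior_def state_space_eq)

lemma space_state_borel: "space (state_borel S) = state_space S"
  unfolding state_borel_def state_space_def by (rule space_measure_of) (auto dest: openin_subset)

lemma openin_imp_sets: "openin (one_point S) U \<Longrightarrow> U \<in> sets (state_borel S)"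
  unfolding state_borel_def state_space_def
  by (subst sets_measure_of) (auto dest: openin_subset)

lemma relatively_closed_sets:
  assumes "G \<subseteq> state_interior S" "openin (one_point S) (state_interior S - G)"
  shows "G \<in> sets (state_borel S)"
proof -
  have "state_interior S - (state_interior S - G) \<in> sets (state_borel S)"
    by (intro sets.Diff openin_imp_sets openin_state_interior assms)
  with assms show ?thesis by (simp add: double_diff)
qed

lemma continuous_on_open_borel:
  fixes f :: "(real ^ 'n) option \<Rightarrow> 'b::topological_space"
  assumes "openin (one_point S) W" "continuous_map (subtopology (one_point S) W) euclidean f"
  shows "f \<in> borel_measurable (restrict_space (state_borel S) W)"
proof (rule borel_measurableI)
  fix V :: "'b set" assume "open V"
  have W: "W \<subseteq> state_space S" using assms(1) openin_subset by (auto simp: state_space_def)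
  have "openin (subtopology (one_point S) W) {x \<in> topspace (subtopology (one_point S) W). f x \<in> V}"
    using assms(2) \<open>open V\<close> by (auto simp: continuous_map_def)
  moreover have "{x \<in> topspace (subtopology (one_point S) W). f x \<in> V} = {x\<in>W. f x \<in> V}"
    using W by (auto simp: state_space_def)
  ultimately have "openin (one_point S) {x\<in>W. f x \<in> V}"
    using assms(1) by (metis openin_trans_full)
  moreover have "f -` V \<inter> space (restrict_space (state_borel S) W) = {x\<in>W. f x \<in> V}"
    using W by (auto simp: space_restrict_space space_state_borel)
  ultimately show "f -` V \<inter> space (restrict_space (state_borel S) W) \<in> sets (restrict_space (state_borel S) W)"
    by (subst sets_restrict_space_iff)
      (simp_all add: openin_imp_sets assms(1) sets.Int_space_eq2)
qed

text \<open>An excessive function on \<open>D\<close> is measurable on \<open>D\<close> only;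
  cutting it off gives a function on the whole state space, to which the Markov property
  applies.\<close>

lemma borel_times_indicator:
  fixes f :: "(real ^ 'n) option \<Rightarrow> ennreal"
  assumes "f \<in> borel_measurable (restrict_space (state_borel S) W)" "G \<subseteq> W" "G \<in> sets (state_borel S)"
  shows "(\<lambda>x. f x * indicator G x) \<in> borel_measurable (state_borel S)"
proof -
  have "f \<in> borel_measurable (restrict_space (state_borel S) G)"
    using measurable_restrict_mono assms by blast
  then show ?thesis
    using assms(3) sets.sets_into_space[OF assms(3)]
    by (subst (asm) borel_measurable_restrict_space_iff_ennreal) (auto simp: Int_absorb1 Int_absorb2)
qed

text \<open>The limit point lies in the open set \<open>W\<close>, so the path is eventually in
  \<open>W\<close> and the limit can be taken in the subspace where \<open>f\<close> is
  continuous.\<close>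

lemma limitin_continuous_on_open:
  assumes "limitin T p l \<F>" "openin T W" "l \<in> W" "continuous_map (subtopology T W) T' f"
  shows "limitin T' (\<lambda>s. f (p s)) (f l) \<F>"
proof -
  have "limitin (subtopology T W) p l \<F>"
    using assms(1-3) unfolding limitin_subtopology by (simp add: limitin_def)
  from continuous_map_limit[OF assms(4) this] show ?thesis
    by (simp add: comp_def)
qed

lemma dyadic_between:
  fixes a b t :: real
  assumes "0 \<le> a" "a < b" "b \<le> t"
  obtains N i :: nat where "i \<le> 2 ^ N" "a < t * real i / 2 ^ N" "t * real i / 2 ^ N < b"
proof -
  have t: "0 < t" using assms by linarith
  \<comment> \<open>\<open>N\<close> makes the mesh \<open>t / 2 ^ N\<close> smaller than
    \<open>b - a\<close>, and \<open>i\<close> will be the first grid index strictly beyond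
    \<open>a\<close>.\<close>
  obtain N :: nat where N: "t / (b - a) < 2 ^ N"
    using real_arch_pow[of 2 "t / (b - a)"] by auto
  define i where "i = nat \<lfloor>a * 2 ^ N / t\<rfloor> + 1"
  have i1: "a * 2 ^ N / t < real i" and i2: "real i \<le> a * 2 ^ N / t + 1"
  proof -
    have "0 \<le> a * 2 ^ N / t" using assms t by simp
    then have "real i = of_int \<lfloor>a * 2 ^ N / t\<rfloor> + 1"
      unfolding i_def by (simp add: of_nat_nat)
    then show "a * 2 ^ N / t < real i" "real i \<le> a * 2 ^ N / t + 1" by linarith+
  qed
  have 1: "a < t * real i / 2 ^ N" using i1 t by (simp add: field_simps)
  have "t * real i \<le> a * 2 ^ N + t" using i2 t by (simp add: field_simps)
  also have "\<dots> < b * 2 ^ N" using N assms by (simp add: field_simps)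
  finally have 2: "t * real i / 2 ^ N < b" by (simp add: field_simps)
  have "t * real i / 2 ^ N < t" using 2 assms by simp
  then have "real i < real (2 ^ N)" using t by (simp add: field_simps)
  then have "i \<le> 2 ^ N" by linarith
  from that[OF this 1 2] show ?thesis .
qed

lemma less_exit_timeD:
  assumes "ennreal t < exit_time X D \<omega>" "0 < s" "s \<le> t"
  shows "X s \<omega> \<in> D"
proof (rule ccontr)
  assume "X s \<omega> \<notin> D"
  then have "exit_time X D \<omega> \<le> ennreal s"
    unfolding exit_time_def using assms by (intro Inf_lower) auto
  with assms show False by (meson ennreal_leI leD order_trans)
qed

text \<open>The exit time is an infimum, so membership in \<open>D\<close> up to \<open>t\<close>
  alone would give a weak inequality; the margin \<open>e\<close> makes it strict.\<close>

lemma less_exit_timeI: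
  assumes "0 < e" "0 \<le> t" "\<And>s. 0 < s \<Longrightarrow> s < t + e \<Longrightarrow> X s \<omega> \<in> D"
  shows "ennreal t < exit_time X D \<omega>"
proof -
  have "ennreal (t + e) \<le> exit_time X D \<omega>"
    unfolding exit_time_def using assms by (intro Inf_greatest) (force intro!: ennreal_leI)
  moreover have "ennreal t < ennreal (t + e)" using assms by (intro ennreal_lessI) auto
  ultimately show ?thesis by order
qed

section \<open>Regular paths and their observation at dyadic times\<close>

context standard_process
begin

text \<open>These properties hold almost surely; once they are fixed, the arguments about single
  paths are deterministic.\<close>

definition regular_path :: "(real ^ 'n) option \<Rightarrow> 'w \<Rightarrow> bool" where
  "regular_path x \<omega> \<longleftrightarrow> \<omega> \<in> space M \<and> X 0 \<omega> = x \<and>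
     (\<forall>t\<ge>0. limitin (one_point S) (\<lambda>s. X s \<omega>) (X t \<omega>) (at_right t)) \<and>
     (\<forall>s\<ge>0. \<forall>t\<ge>s. X s \<omega> \<in> state_boundary S \<longrightarrow> X t \<omega> = X s \<omega>)"

lemma space_P: "x \<in> state_space S \<Longrightarrow> space (P x) = space M"
  using sets_P sets_eq_imp_space_eq by blast

lemma AE_regular_path:
  assumes "x \<in> state_space S"
  shows "AE \<omega> in P x. regular_path x \<omega>"
  using normal[OF assms] right_continuous[OF assms] absorbed[OF assms] AE_space[of "P x"]
  unfolding space_P[OF assms] regular_path_def by eventually_elim blast

lemma path_in_state_space:
  assumes "\<omega> \<in> space M" "0 \<le> t"
  shows "X t \<omega> \<in> state_space S"
  using measurable_space[OF adapted[OF assms(2)]] assms(1) by (simp add: space_F space_state_borel)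

lemma regular_path_space: "regular_path x \<omega> \<Longrightarrow> \<omega> \<in> space M"
  by (simp add: regular_path_def)

lemma regular_path_start: "regular_path x \<omega> \<Longrightarrow> X 0 \<omega> = x"
  by (simp add: regular_path_def)

lemma regular_path_limitin:
  "regular_path x \<omega> \<Longrightarrow> 0 \<le> t \<Longrightarrow> limitin (one_point S) (\<lambda>s. X s \<omega>) (X t \<omega>) (at_right t)"
  by (simp add: regular_path_def)

text \<open>A boundary point would have trapped the path. Hence killing at the exit from the
  interior can be read off at the final time.\<close>

lemma regular_path_interior_before:
  assumes "regular_path x \<omega>" "0 \<le> s" "s \<le> t" "X t \<omega> \<in> state_interior S"
  shows "X s \<omega> \<in> state_interior S"
proof (rule ccontr)
  assume "X s \<omega> \<notin> state_interior S"
  then have "X s \<omega> \<in> state_boundary S"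
    using path_in_state_space[OF regular_path_space[OF assms(1)] assms(2)] by (simp add: state_boundary_def)
  then have "X t \<omega> = X s \<omega>" using assms unfolding regular_path_def by blast
  with assms \<open>X s \<omega> \<notin> state_interior S\<close> show False by simp
qed

lemma regular_path_open:
  assumes "regular_path x \<omega>" "0 \<le> t" "openin (one_point S) V" "X t \<omega> \<in> V"
  obtains e where "0 < e" "\<And>s. t \<le> s \<Longrightarrow> s < t + e \<Longrightarrow> X s \<omega> \<in> V"
proof -
  have "eventually (\<lambda>s. X s \<omega> \<in> V) (at_right t)"
    using regular_path_limitin[OF assms(1,2)] assms(3,4) by (auto simp: limitin_def)
  then obtain b where b: "t < b" "\<And>s. t < s \<Longrightarrow> s < b \<Longrightarrow> X s \<omega> \<in> V"
    unfolding eventually_at_right_field by auto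
  show ?thesis
    by (rule that[of "b - t"]) (use b assms(4) in \<open>auto simp: order_le_less\<close>)
qed

text \<open>The open set \<open>V\<close> around \<open>X t \<omega>\<close> supplies the margin
  after \<open>t\<close> for the strict inequality. \<open>D\<close> itself may fail to be open,
  which matters for I(D).\<close>

lemma regular_path_exit_time:
  assumes "regular_path x \<omega>" "0 \<le> t" "openin (one_point S) V" "X t \<omega> \<in> V" "V \<subseteq> D"
    and "\<And>s. 0 < s \<Longrightarrow> s \<le> t \<Longrightarrow> X s \<omega> \<in> D"
  shows "ennreal t < exit_time X D \<omega>"
proof -
  obtain e where e: "0 < e" "\<And>s. t \<le> s \<Longrightarrow> s < t + e \<Longrightarrow> X s \<omega> \<in> V"
    using regular_path_open[OF assms(1-4)] by metis
  show ?thesis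
  proof (rule less_exit_timeI[OF e(1) assms(2)])
    fix s assume "0 < s" "s < t + e"
    then show "X s \<omega> \<in> D"
      using assms(5,6) e(2)[of s] by (cases "s \<le> t") auto
  qed
qed

text \<open>
  Observing paths on a dyadic grid keeps all events measurable; by right-continuity nothing is lost
  as long as \<open>G\<close> is closed in the interior.
\<close>

definition on_grid :: "(real ^ 'n) option set \<Rightarrow> real \<Rightarrow> real \<Rightarrow> 'w \<Rightarrow> bool" where
  "on_grid G s u \<omega> \<longleftrightarrow> (\<forall>N. \<forall>i\<le>2 ^ N. X (s + u * real i / 2 ^ N) \<omega> \<in> G)"

lemma on_grid_start: "on_grid G s u \<omega> \<Longrightarrow> X s \<omega> \<in> G"
  unfolding on_grid_def by (drule spec[of _ 0], drule spec[of _ 0]) simp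

lemma on_grid_end: "on_grid G s u \<omega> \<Longrightarrow> X (s + u) \<omega> \<in> G"
  unfolding on_grid_def by (drule spec[of _ 0], drule spec[of _ 1]) simp

text \<open>If the path is outside \<open>G\<close> but in the interior, it is in an open set and
  stays there for some interval, which contains a grid time. The end point in the interior rules out
  an earlier absorption in the boundary.\<close>

lemma on_grid_imp:
  assumes \<omega>: "regular_path x \<omega>" and G: "openin (one_point S) (state_interior S - G)"
    and su: "0 \<le> s" and int: "X (s + u) \<omega> \<in> state_interior S"
    and grid: "on_grid G s u \<omega>" and r: "s \<le> r" "r \<le> s + u"
  shows "X r \<omega> \<in> G"
proof (rule ccontr)
  assume "X r \<omega> \<notin> G"
  then have "r \<noteq> s + u" using on_grid_end[OF grid] by auto
  then have "r < s + u" using r by simp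
  have "X r \<omega> \<in> state_interior S - G"
    using regular_path_interior_before[OF \<omega> _ r(2) int] su r \<open>X r \<omega> \<notin> G\<close> by auto
  then obtain e where e: "0 < e" "\<And>q. r \<le> q \<Longrightarrow> q < r + e \<Longrightarrow> X q \<omega> \<in> state_interior S - G"
    using regular_path_open[OF \<omega> _ G] su r by (metis order_trans)
  \<comment> \<open>Cutting at \<open>u\<close> keeps the dyadic point within the grid on
    \<open>[s, s + u]\<close>.\<close>
  define b where "b = min (r - s + e) u"
  obtain N i :: nat where N: "i \<le> 2 ^ N" "r - s < u * real i / 2 ^ N" "u * real i / 2 ^ N < b"
    by (rule dyadic_between[of "r - s" b u]) (use r e \<open>r < s + u\<close> b_def in auto)
  have "X (s + u * real i / 2 ^ N) \<omega> \<in> G" using grid N(1) by (auto simp: on_grid_def)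
  moreover have "X (s + u * real i / 2 ^ N) \<omega> \<in> state_interior S - G"
    by (rule e(2)) (use N b_def in auto)
  ultimately show False by simp
qed

lemma X_measurable [measurable]: "0 \<le> t \<Longrightarrow> X t \<in> M \<rightarrow>\<^sub>M state_borel S"
  using adapted[of t] sets_F[of "ennreal t"] by (auto simp: measurable_def space_F)

lemma X_measurable_F: "0 \<le> s \<Longrightarrow> s \<le> t \<Longrightarrow> X s \<in> F (ennreal t) \<rightarrow>\<^sub>M state_borel S"
  using adapted[of s] sets_F_mono[of "ennreal s" "ennreal t"]
  by (auto simp: measurable_def space_F ennreal_leI)

lemma X_measurable_P: "x \<in> state_space S \<Longrightarrow> 0 \<le> t \<Longrightarrow> X t \<in> P x \<rightarrow>\<^sub>M state_borel S"
  using X_measurable measurable_cong_sets sets_P by blast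

lemma borel_measurable_P: "x \<in> state_space S \<Longrightarrow> borel_measurable (P x) = borel_measurable M"
  by (rule measurable_cong_sets) (simp_all add: sets_P)

lemma F_le_M: "f \<in> F t \<rightarrow>\<^sub>M N \<Longrightarrow> f \<in> M \<rightarrow>\<^sub>M N"
  using sets_F[of t] by (auto simp: measurable_def space_F)

lemma on_grid_measurable:
  assumes "0 \<le> s" "0 \<le> u" "s + u \<le> t" "G \<in> sets (state_borel S)"
  shows "Measurable.pred (F (ennreal t)) (on_grid G s u)"
proof -
  have "Measurable.pred (F (ennreal t)) (\<lambda>\<omega>. X (s + u * real i / 2 ^ N) \<omega> \<in> G)" if "i \<le> 2 ^ N" for i N :: nat
  proof -
    have "u * real i / 2 ^ N \<le> u"
      using that assms(2) by (simp add: field_simps) (metis mult_left_mono of_nat_le_iff of_nat_numeral of_nat_power)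
    then have "X (s + u * real i / 2 ^ N) \<in> F (ennreal t) \<rightarrow>\<^sub>M state_borel S"
      by (intro X_measurable_F) (use assms in auto)
    from pred_sets2[OF assms(4) this] show ?thesis .
  qed
  then show ?thesis
    unfolding on_grid_def[abs_def] by (intro pred_intros_countable pred_intros_imp') auto
qed

subsection \<open>Markov property along dyadic grids\<close>

lemma transition_nn_measurable:
  assumes f: "f \<in> borel_measurable (state_borel S)" and u: "0 \<le> u"
  shows "(\<lambda>x. \<integral>\<^sup>+\<omega>. f (X u \<omega>) \<partial>P x) \<in> borel_measurable (state_borel S)"
  using f
proof (induct rule: borel_measurable_induct)
  case (cong f g)
  have "(\<integral>\<^sup>+\<omega>. f (X u \<omega>) \<partial>P x) = (\<integral>\<^sup>+\<omega>. g (X u \<omega>) \<partial>P x)" if "x \<in> space (state_borel S)" for x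
    using that cong(3) path_in_state_space[OF _ u]
    by (intro nn_integral_cong) (auto simp: space_state_borel space_P)
  then show ?case using cong(4) by (simp cong: measurable_cong)
next
  case (set B)
  have "(\<integral>\<^sup>+\<omega>. indicator B (X u \<omega>) \<partial>P x) = emeasure (P x) {\<omega>\<in>space M. X u \<omega> \<in> B}"
    if "x \<in> space (state_borel S)" for x
  proof -
    have x: "x \<in> state_space S" using that by (simp add: space_state_borel)
    have "{\<omega>\<in>space (P x). X u \<omega> \<in> B} \<in> sets (P x)"
      using measurable_sets[OF X_measurable_P[OF x u] set] by (simp add: vimage_def Int_def conj_commute)
    then have "emeasure (P x) {\<omega>\<in>space M. X u \<omega> \<in> B} =
        (\<integral>\<^sup>+\<omega>. indicator {\<omega>\<in>space M. X u \<omega> \<in> B} \<omega> \<partial>P x)"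
      using space_P[OF x] by simp
    also have "\<dots> = (\<integral>\<^sup>+\<omega>. indicator B (X u \<omega>) \<partial>P x)"
      using space_P[OF x] by (intro nn_integral_cong) (auto split: split_indicator)
    finally show ?thesis ..
  qed
  then show ?case using transition_measurable[OF u set] by (simp cong: measurable_cong)
next
  case (mult f c)
  have "(\<integral>\<^sup>+\<omega>. c * f (X u \<omega>) \<partial>P x) = c * (\<integral>\<^sup>+\<omega>. f (X u \<omega>) \<partial>P x)" if "x \<in> space (state_borel S)" for x
    using that measurable_compose[OF X_measurable_P[OF _ u] mult(2)]
    by (intro nn_integral_cmult) (auto simp: space_state_borel)
  then show ?case using mult by (simp cong: measurable_cong)
next
  case (add f g)
  have "(\<integral>\<^sup>+\<omega>. g (X u \<omega>) + f (X u \<omega>) \<partial>P x) = (\<integral>\<^sup>+\<omega>. g (X u \<omega>) \<partial>P x) + (\<integral>\<^sup>+\<omega>. f (X u \<omega>) \<partial>P x)"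
    if "x \<in> space (state_borel S)" for x
    using that measurable_compose[OF X_measurable_P[OF _ u] add(1)]
      measurable_compose[OF X_measurable_P[OF _ u] add(4)]
    by (intro nn_integral_add) (auto simp: space_state_borel)
  then show ?case using add by (simp cong: measurable_cong)
next
  case (seq U)
  have "(\<integral>\<^sup>+\<omega>. (SUP i. U i (X u \<omega>)) \<partial>P x) = (SUP i. \<integral>\<^sup>+\<omega>. U i (X u \<omega>) \<partial>P x)"
    if "x \<in> space (state_borel S)" for x
    using that measurable_compose[OF X_measurable_P[OF _ u] seq(1)] seq(4)
    by (intro nn_integral_monotone_convergence_SUP)
      (auto simp: space_state_borel incseq_def le_fun_def)
  moreover have "(SUP i. U i) = (\<lambda>x. SUP i. U i x)" by (rule ext) (rule SUP_apply)
  ultimately show ?case using seq(1,3) by (simp cong: measurable_cong)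
qed

text \<open>This is \<open>strong_markov\<close> at the constant stopping time \<open>s\<close>;
  events known at time \<open>s\<close> belong to its pre-sigma-algebra.\<close>

lemma markov_sets:
  assumes x: "x \<in> state_space S" and s: "0 \<le> s" and u: "0 \<le> u"
    and A: "A \<in> sets (F (ennreal s))" and B: "B \<in> sets (state_borel S)"
  shows "(\<integral>\<^sup>+\<omega>. indicator A \<omega> * indicator B (X (s + u) \<omega>) \<partial>P x) =
    (\<integral>\<^sup>+\<omega>. indicator A \<omega> * (\<integral>\<^sup>+\<omega>'. indicator B (X u \<omega>') \<partial>P (X s \<omega>)) \<partial>P x)"
proof -
  have T: "stopping_time F (\<lambda>_. ennreal s)" by (rule stopping_time_const)
  have "{\<omega> \<in> A. ennreal s \<le> t} \<in> sets (F t)" for t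
    using A sets_F_mono[of "ennreal s" t] by (cases "ennreal s \<le> t") auto
  then have "A \<in> sets (pre_sigma (\<lambda>_. ennreal s))" by (intro sets_pre_sigmaI[OF T])
  from strong_markov[OF x T this u B]
  have eq: "emeasure (P x) {\<omega>\<in>A. X (s + u) \<omega> \<in> B} =
    (\<integral>\<^sup>+\<omega>. emeasure (P (X s \<omega>)) {\<omega>'\<in>space M. X u \<omega>' \<in> B} * indicator A \<omega> \<partial>P x)"
    using s by simp
  have AM: "A \<in> sets M" "A \<subseteq> space M"
    using A sets_F sets.sets_into_space by blast+
  have ev: "{\<omega>\<in>space M. X r \<omega> \<in> B} \<in> sets M" if "0 \<le> r" for r
    using measurable_sets[OF X_measurable[OF that] B] by (simp add: vimage_def Int_def conj_commute)
  have "{\<omega>\<in>A. X (s + u) \<omega> \<in> B} = A \<inter> {\<omega>\<in>space M. X (s + u) \<omega> \<in> B}"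
    using AM by auto
  then have m: "{\<omega>\<in>A. X (s + u) \<omega> \<in> B} \<in> sets (P x)"
    using ev[of "s + u"] AM s u sets_P[OF x] by auto
  have "(\<integral>\<^sup>+\<omega>. indicator A \<omega> * indicator B (X (s + u) \<omega>) \<partial>P x) =
      (\<integral>\<^sup>+\<omega>. indicator {\<omega>\<in>A. X (s + u) \<omega> \<in> B} \<omega> \<partial>P x)"
    by (intro nn_integral_cong) (auto split: split_indicator)
  also have "\<dots> = emeasure (P x) {\<omega>\<in>A. X (s + u) \<omega> \<in> B}" using m by simp
  also note eq
  also have "(\<integral>\<^sup>+\<omega>. emeasure (P (X s \<omega>)) {\<omega>'\<in>space M. X u \<omega>' \<in> B} * indicator A \<omega> \<partial>P x) =
      (\<integral>\<^sup>+\<omega>. indicator A \<omega> * (\<integral>\<^sup>+\<omega>'. indicator B (X u \<omega>') \<partial>P (X s \<omega>)) \<partial>P x)"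
  proof (intro nn_integral_cong)
    fix \<omega> assume "\<omega> \<in> space (P x)"
    then have X: "X s \<omega> \<in> state_space S" using path_in_state_space s space_P[OF x] by auto
    have "emeasure (P (X s \<omega>)) {\<omega>'\<in>space M. X u \<omega>' \<in> B} =
        (\<integral>\<^sup>+\<omega>'. indicator {\<omega>'\<in>space M. X u \<omega>' \<in> B} \<omega>' \<partial>P (X s \<omega>))"
      using ev[OF u] sets_P[OF X] by simp
    also have "\<dots> = (\<integral>\<^sup>+\<omega>'. indicator B (X u \<omega>') \<partial>P (X s \<omega>))"
      using space_P[OF X] by (intro nn_integral_cong) (auto split: split_indicator)
    finally show "emeasure (P (X s \<omega>)) {\<omega>'\<in>space M. X u \<omega>' \<in> B} * indicator A \<omega> =
        indicator A \<omega> * (\<integral>\<^sup>+\<omega>'. indicator B (X u \<omega>') \<partial>P (X s \<omega>))"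
      by (simp add: mult.commute)
  qed
  finally show ?thesis .
qed

lemma markov_indicator:
  assumes x: "x \<in> state_space S" and s: "0 \<le> s" and u: "0 \<le> u"
    and A: "A \<in> sets (F (ennreal s))" and f: "f \<in> borel_measurable (state_borel S)"
  shows "(\<integral>\<^sup>+\<omega>. indicator A \<omega> * f (X (s + u) \<omega>) \<partial>P x) =
    (\<integral>\<^sup>+\<omega>. indicator A \<omega> * (\<integral>\<^sup>+\<omega>'. f (X u \<omega>') \<partial>P (X s \<omega>)) \<partial>P x)"
  using f
proof (induct rule: borel_measurable_induct)
  have su: "0 \<le> s + u" using s u by simp
  have Xs: "X s \<omega> \<in> state_space S" if "\<omega> \<in> space (P x)" for \<omega>
    using that path_in_state_space[OF _ s] space_P[OF x] by auto
  have A'[measurable]: "A \<in> sets (P x)" using A sets_F sets_P[OF x] by blast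
  note [measurable] = X_measurable_P[OF _ u] X_measurable_P[OF _ s] X_measurable_P[OF _ su]
    transition_nn_measurable[OF _ u]
  have m1: "(\<lambda>\<omega>. g (X (s + u) \<omega>)) \<in> borel_measurable (P x)"
    and m2: "(\<lambda>\<omega>. \<integral>\<^sup>+\<omega>'. g (X u \<omega>') \<partial>P (X s \<omega>)) \<in> borel_measurable (P x)"
    if "g \<in> borel_measurable (state_borel S)" for g :: "_ \<Rightarrow> ennreal"
    using measurable_compose[OF X_measurable_P[OF x su] that]
      measurable_compose[OF X_measurable_P[OF x s] transition_nn_measurable[OF that u]] .
  have m3: "(\<lambda>\<omega>'. g (X u \<omega>')) \<in> borel_measurable (P y)"
    if "g \<in> borel_measurable (state_borel S)" "y \<in> state_space S" for g :: "_ \<Rightarrow> ennreal" and y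
    using measurable_compose[OF X_measurable_P[OF that(2) u] that(1)] .
  {
    case (cong f g)
    have 1: "(\<integral>\<^sup>+\<omega>. indicator A \<omega> * f (X (s + u) \<omega>) \<partial>P x) = (\<integral>\<^sup>+\<omega>. indicator A \<omega> * g (X (s + u) \<omega>) \<partial>P x)"
      using cong(3) path_in_state_space[OF _ su]
      by (intro nn_integral_cong) (auto simp: space_state_borel space_P[OF x])
    have "(\<integral>\<^sup>+\<omega>'. f (X u \<omega>') \<partial>P y) = (\<integral>\<^sup>+\<omega>'. g (X u \<omega>') \<partial>P y)" if "y \<in> state_space S" for y
      using cong(3) path_in_state_space[OF _ u]
      by (intro nn_integral_cong) (auto simp: space_state_borel space_P[OF that])
    then have "(\<integral>\<^sup>+\<omega>. indicator A \<omega> * (\<integral>\<^sup>+\<omega>'. f (X u \<omega>') \<partial>P (X s \<omega>)) \<partial>P x) =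
        (\<integral>\<^sup>+\<omega>. indicator A \<omega> * (\<integral>\<^sup>+\<omega>'. g (X u \<omega>') \<partial>P (X s \<omega>)) \<partial>P x)"
      using Xs by (intro nn_integral_cong) simp
    with 1 cong(4) show ?case by simp
  next
    case (set B)
    then show ?case by (rule markov_sets[OF x s u A])
  next
    case (mult f c)
    have "(\<integral>\<^sup>+\<omega>. indicator A \<omega> * (c * f (X (s + u) \<omega>)) \<partial>P x) =
        c * (\<integral>\<^sup>+\<omega>. indicator A \<omega> * f (X (s + u) \<omega>) \<partial>P x)"
      using m1[OF mult(2)] by (subst nn_integral_cmult[symmetric]) (auto simp: mult_ac)
    moreover have "(\<integral>\<^sup>+\<omega>. indicator A \<omega> * (\<integral>\<^sup>+\<omega>'. c * f (X u \<omega>') \<partial>P (X s \<omega>)) \<partial>P x) =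
        (\<integral>\<^sup>+\<omega>. c * (indicator A \<omega> * (\<integral>\<^sup>+\<omega>'. f (X u \<omega>') \<partial>P (X s \<omega>))) \<partial>P x)"
      using m3[OF mult(2) Xs] by (intro nn_integral_cong) (simp add: nn_integral_cmult mult_ac)
    moreover have "\<dots> = c * (\<integral>\<^sup>+\<omega>. indicator A \<omega> * (\<integral>\<^sup>+\<omega>'. f (X u \<omega>') \<partial>P (X s \<omega>)) \<partial>P x)"
      using m2[OF mult(2)] by (intro nn_integral_cmult) auto
    ultimately show ?case using mult(4) by simp
  next
    case (add f g)
    have "(\<integral>\<^sup>+\<omega>. indicator A \<omega> * (g (X (s + u) \<omega>) + f (X (s + u) \<omega>)) \<partial>P x) =
        (\<integral>\<^sup>+\<omega>. indicator A \<omega> * g (X (s + u) \<omega>) \<partial>P x) + (\<integral>\<^sup>+\<omega>. indicator A \<omega> * f (X (s + u) \<omega>) \<partial>P x)"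
      using m1[OF add(1)] m1[OF add(4)] by (subst nn_integral_add[symmetric]) (auto simp: distrib_left)
    moreover have "(\<integral>\<^sup>+\<omega>. indicator A \<omega> * (\<integral>\<^sup>+\<omega>'. g (X u \<omega>') + f (X u \<omega>') \<partial>P (X s \<omega>)) \<partial>P x) =
        (\<integral>\<^sup>+\<omega>. indicator A \<omega> * (\<integral>\<^sup>+\<omega>'. g (X u \<omega>') \<partial>P (X s \<omega>)) +
          indicator A \<omega> * (\<integral>\<^sup>+\<omega>'. f (X u \<omega>') \<partial>P (X s \<omega>)) \<partial>P x)"
      using m3[OF add(1) Xs] m3[OF add(4) Xs]
      by (intro nn_integral_cong) (simp add: nn_integral_add distrib_left)
    moreover have "\<dots> = (\<integral>\<^sup>+\<omega>. indicator A \<omega> * (\<integral>\<^sup>+\<omega>'. g (X u \<omega>') \<partial>P (X s \<omega>)) \<partial>P x) +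
          (\<integral>\<^sup>+\<omega>. indicator A \<omega> * (\<integral>\<^sup>+\<omega>'. f (X u \<omega>') \<partial>P (X s \<omega>)) \<partial>P x)"
      using m2[OF add(1)] m2[OF add(4)] by (intro nn_integral_add) auto
    ultimately show ?case using add(3,7) by simp
  next
    case (seq U)
    have mono: "\<And>i j y. i \<le> j \<Longrightarrow> U i y \<le> U j y" using seq(4) by (auto simp: incseq_def le_fun_def)
    have "(\<integral>\<^sup>+\<omega>. indicator A \<omega> * (SUP i. U i (X (s + u) \<omega>)) \<partial>P x) =
        (\<integral>\<^sup>+\<omega>. (SUP i. indicator A \<omega> * U i (X (s + u) \<omega>)) \<partial>P x)"
      by (simp add: SUP_mult_left_ennreal)
    also have "\<dots> = (SUP i. \<integral>\<^sup>+\<omega>. indicator A \<omega> * U i (X (s + u) \<omega>) \<partial>P x)"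
      using m1[OF seq(1)] mono
      by (intro nn_integral_monotone_convergence_SUP) (auto simp: incseq_def le_fun_def intro!: mult_left_mono)
    also have "\<dots> = (SUP i. \<integral>\<^sup>+\<omega>. indicator A \<omega> * (\<integral>\<^sup>+\<omega>'. U i (X u \<omega>') \<partial>P (X s \<omega>)) \<partial>P x)"
      using seq(3) by simp
    also have "\<dots> = (\<integral>\<^sup>+\<omega>. (SUP i. indicator A \<omega> * (\<integral>\<^sup>+\<omega>'. U i (X u \<omega>') \<partial>P (X s \<omega>))) \<partial>P x)"
      using m2[OF seq(1)] mono
      by (intro nn_integral_monotone_convergence_SUP[symmetric])
        (auto simp: incseq_def le_fun_def intro!: mult_left_mono nn_integral_mono)
    also have "\<dots> = (\<integral>\<^sup>+\<omega>. indicator A \<omega> * (\<integral>\<^sup>+\<omega>'. (SUP i. U i (X u \<omega>')) \<partial>P (X s \<omega>)) \<partial>P x)"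
    proof (intro nn_integral_cong)
      fix \<omega> assume "\<omega> \<in> space (P x)"
      have "(\<integral>\<^sup>+\<omega>'. (SUP i. U i (X u \<omega>')) \<partial>P (X s \<omega>)) = (SUP i. \<integral>\<^sup>+\<omega>'. U i (X u \<omega>') \<partial>P (X s \<omega>))"
        using m3[OF seq(1) Xs[OF \<open>\<omega> \<in> space (P x)\<close>]] mono
        by (intro nn_integral_monotone_convergence_SUP) (auto simp: incseq_def le_fun_def)
      then show "(SUP i. indicator A \<omega> * (\<integral>\<^sup>+\<omega>'. U i (X u \<omega>') \<partial>P (X s \<omega>))) =
          indicator A \<omega> * (\<integral>\<^sup>+\<omega>'. (SUP i. U i (X u \<omega>')) \<partial>P (X s \<omega>))"
        by (simp add: SUP_mult_left_ennreal)
    qed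
    finally have "(\<integral>\<^sup>+\<omega>. indicator A \<omega> * (SUP i. U i (X (s + u) \<omega>)) \<partial>P x) =
      (\<integral>\<^sup>+\<omega>. indicator A \<omega> * (\<integral>\<^sup>+\<omega>'. (SUP i. U i (X u \<omega>')) \<partial>P (X s \<omega>)) \<partial>P x)" .
    moreover have "(SUP i. U i) = (\<lambda>x. SUP i. U i x)" by (rule ext) (rule SUP_apply)
    ultimately show ?case by simp
  }
qed

lemma markov:
  assumes x: "x \<in> state_space S" and s: "0 \<le> s" and u: "0 \<le> u"
    and W: "W \<in> borel_measurable (F (ennreal s))" and f: "f \<in> borel_measurable (state_borel S)"
  shows "(\<integral>\<^sup>+\<omega>. W \<omega> * f (X (s + u) \<omega>) \<partial>P x) =
    (\<integral>\<^sup>+\<omega>. W \<omega> * (\<integral>\<^sup>+\<omega>'. f (X u \<omega>') \<partial>P (X s \<omega>)) \<partial>P x)"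
proof -
  have su: "0 \<le> s + u" using s u by simp
  define a where "a = (\<lambda>\<omega>. f (X (s + u) \<omega>))"
  define b where "b = (\<lambda>\<omega>. \<integral>\<^sup>+\<omega>'. f (X u \<omega>') \<partial>P (X s \<omega>))"
  have a: "a \<in> borel_measurable (P x)" and b: "b \<in> borel_measurable (P x)"
    unfolding a_def b_def using measurable_compose[OF X_measurable_P[OF x su] f]
      measurable_compose[OF X_measurable_P[OF x s] transition_nn_measurable[OF f u]] .
  have m: "g \<in> borel_measurable (P x)" if "g \<in> borel_measurable (F (ennreal s))" for g :: "_ \<Rightarrow> ennreal"
    using F_le_M[OF that] borel_measurable_P[OF x] by auto
  have "(\<integral>\<^sup>+\<omega>. W \<omega> * a \<omega> \<partial>P x) = (\<integral>\<^sup>+\<omega>. W \<omega> * b \<omega> \<partial>P x)"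
    using W
  proof (induct rule: borel_measurable_induct)
    case (cong f g)
    have "space (P x) = space (F (ennreal s))" by (simp add: space_P[OF x] space_F)
    then have "(\<integral>\<^sup>+\<omega>. f \<omega> * c \<omega> \<partial>P x) = (\<integral>\<^sup>+\<omega>. g \<omega> * c \<omega> \<partial>P x)" for c
      using cong(3) by (intro nn_integral_cong) simp
    with cong(4) show ?case by simp
  next
    case (set A)
    then show ?case unfolding a_def b_def by (rule markov_indicator[OF x s u _ f])
  next
    case (mult g c)
    then show ?case using m[OF mult(2)] a b by (simp add: mult.assoc nn_integral_cmult)
  next
    case (add g g')
    then show ?case using m[OF add(1)] m[OF add(4)] a b by (simp add: distrib_right nn_integral_add)
  next
    case (seq U)
    have mono: "\<And>i j y. i \<le> j \<Longrightarrow> U i y \<le> U j y" using seq(4) by (auto simp: incseq_def le_fun_def)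
    have "(\<integral>\<^sup>+\<omega>. (SUP i. U i) \<omega> * c \<omega> \<partial>P x) = (SUP i. \<integral>\<^sup>+\<omega>. U i \<omega> * c \<omega> \<partial>P x)"
      if c: "c \<in> borel_measurable (P x)" for c
    proof -
      have "(\<integral>\<^sup>+\<omega>. (SUP i. U i) \<omega> * c \<omega> \<partial>P x) = (\<integral>\<^sup>+\<omega>. (SUP i. U i \<omega> * c \<omega>) \<partial>P x)"
        unfolding SUP_apply by (simp add: SUP_mult_right_ennreal)
      also have "\<dots> = (SUP i. \<integral>\<^sup>+\<omega>. U i \<omega> * c \<omega> \<partial>P x)"
        using m[OF seq(1)] c mono
        by (intro nn_integral_monotone_convergence_SUP) (auto simp: incseq_def le_fun_def intro!: mult_right_mono)
      finally show ?thesis .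
    qed
    from this[OF a] this[OF b] show ?case using seq(3) by simp
  qed
  then show ?thesis by (simp add: a_def b_def)
qed

text \<open>The list holds time increments rather than absolute times, so that the same list started
  at 0 describes the path after time \<open>s\<close>; this takes the place of translation
  operators.\<close>

fun path_prod :: "(real \<times> ((real ^ 'n) option \<Rightarrow> ennreal)) list \<Rightarrow> real \<Rightarrow> 'w \<Rightarrow> ennreal" where
  "path_prod [] s \<omega> = 1"
| "path_prod ((d, f) # bs) s \<omega> = f (X (s + d) \<omega>) * path_prod bs (s + d) \<omega>"

text \<open>Induction on the list: the first factor is known at time \<open>s + d\<close> and is
  absorbed into the weight \<open>W\<close>, so that the hypothesis applies from there; one use of
  \<open>markov\<close> leads back to time \<open>s\<close>. Both claims are proved together because
  the expectation over the tail becomes part of the next integrand and has to be measurable.\<close>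

lemma path_prod_markov:
  assumes "\<forall>(d, f)\<in>set bs. 0 \<le> d \<and> f \<in> borel_measurable (state_borel S)"
  shows "(\<lambda>z. \<integral>\<^sup>+\<omega>. path_prod bs 0 \<omega> \<partial>P z) \<in> borel_measurable (state_borel S)"
    and "\<And>x s W. x \<in> state_space S \<Longrightarrow> 0 \<le> s \<Longrightarrow> W \<in> borel_measurable (F (ennreal s)) \<Longrightarrow>
      (\<integral>\<^sup>+\<omega>. W \<omega> * path_prod bs s \<omega> \<partial>P x) =
      (\<integral>\<^sup>+\<omega>. W \<omega> * (\<integral>\<^sup>+\<omega>'. path_prod bs 0 \<omega>' \<partial>P (X s \<omega>)) \<partial>P x)"
  using assms
proof (induct bs)
  case Nil
  {
    case 1
    have "(\<integral>\<^sup>+\<omega>. path_prod [] 0 \<omega> \<partial>P z) = 1" if "z \<in> space (state_borel S)" for z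
      using prob_space.emeasure_space_1[OF prob] that by (simp add: space_state_borel)
    then show ?case by (simp cong: measurable_cong)
  next
    case (2 x s W)
    have "(\<integral>\<^sup>+\<omega>'. path_prod [] 0 \<omega>' \<partial>P (X s \<omega>)) = 1" if "\<omega> \<in> space (P x)" for \<omega>
      using prob_space.emeasure_space_1[OF prob] path_in_state_space[of \<omega> s] that space_P 2 by simp
    then show ?case by (intro nn_integral_cong) simp
  }
next
  case (Cons b bs)
  obtain d f where b: "b = (d, f)" by (cases b)
  {
    assume "\<forall>(d, f)\<in>set (b # bs). 0 \<le> d \<and> f \<in> borel_measurable (state_borel S)"
    then have d: "0 \<le> d" and f: "f \<in> borel_measurable (state_borel S)"
      and bs: "\<forall>(d, f)\<in>set bs. 0 \<le> d \<and> f \<in> borel_measurable (state_borel S)"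
      by (auto simp: b)
    define g where "g z = f z * (\<integral>\<^sup>+\<omega>. path_prod bs 0 \<omega> \<partial>P z)" for z
    have g: "g \<in> borel_measurable (state_borel S)"
      unfolding g_def using f Cons.hyps(1)[OF bs] by (rule borel_measurable_times_ennreal)
    have *: "(\<integral>\<^sup>+\<omega>. W \<omega> * path_prod (b # bs) s \<omega> \<partial>P x) = (\<integral>\<^sup>+\<omega>. W \<omega> * g (X (s + d) \<omega>) \<partial>P x)"
      if "x \<in> state_space S" "0 \<le> s" "W \<in> borel_measurable (F (ennreal s))" for x s W
    proof -
      have sd: "0 \<le> s + d" using that d by simp
      have W: "W \<in> borel_measurable (F (ennreal (s + d)))"
        using that(3) sets_F_mono[of "ennreal s" "ennreal (s + d)"] d
        by (auto simp: measurable_def space_F ennreal_leI)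
      have "(\<lambda>\<omega>. W \<omega> * f (X (s + d) \<omega>)) \<in> borel_measurable (F (ennreal (s + d)))"
        using W measurable_compose[OF adapted[OF sd] f] by (rule borel_measurable_times_ennreal)
      from Cons.hyps(2)[OF that(1) sd this bs] show ?thesis
        by (simp add: b g_def mult.assoc)
    qed
    have **: "(\<integral>\<^sup>+\<omega>. path_prod (b # bs) 0 \<omega> \<partial>P z) = (\<integral>\<^sup>+\<omega>. g (X d \<omega>) \<partial>P z)" if "z \<in> state_space S" for z
      using *[OF that order.refl, of "\<lambda>_. 1"] by simp
    note g d * **
  } note step = this
  {
    case 1
    show ?case
      by (rule measurable_cong[THEN iffD2, OF step(4)[OF 1] transition_nn_measurable[OF step(1,2)[OF 1]]])
        (simp add: space_state_borel)
  next
    case (2 x s W)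
    show ?case
      unfolding step(3)[OF 2(4,1,2,3)] markov[OF 2(1,2) step(2)[OF 2(4)] 2(3) step(1)[OF 2(4)]]
      using step(4)[OF 2(4)] path_in_state_space[OF _ 2(2)] space_P[OF 2(1)]
      by (intro nn_integral_cong) simp
  }
qed

lemma path_prod_measurable:
  assumes "\<forall>(d, f)\<in>set bs. 0 \<le> d \<and> f \<in> borel_measurable (state_borel S)" "0 \<le> s"
  shows "path_prod bs s \<in> borel_measurable M"
  using assms
proof (induct bs arbitrary: s)
  case (Cons b bs)
  obtain d f where b: "b = (d, f)" by (cases b)
  have "(\<lambda>\<omega>. f (X (s + d) \<omega>) * path_prod bs (s + d) \<omega>) \<in> borel_measurable M"
    by (intro borel_measurable_times_ennreal measurable_compose[OF X_measurable] Cons.hyps)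
      (use Cons.prems in \<open>auto simp: b\<close>)
  then show ?case by (simp add: b)
next
  case Nil
  have "path_prod [] s = (\<lambda>_. 1)" by (rule ext) simp
  then show ?case by simp
qed

lemma path_prod_replicate:
  "path_prod (replicate n (d, indicator G) @ [(0, f)]) s \<omega> =
    (if \<forall>i\<in>{1..n}. X (s + d * real i) \<omega> \<in> G then f (X (s + d * real n) \<omega>) else 0)"
proof (induct n arbitrary: s)
  case (Suc n)
  have "(\<forall>i\<in>{1..Suc n}. X (s + d * real i) \<omega> \<in> G) \<longleftrightarrow>
      X (s + d) \<omega> \<in> G \<and> (\<forall>i\<in>{1..n}. X (s + d * real (Suc i)) \<omega> \<in> G)"
  proof -
    have "{1..Suc n} = insert 1 (Suc ` {1..n})"
      by (simp only: image_Suc_atLeastAtMost) auto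
    then show ?thesis by (simp del: image_Suc_atLeastAtMost)
  qed
  moreover have "s + d * real (Suc i) = s + d + d * real i" for i
    by (simp add: algebra_simps)
  ultimately show ?case
    using Suc[of "s + d"] by (simp add: indicator_def add.assoc)
qed simp

definition grid_level :: "(real ^ 'n) option set \<Rightarrow> real \<Rightarrow> real \<Rightarrow> nat \<Rightarrow> 'w \<Rightarrow> bool" where
  "grid_level G s u N \<omega> \<longleftrightarrow> (\<forall>i\<le>2 ^ N. X (s + u * real i / 2 ^ N) \<omega> \<in> G)"

lemma on_grid_levels: "on_grid G s u \<omega> \<longleftrightarrow> (\<forall>N. grid_level G s u N \<omega>)"
  by (simp add: on_grid_def grid_level_def)

lemma grid_level_Suc:
  assumes "grid_level G s u (Suc N) \<omega>"
  shows "grid_level G s u N \<omega>"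
  unfolding grid_level_def
proof (intro allI impI)
  fix i :: nat assume "i \<le> 2 ^ N"
  then have "X (s + u * real (2 * i) / 2 ^ Suc N) \<omega> \<in> G"
    by (intro assms[unfolded grid_level_def, rule_format]) simp
  then show "X (s + u * real i / 2 ^ N) \<omega> \<in> G" by simp
qed

text \<open>The two zero increments test the starting point and read off \<open>f\<close> at the end
  without moving.\<close>

definition grid_list ::
  "(real ^ 'n) option set \<Rightarrow> real \<Rightarrow> ((real ^ 'n) option \<Rightarrow> ennreal) \<Rightarrow> nat \<Rightarrow>
    (real \<times> ((real ^ 'n) option \<Rightarrow> ennreal)) list" where
  "grid_list G u f N = (0, indicator G) # replicate (2 ^ N) (u / 2 ^ N, indicator G) @ [(0, f)]"

lemma path_prod_grid_list:
  "path_prod (grid_list G u f N) s \<omega> = f (X (s + u) \<omega>) * indicator {\<omega>. grid_level G s u N \<omega>} \<omega>"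
proof -
  have "(\<forall>i\<le>n. Q i) \<longleftrightarrow> (\<forall>i\<in>insert 0 {1..n}. Q i)" for n :: nat and Q
  proof -
    have "{..n} = insert 0 {1..n}" by auto
    then have "(\<forall>i\<in>{..n}. Q i) \<longleftrightarrow> (\<forall>i\<in>insert 0 {1..n}. Q i)" by (simp only:)
    then show ?thesis by (simp only: Ball_def atMost_iff)
  qed
  then have "grid_level G s u N \<omega> \<longleftrightarrow> X s \<omega> \<in> G \<and> (\<forall>i\<in>{1..2 ^ N}. X (s + u / 2 ^ N * real i) \<omega> \<in> G)"
    unfolding grid_level_def by simp
  then show ?thesis
    unfolding grid_list_def append_Cons path_prod.simps add_0_right path_prod_replicate
    by (simp add: indicator_def)
qed

lemma grid_list_ok:
  assumes "G \<in> sets (state_borel S)" "0 \<le> u" "f \<in> borel_measurable (state_borel S)"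
  shows "\<forall>(d, g)\<in>set (grid_list G u f N). 0 \<le> d \<and> g \<in> borel_measurable (state_borel S)"
  using assms by (auto simp: grid_list_def)

lemma path_prod_grid_list_Suc_le:
  "path_prod (grid_list G u f (Suc N)) s \<omega> \<le> path_prod (grid_list G u f N) s \<omega>"
  using grid_level_Suc[of G s u N \<omega>] by (auto simp: path_prod_grid_list indicator_def)

lemma INF_path_prod_grid_list:
  "(INF N. path_prod (grid_list G u f N) s \<omega>) = f (X (s + u) \<omega>) * indicator {\<omega>. on_grid G s u \<omega>} \<omega>"
proof (cases "on_grid G s u \<omega>")
  case True
  then show ?thesis by (simp add: path_prod_grid_list on_grid_levels)
next
  case False
  then obtain N where "\<not> grid_level G s u N \<omega>" by (auto simp: on_grid_levels)
  then have "(INF N. path_prod (grid_list G u f N) s \<omega>) \<le> 0"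
    by (intro INF_lower2[of N]) (auto simp: path_prod_grid_list)
  with False show ?thesis by simp
qed

text \<open>At a fixed level the grid condition is a finite product, covered by
  \<open>path_prod_markov\<close>. The levels decrease, and monotone convergence from above demands
  finite integrals, hence the bound \<open>c\<close>.\<close>

lemma markov_on_grid:
  assumes x: "x \<in> state_space S" and s: "0 \<le> s" and u: "0 \<le> u"
    and A: "A \<in> sets (F (ennreal s))" and G: "G \<in> sets (state_borel S)"
    and f: "f \<in> borel_measurable (state_borel S)" and c: "c < \<top>" "\<And>y. f y \<le> c"
  shows "(\<integral>\<^sup>+\<omega>. indicator A \<omega> * (f (X (s + u) \<omega>) * indicator {\<omega>. on_grid G s u \<omega>} \<omega>) \<partial>P x) =
    (\<integral>\<^sup>+\<omega>. indicator A \<omega> * (\<integral>\<^sup>+\<omega>'. f (X u \<omega>') * indicator {\<omega>. on_grid G 0 u \<omega>} \<omega>' \<partial>P (X s \<omega>)) \<partial>P x)"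
proof -
  have mP: "path_prod (grid_list G u f N) r \<in> borel_measurable (P z)" if "0 \<le> r" "z \<in> state_space S" for N r z
    using path_prod_measurable[OF grid_list_ok[OF G u f] that(1)] borel_measurable_P[OF that(2)] by auto
  have AP[measurable]: "A \<in> sets (P x)" using A sets_F sets_P[OF x] by blast
  have bd: "path_prod (grid_list G u f N) r \<omega> \<le> c" for N r \<omega>
    using c(2) by (auto simp: path_prod_grid_list indicator_def)
  have fin: "(\<integral>\<^sup>+\<omega>. g \<omega> \<partial>P z) \<le> c" if "z \<in> state_space S" "\<And>\<omega>. g \<omega> \<le> c" for z g
    using nn_integral_mono[of "P z" g "\<lambda>_. c"] that prob_space.emeasure_space_1[OF prob, of z] by simp
  define \<Phi> where "\<Phi> N z = (\<integral>\<^sup>+\<omega>. path_prod (grid_list G u f N) 0 \<omega> \<partial>P z)" for N z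
  have \<Phi>: "\<Phi> N \<in> borel_measurable (state_borel S)" for N
    unfolding \<Phi>_def[abs_def] by (rule path_prod_markov(1)[OF grid_list_ok[OF G u f]])
  have INF\<Phi>: "(INF N. \<Phi> N z) = (\<integral>\<^sup>+\<omega>. f (X u \<omega>) * indicator {\<omega>. on_grid G 0 u \<omega>} \<omega> \<partial>P z)"
    if z: "z \<in> state_space S" for z
  proof -
    have "(\<integral>\<^sup>+\<omega>. (INF N. path_prod (grid_list G u f N) 0 \<omega>) \<partial>P z) = (INF N. \<Phi> N z)"
      unfolding \<Phi>_def using mP[OF order.refl z] path_prod_grid_list_Suc_le
      by (intro nn_integral_monotone_convergence_INF_AE[where i=0])
        (auto intro!: le_less_trans[OF fin[OF z bd] c(1)])
    then show ?thesis by (simp add: INF_path_prod_grid_list)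
  qed
  have ind_INF: "(INF N. indicator A \<omega> * g N) = indicator A \<omega> * (INF N. g N)" for \<omega> and g :: "nat \<Rightarrow> ennreal"
    by (auto simp: indicator_def)
  have "(\<integral>\<^sup>+\<omega>. indicator A \<omega> * (f (X (s + u) \<omega>) * indicator {\<omega>. on_grid G s u \<omega>} \<omega>) \<partial>P x) =
      (\<integral>\<^sup>+\<omega>. (INF N. indicator A \<omega> * path_prod (grid_list G u f N) s \<omega>) \<partial>P x)"
    unfolding ind_INF INF_path_prod_grid_list ..
  also have "\<dots> = (INF N. \<integral>\<^sup>+\<omega>. indicator A \<omega> * path_prod (grid_list G u f N) s \<omega> \<partial>P x)"
    using mP[OF s x] path_prod_grid_list_Suc_le
    by (intro nn_integral_monotone_convergence_INF_AE[where i=0])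
      (auto intro!: le_less_trans[OF fin[OF x] c(1)] mult_left_mono simp: bd indicator_def)
  also have "\<dots> = (INF N. \<integral>\<^sup>+\<omega>. indicator A \<omega> * \<Phi> N (X s \<omega>) \<partial>P x)"
    unfolding \<Phi>_def using A by (subst path_prod_markov(2)[OF grid_list_ok[OF G u f] x s]) auto
  also have "\<dots> = (\<integral>\<^sup>+\<omega>. (INF N. indicator A \<omega> * \<Phi> N (X s \<omega>)) \<partial>P x)"
  proof (intro nn_integral_monotone_convergence_INF_AE[where i=0, symmetric])
    have "indicator A \<omega> * \<Phi> 0 (X s \<omega>) \<le> c" if "\<omega> \<in> space (P x)" for \<omega>
      using fin[OF path_in_state_space[OF _ s] bd] that
      by (auto simp: \<Phi>_def space_P[OF x] indicator_def)
    then have "(\<integral>\<^sup>+\<omega>. indicator A \<omega> * \<Phi> 0 (X s \<omega>) \<partial>P x) \<le> (\<integral>\<^sup>+\<omega>. c \<partial>P x)"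
      by (intro nn_integral_mono)
    also have "\<dots> < \<infinity>" using fin[OF x, of "\<lambda>_. c"] c(1) by (auto intro: le_less_trans)
    finally show "(\<integral>\<^sup>+\<omega>. indicator A \<omega> * \<Phi> 0 (X s \<omega>) \<partial>P x) < \<infinity>" .
    show "(\<lambda>\<omega>. indicator A \<omega> * \<Phi> N (X s \<omega>)) \<in> borel_measurable (P x)" for N
      using measurable_compose[OF X_measurable_P[OF x s] \<Phi>] by auto
  qed (auto simp: \<Phi>_def intro!: mult_left_mono nn_integral_mono path_prod_grid_list_Suc_le)
  also have "\<dots> = (\<integral>\<^sup>+\<omega>. indicator A \<omega> *
      (\<integral>\<^sup>+\<omega>'. f (X u \<omega>') * indicator {\<omega>. on_grid G 0 u \<omega>} \<omega>' \<partial>P (X s \<omega>)) \<partial>P x)"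
    unfolding ind_INF using path_in_state_space[OF _ s] space_P[OF x]
    by (intro nn_integral_cong) (simp add: INF\<Phi>)
  finally show ?thesis .
qed

subsection \<open>Excessive functions as supermartingales\<close>

lemma on_grid_measurable_P:
  assumes "x \<in> state_space S" "0 \<le> s" "0 \<le> u" "G \<in> sets (state_borel S)"
  shows "Measurable.pred (P x) (on_grid G s u)"
proof -
  have "Measurable.pred M (on_grid G s u)"
    using on_grid_measurable[OF assms(2,3) order.refl assms(4)] by (rule F_le_M)
  then show ?thesis by (simp only: measurable_cong_sets[OF sets_P[OF assms(1)] refl])
qed

text \<open>Almost surely the measurable grid event implies survival in \<open>D\<close> beyond time
  \<open>u\<close>, since \<open>D \<inter> state_interior S\<close> is open. So the integral is
  below the killed semigroup, to which excessivity applies.\<close>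

lemma killed_on_grid_le:
  assumes D: "openin (one_point S) D" and G: "G \<subseteq> D \<inter> state_interior S"
    and Gc: "openin (one_point S) (state_interior S - G)"
    and H: "excessive_on S P X D H" and z: "z \<in> G" and u: "0 \<le> u"
  shows "(\<integral>\<^sup>+\<omega>. H (X u \<omega>) * indicator G (X u \<omega>) * indicator {\<omega>. on_grid G 0 u \<omega>} \<omega> \<partial>P z) \<le> H z"
proof -
  have z': "z \<in> state_space S" using z G state_interior_subset by blast
  have "(\<integral>\<^sup>+\<omega>. H (X u \<omega>) * indicator G (X u \<omega>) * indicator {\<omega>. on_grid G 0 u \<omega>} \<omega> \<partial>P z) =
      (\<integral>\<^sup>+\<omega>. H (X u \<omega>) * indicator G (X u \<omega>) * indicator {\<omega>. on_grid G 0 u \<omega>} \<omega> \<partial>completion (P z))"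
    by (simp add: nn_integral_completion)
  also have "\<dots> \<le> killed_semigroup P X D u H z"
    unfolding killed_semigroup_def
  proof (rule nn_integral_mono_AE)
    show "AE \<omega> in completion (P z). H (X u \<omega>) * indicator G (X u \<omega>) * indicator {\<omega>. on_grid G 0 u \<omega>} \<omega>
        \<le> H (X u \<omega>) * indicator {\<omega>. ennreal u < exit_time X D \<omega>} \<omega>"
      using AE_completion[OF AE_regular_path[OF z']]
    proof eventually_elim
      case (elim \<omega>)
      show ?case
      proof (cases "on_grid G 0 u \<omega>")
        case True
        have Xu: "X (0 + u) \<omega> \<in> state_interior S" using on_grid_end[OF True] G by auto
        have "ennreal u < exit_time X D \<omega>"
        proof (rule regular_path_exit_time[OF elim u, of "D \<inter> state_interior S"])
          show "openin (one_point S) (D \<inter> state_interior S)" using D openin_state_interior by blast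
          show "X u \<omega> \<in> D \<inter> state_interior S" using on_grid_end[OF True] G by auto
          show "X s \<omega> \<in> D" if "0 < s" "s \<le> u" for s
            using on_grid_imp[OF elim Gc order.refl Xu True, of s] that G by auto
        qed auto
        then show ?thesis by (auto simp: indicator_def)
      qed simp
    qed
  qed
  also have "\<dots> \<le> H z" using H z u G by (auto simp: excessive_on_def)
  finally show ?thesis .
qed

lemma grid_supermartingale:
  assumes D: "openin (one_point S) D" and G: "G \<subseteq> D \<inter> state_interior S"
    and Gc: "openin (one_point S) (state_interior S - G)"
    and H: "excessive_on S P X D H" and x: "x \<in> state_space S" and s: "0 \<le> s" and u: "0 \<le> u"
    and A: "A \<in> sets (F (ennreal s))"
  shows "(\<integral>\<^sup>+\<omega>. indicator A \<omega> * (H (X (s + u) \<omega>) * indicator G (X (s + u) \<omega>) * indicator {\<omega>. on_grid G s u \<omega>} \<omega>) \<partial>P x)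
    \<le> (\<integral>\<^sup>+\<omega>. indicator A \<omega> * (H (X s \<omega>) * indicator G (X s \<omega>)) \<partial>P x)"
proof -
  define K where "K = (\<lambda>y. H y * indicator G y)"
  have GS: "G \<in> sets (state_borel S)" using relatively_closed_sets G Gc by blast
  have K: "K \<in> borel_measurable (state_borel S)"
    unfolding K_def using H G GS by (intro borel_times_indicator[of H S D]) (auto simp: excessive_on_def)
  \<comment> \<open>\<open>markov_on_grid\<close> takes bounded functions, so \<open>K\<close> is
    truncated at height \<open>c\<close> and the monotone limit is taken afterwards.\<close>
  define K' where "K' c y = min (K y) (of_nat c)" for c :: nat and y
  have K': "K' c \<in> borel_measurable (state_borel S)" for c
    unfolding K'_def using K by auto
  have mono: "K' c y \<le> K' d y" if "c \<le> d" for c d y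
    unfolding K'_def using that by (auto simp: min.coboundedI2)
  have SUPK: "(SUP c. K' c y) = K y" for y
  proof (rule antisym)
    show "(SUP c. K' c y) \<le> K y" by (auto intro!: SUP_least simp: K'_def)
    show "K y \<le> (SUP c. K' c y)"
    proof (cases "K y = \<top>")
      case True
      then have "K' c y = of_nat c" for c by (simp add: K'_def)
      then show ?thesis by (simp add: True ennreal_SUP_of_nat_eq_top)
    next
      case False
      then obtain c :: nat where "K y < of_nat c"
        using ennreal_Ex_less_of_nat[of "K y"] by (auto simp: top.not_eq_extremum)
      then have "K y = K' c y" by (simp add: K'_def min_def less_imp_le)
      moreover have "K' c y \<le> (SUP c. K' c y)" by (rule SUP_upper) simp
      ultimately show ?thesis by simp
    qed
  qed
  have AP[measurable]: "A \<in> sets (P x)" using A sets_F sets_P[OF x] by blast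
  have su: "0 \<le> s + u" using s u by simp
  have gm: "(indicator {\<omega>. on_grid G s u \<omega>} :: _ \<Rightarrow> ennreal) \<in> borel_measurable (P x)"
    using on_grid_measurable_P[OF x s u GS] by (auto intro: borel_measurable_indicator')
  \<comment> \<open>Off \<open>G\<close> both sides are 0, because the grid contains time 0.\<close>
  have inner: "(\<integral>\<^sup>+\<omega>. K (X u \<omega>) * indicator {\<omega>. on_grid G 0 u \<omega>} \<omega> \<partial>P y) \<le> K y" if y: "y \<in> state_space S" for y
  proof (cases "y \<in> G")
    case True
    then show ?thesis using killed_on_grid_le[OF D G Gc H True u] by (simp add: K_def)
  next
    case False
    have "AE \<omega> in P y. K (X u \<omega>) * indicator {\<omega>. on_grid G 0 u \<omega>} \<omega> = 0"
      using AE_regular_path[OF y]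
      by eventually_elim (use False on_grid_start regular_path_start in \<open>force simp: indicator_def\<close>)
    then have "(\<integral>\<^sup>+\<omega>. K (X u \<omega>) * indicator {\<omega>. on_grid G 0 u \<omega>} \<omega> \<partial>P y) = 0"
      by (subst nn_integral_cong_AE[where v="\<lambda>_. 0"]) auto
    then show ?thesis by simp
  qed
  have "(\<integral>\<^sup>+\<omega>. indicator A \<omega> * (K (X (s + u) \<omega>) * indicator {\<omega>. on_grid G s u \<omega>} \<omega>) \<partial>P x) =
      (\<integral>\<^sup>+\<omega>. (SUP c. indicator A \<omega> * (K' c (X (s + u) \<omega>) * indicator {\<omega>. on_grid G s u \<omega>} \<omega>)) \<partial>P x)"
    by (simp add: SUP_mult_left_ennreal[symmetric] SUP_mult_right_ennreal[symmetric] SUPK)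
  also have "\<dots> = (SUP c. \<integral>\<^sup>+\<omega>. indicator A \<omega> * (K' c (X (s + u) \<omega>) * indicator {\<omega>. on_grid G s u \<omega>} \<omega>) \<partial>P x)"
    using measurable_compose[OF X_measurable_P[OF x su] K'] gm mono
    by (intro nn_integral_monotone_convergence_SUP)
      (auto simp: incseq_def le_fun_def intro!: mult_left_mono mult_right_mono)
  also have "\<dots> \<le> (\<integral>\<^sup>+\<omega>. indicator A \<omega> * K (X s \<omega>) \<partial>P x)"
  proof (rule SUP_least)
    fix c :: nat
    have "(\<integral>\<^sup>+\<omega>. indicator A \<omega> * (K' c (X (s + u) \<omega>) * indicator {\<omega>. on_grid G s u \<omega>} \<omega>) \<partial>P x) =
      (\<integral>\<^sup>+\<omega>. indicator A \<omega> * (\<integral>\<^sup>+\<omega>'. K' c (X u \<omega>') * indicator {\<omega>. on_grid G 0 u \<omega>} \<omega>' \<partial>P (X s \<omega>)) \<partial>P x)"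
      by (rule markov_on_grid[OF x s u A GS K', of "of_nat c"]) (auto simp: K'_def of_nat_less_top)
    also have "\<dots> \<le> (\<integral>\<^sup>+\<omega>. indicator A \<omega> * K (X s \<omega>) \<partial>P x)"
    proof (intro nn_integral_mono mult_left_mono)
      fix \<omega> assume "\<omega> \<in> space (P x)"
      then have y: "X s \<omega> \<in> state_space S" using path_in_state_space[OF _ s] space_P[OF x] by simp
      have "(\<integral>\<^sup>+\<omega>'. K' c (X u \<omega>') * indicator {\<omega>. on_grid G 0 u \<omega>} \<omega>' \<partial>P (X s \<omega>)) \<le>
          (\<integral>\<^sup>+\<omega>'. K (X u \<omega>') * indicator {\<omega>. on_grid G 0 u \<omega>} \<omega>' \<partial>P (X s \<omega>))"
        by (intro nn_integral_mono mult_right_mono) (auto simp: K'_def)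
      also have "\<dots> \<le> K (X s \<omega>)" by (rule inner[OF y])
      finally show "(\<integral>\<^sup>+\<omega>'. K' c (X u \<omega>') * indicator {\<omega>. on_grid G 0 u \<omega>} \<omega>' \<partial>P (X s \<omega>)) \<le> K (X s \<omega>)" .
    qed auto
    finally show "(\<integral>\<^sup>+\<omega>. indicator A \<omega> * (K' c (X (s + u) \<omega>) * indicator {\<omega>. on_grid G s u \<omega>} \<omega>) \<partial>P x)
      \<le> (\<integral>\<^sup>+\<omega>. indicator A \<omega> * K (X s \<omega>) \<partial>P x)" .
  qed
  finally show ?thesis by (simp add: K_def)
qed

section \<open>Optional stopping on an equidistant time grid\<close>

definition stays :: "(real ^ 'n) option set \<Rightarrow> real \<Rightarrow> nat \<Rightarrow> 'w \<Rightarrow> bool" where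
  "stays G d j \<omega> \<longleftrightarrow> (\<forall>l<j. on_grid G (d * real l) d \<omega>)"

definition killed_value ::
  "((real ^ 'n) option \<Rightarrow> ennreal) \<Rightarrow> (real ^ 'n) option set \<Rightarrow> real \<Rightarrow> nat \<Rightarrow> 'w \<Rightarrow> ennreal" where
  "killed_value H G d j \<omega> =
    H (X (d * real j) \<omega>) * indicator G (X (d * real j) \<omega>) * indicator {\<omega>. stays G d j \<omega>} \<omega>"

lemma stays_measurable:
  assumes "G \<in> sets (state_borel S)" "0 \<le> d"
  shows "Measurable.pred (F (ennreal (d * real j))) (stays G d j)"
proof -
  have "Measurable.pred (F (ennreal (d * real j))) (on_grid G (d * real l) d)" if "l < j" for l
  proof (rule on_grid_measurable)
    have "d * (real l + 1) \<le> d * real j" using that assms by (intro mult_left_mono) auto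
    then show "d * real l + d \<le> d * real j" by (simp add: algebra_simps)
  qed (use assms in auto)
  then show ?thesis
    unfolding stays_def[abs_def] by (intro pred_intros_countable pred_intros_imp') auto
qed

lemma killed_value_measurable:
  assumes H: "H \<in> borel_measurable (restrict_space (state_borel S) D)"
    and G: "G \<subseteq> D" "G \<in> sets (state_borel S)" and d: "0 \<le> d"
  shows "killed_value H G d j \<in> borel_measurable M"
proof -
  have "(\<lambda>\<omega>. H (X (d * real j) \<omega>) * indicator G (X (d * real j) \<omega>)) \<in> borel_measurable M"
    using d by (intro measurable_compose[OF X_measurable borel_times_indicator[OF H G]]) auto
  moreover have "(indicator {\<omega>. stays G d j \<omega>} :: _ \<Rightarrow> ennreal) \<in> borel_measurable M"
    using F_le_M[OF stays_measurable[OF G(2) d]] by (auto intro: borel_measurable_indicator')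
  ultimately show ?thesis
    unfolding killed_value_def[abs_def] by (rule borel_measurable_times_ennreal)
qed

text \<open>\<open>A j\<close> is the event of stopping at step \<open>j\<close>, and
  \<open>C N\<close> in the proof that of no stop before step \<open>N\<close>. The expected value
  collected so far plus the expected value still running does not increase from step to step and
  starts below \<open>H x\<close>. The running part is nonnegative and is dropped at each
  \<open>N\<close>, so stopping may be arbitrarily late or never happen.\<close>

lemma optional_stopping:
  assumes D: "openin (one_point S) D" and G: "G \<subseteq> D \<inter> state_interior S"
    and Gc: "openin (one_point S) (state_interior S - G)"
    and H: "excessive_on S P X D H" and x: "x \<in> state_space S" and d: "0 \<le> d"
    and A: "\<And>j. A j \<in> sets (F (ennreal (d * real j)))" and disj: "disjoint_family A"
  shows "(\<integral>\<^sup>+\<omega>. (\<Sum>j. indicator (A j) \<omega> * killed_value H G d j \<omega>) \<partial>P x) \<le> H x"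
proof -
  have GS: "G \<in> sets (state_borel S)" using relatively_closed_sets G Gc by blast
  have m: "killed_value H G d j \<in> borel_measurable (P x)" for j
    unfolding borel_measurable_P[OF x]
    using H G GS d by (intro killed_value_measurable[of H D]) (auto simp: excessive_on_def)
  have AP[measurable]: "A j \<in> sets (P x)" for j using A sets_F sets_P[OF x] by blast
  define C where "C N = space M - (\<Union>i<N. A i)" for N
  \<comment> \<open>\<open>C (Suc N)\<close> excludes stopping up to and including step
    \<open>N\<close>, so it is known at time \<open>d * real N\<close>, as the supermartingale step
    from \<open>N\<close> to \<open>Suc N\<close> requires.\<close>
  have CF: "C (Suc N) \<in> sets (F (ennreal (d * real N)))" for N
  proof -
    have "A i \<in> sets (F (ennreal (d * real N)))" if "i < Suc N" for i
    proof -
      have "ennreal (d * real i) \<le> ennreal (d * real N)"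
        using that d by (intro ennreal_leI mult_left_mono) auto
      from sets_F_mono[OF this] A[of i] show ?thesis by blast
    qed
    then have "space (F (ennreal (d * real N))) - (\<Union>i<Suc N. A i) \<in> sets (F (ennreal (d * real N)))"
      by (intro sets.compl_sets sets.finite_UN) auto
    then show ?thesis by (simp add: C_def space_F)
  qed
  have CP[measurable]: "C N \<in> sets (P x)" for N
    unfolding C_def space_P[OF x, symmetric] by measurable
  have step: "(\<integral>\<^sup>+\<omega>. indicator (C (Suc N)) \<omega> * killed_value H G d (Suc N) \<omega> \<partial>P x)
      \<le> (\<integral>\<^sup>+\<omega>. indicator (C (Suc N)) \<omega> * killed_value H G d N \<omega> \<partial>P x)" for N
  proof -
    \<comment> \<open>The past up to step \<open>N\<close> goes into the event \<open>B\<close>;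
      what remains is the grid condition on the next interval alone.\<close>
    define B where "B = C (Suc N) \<inter> {\<omega>\<in>space (F (ennreal (d * real N))). stays G d N \<omega>}"
    have B: "B \<in> sets (F (ennreal (d * real N)))"
      unfolding B_def using CF stays_measurable[OF GS d] by (intro sets.Int) (auto simp: pred_def)
    have B_eq: "indicator B \<omega> = indicator (C (Suc N)) \<omega> * (indicator {\<omega>. stays G d N \<omega>} \<omega> :: ennreal)"
      if "\<omega> \<in> space (P x)" for \<omega>
      using that by (auto simp: B_def space_F space_P[OF x] indicator_def)
    have stays_Suc: "stays G d (Suc N) \<omega> \<longleftrightarrow> stays G d N \<omega> \<and> on_grid G (d * real N) d \<omega>" for \<omega>
      by (auto simp: stays_def less_Suc_eq)
    have t: "d * real (Suc N) = d * real N + d" by (simp add: algebra_simps)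
    have "(\<integral>\<^sup>+\<omega>. indicator (C (Suc N)) \<omega> * killed_value H G d (Suc N) \<omega> \<partial>P x) =
        (\<integral>\<^sup>+\<omega>. indicator B \<omega> * (H (X (d * real N + d) \<omega>) * indicator G (X (d * real N + d) \<omega>) *
          indicator {\<omega>. on_grid G (d * real N) d \<omega>} \<omega>) \<partial>P x)"
      unfolding killed_value_def t stays_Suc
      by (intro nn_integral_cong) (auto simp only: B_eq, auto simp: indicator_def)
    also have "\<dots> \<le> (\<integral>\<^sup>+\<omega>. indicator B \<omega> * (H (X (d * real N) \<omega>) * indicator G (X (d * real N) \<omega>)) \<partial>P x)"
      using d by (intro grid_supermartingale[OF D G Gc H x _ d B]) auto
    also have "\<dots> = (\<integral>\<^sup>+\<omega>. indicator (C (Suc N)) \<omega> * killed_value H G d N \<omega> \<partial>P x)"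
      unfolding killed_value_def
      by (intro nn_integral_cong) (auto simp only: B_eq, auto simp: indicator_def)
    finally show ?thesis .
  qed
  have split: "indicator (C N) \<omega> = (indicator (A N) \<omega> + indicator (C (Suc N)) \<omega> :: ennreal)"
    if "\<omega> \<in> space (P x)" for N \<omega>
  proof -
    have "A N \<inter> A i = {}" if "i < N" for i using disj that by (auto simp: disjoint_family_on_def)
    then have "\<omega> \<in> A N \<Longrightarrow> \<omega> \<in> C N" using that by (auto simp: C_def space_P[OF x])
    then show ?thesis by (auto simp: C_def indicator_def less_Suc_eq)
  qed
  have "(\<Sum>j<N. \<integral>\<^sup>+\<omega>. indicator (A j) \<omega> * killed_value H G d j \<omega> \<partial>P x) +
      (\<integral>\<^sup>+\<omega>. indicator (C N) \<omega> * killed_value H G d N \<omega> \<partial>P x) \<le> H x" for N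
  proof (induct N)
    case 0
    have "(\<integral>\<^sup>+\<omega>. indicator (C 0) \<omega> * killed_value H G d 0 \<omega> \<partial>P x) \<le> (\<integral>\<^sup>+\<omega>. H x \<partial>P x)"
    proof (rule nn_integral_mono_AE)
      show "AE \<omega> in P x. indicator (C 0) \<omega> * killed_value H G d 0 \<omega> \<le> H x"
        using AE_regular_path[OF x]
        by eventually_elim (auto simp: killed_value_def indicator_def dest: regular_path_start)
    qed
    then show ?case using prob_space.emeasure_space_1[OF prob[OF x]] by simp
  next
    case (Suc N)
    have "(\<integral>\<^sup>+\<omega>. indicator (C N) \<omega> * killed_value H G d N \<omega> \<partial>P x) =
        (\<integral>\<^sup>+\<omega>. indicator (A N) \<omega> * killed_value H G d N \<omega> + indicator (C (Suc N)) \<omega> * killed_value H G d N \<omega> \<partial>P x)"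
      by (intro nn_integral_cong) (simp add: split[where N=N] distrib_right)
    also have "\<dots> = (\<integral>\<^sup>+\<omega>. indicator (A N) \<omega> * killed_value H G d N \<omega> \<partial>P x) +
        (\<integral>\<^sup>+\<omega>. indicator (C (Suc N)) \<omega> * killed_value H G d N \<omega> \<partial>P x)"
      using m by (intro nn_integral_add) auto
    finally have "(\<integral>\<^sup>+\<omega>. indicator (A N) \<omega> * killed_value H G d N \<omega> \<partial>P x) +
        (\<integral>\<^sup>+\<omega>. indicator (C (Suc N)) \<omega> * killed_value H G d (Suc N) \<omega> \<partial>P x) \<le>
        (\<integral>\<^sup>+\<omega>. indicator (C N) \<omega> * killed_value H G d N \<omega> \<partial>P x)"
      using add_left_mono[OF step[of N]] by metis
    from order_trans[OF add_left_mono[OF this] Suc] show ?case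
      by (simp add: add.assoc)
  qed
  then have part: "(\<Sum>j<N. \<integral>\<^sup>+\<omega>. indicator (A j) \<omega> * killed_value H G d j \<omega> \<partial>P x) \<le> H x" for N
    by (rule order_trans[OF add_increasing2[OF zero_le order.refl]])
  have "(\<integral>\<^sup>+\<omega>. (\<Sum>j. indicator (A j) \<omega> * killed_value H G d j \<omega>) \<partial>P x) =
      (\<Sum>j. \<integral>\<^sup>+\<omega>. indicator (A j) \<omega> * killed_value H G d j \<omega> \<partial>P x)"
    using m by (intro nn_integral_suminf) auto
  also have "\<dots> \<le> H x" unfolding suminf_eq_SUP by (intro SUP_least part)
  finally show ?thesis .
qed

subsection \<open>The Doob transform and the inversion\<close>

text \<open>Where \<open>f\<close> does not vanish the path is in the interior at time
  \<open>t\<close>, hence has been there all along and survives in \<open>E\<close>; killing at the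
  exit from \<open>E\<close> changes nothing.\<close>

lemma killed_semigroup_absorbed:
  assumes x: "x \<in> state_space S" and t: "0 \<le> t" and E: "state_interior S \<subseteq> E"
    and f: "\<And>y. y \<notin> state_interior S \<Longrightarrow> f y = 0"
  shows "killed_semigroup P X E t f x = (\<integral>\<^sup>+\<omega>. f (X t \<omega>) \<partial>P x)"
  unfolding killed_semigroup_def nn_integral_completion
proof (rule nn_integral_cong_AE)
  show "AE \<omega> in P x. f (X t \<omega>) * indicator {\<omega>. ennreal t < exit_time X E \<omega>} \<omega> = f (X t \<omega>)"
    using AE_regular_path[OF x]
  proof eventually_elim
    case (elim \<omega>)
    show ?case
    proof (cases "X t \<omega> \<in> state_interior S")
      case True
      have "ennreal t < exit_time X E \<omega>"
        using regular_path_interior_before[OF elim _ _ True] E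
        by (intro regular_path_exit_time[OF elim t openin_state_interior True E]) auto
      then show ?thesis by (simp add: indicator_def)
    qed (simp add: f)
  qed
qed

text \<open>Each step of the transform divides by \<open>h\<close> at its start and multiplies by
  \<open>h\<close> at its end. Along the list these factors telescope, and \<open>h\<close> at the
  last time remains. The indicator of the interior keeps to points where \<open>h\<close> is neither
  0 nor infinite, so that cancelling is legitimate; the weight \<open>W\<close> carries the
  conditions already tested.\<close>

lemma doob_fdd_markov:
  assumes h: "h \<in> borel_measurable (state_borel S)"
    and h0: "\<forall>x\<in>state_interior S. 0 < h x \<and> h x < \<top>"
    and bs: "\<forall>(t, B)\<in>set bs. B \<in> sets (state_borel S) \<and> B \<subseteq> state_interior S"
    and s: "0 \<le> s" "sorted (s # map fst bs)"
  shows "(\<lambda>z. indicator (state_interior S) z * (h z * doob_fdd S P X h s bs z)) \<in> borel_measurable (state_borel S)"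
    and "\<And>x W. x \<in> state_space S \<Longrightarrow> W \<in> borel_measurable (F (ennreal s)) \<Longrightarrow>
      (\<integral>\<^sup>+\<omega>. W \<omega> * (indicator (state_interior S) (X s \<omega>) * (h (X s \<omega>) * doob_fdd S P X h s bs (X s \<omega>))) \<partial>P x) =
      (\<integral>\<^sup>+\<omega>. W \<omega> * (indicator (state_interior S) (X s \<omega>) * (h (X (last (s # map fst bs)) \<omega>) *
        indicator {\<omega>. \<forall>(t, B)\<in>set bs. X t \<omega> \<in> B} \<omega>)) \<partial>P x)"
  using bs s
proof (induct bs arbitrary: s)
  case Nil
  {
    case 1
    show ?case
      unfolding doob_fdd.simps mult_1_right
      by (intro borel_measurable_times_ennreal borel_measurable_indicator h openin_imp_sets openin_state_interior)
  next
    case 2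
    show ?case by simp
  }
next
  case (Cons b bs)
  obtain t B where b: "b = (t, B)" by (cases b)
  have intS: "state_interior S \<in> sets (state_borel S)" by (rule openin_imp_sets[OF openin_state_interior])
  have main: "(\<lambda>z. indicator (state_interior S) z * (h z * doob_fdd S P X h s (b # bs) z)) \<in> borel_measurable (state_borel S)"
    "(\<integral>\<^sup>+\<omega>. W \<omega> * (indicator (state_interior S) (X s \<omega>) * (h (X s \<omega>) * doob_fdd S P X h s (b # bs) (X s \<omega>))) \<partial>P x) =
      (\<integral>\<^sup>+\<omega>. W \<omega> * (indicator (state_interior S) (X s \<omega>) * (h (X (last (s # map fst (b # bs))) \<omega>) *
        indicator {\<omega>. \<forall>(t, B)\<in>set (b # bs). X t \<omega> \<in> B} \<omega>)) \<partial>P x)"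
    if P1: "\<forall>(t, B)\<in>set (b # bs). B \<in> sets (state_borel S) \<and> B \<subseteq> state_interior S"
      and P2: "0 \<le> s" "sorted (s # map fst (b # bs))"
      and x: "x \<in> state_space S" and W: "W \<in> borel_measurable (F (ennreal s))" for x W s
  proof -
    have B: "B \<in> sets (state_borel S)" "B \<subseteq> state_interior S"
      and bs: "\<forall>(t, B)\<in>set bs. B \<in> sets (state_borel S) \<and> B \<subseteq> state_interior S"
      and st: "s \<le> t" and t: "0 \<le> t" and srt: "sorted (t # map fst bs)"
      using P1 P2 by (auto simp: b)
    define \<psi> where "\<psi> z = indicator (state_interior S) z * (h z * doob_fdd S P X h t bs z)" for z
    have \<psi>: "\<psi> \<in> borel_measurable (state_borel S)"
      unfolding \<psi>_def[abs_def] by (rule Cons.hyps(1)[OF bs t srt])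
    define \<phi> where "\<phi> z = indicator B z * \<psi> z" for z
    have \<phi>: "\<phi> \<in> borel_measurable (state_borel S)"
      unfolding \<phi>_def[abs_def] using \<psi> B by simp
    have \<phi>_eq: "\<phi> z = h z * (indicator B z * doob_fdd S P X h t bs z)" for z
      using B by (auto simp: \<phi>_def \<psi>_def indicator_def)
    have one: "indicator (state_interior S) z * (h z * doob_fdd S P X h s (b # bs) z) =
        indicator (state_interior S) z * (\<integral>\<^sup>+\<omega>. \<phi> (X (t - s) \<omega>) \<partial>P z)" for z
    proof (cases "z \<in> state_interior S")
      case True
      have zS: "z \<in> state_space S" using True state_interior_subset by auto
      have pos: "z \<in> positivity_set S h" "state_interior S \<subseteq> positivity_set S h"
        using True h0 state_interior_subset by (auto simp: positivity_set_def)
      have "doob_fdd S P X h s (b # bs) z = killed_semigroup P X (positivity_set S h) (t - s) \<phi> z / h z"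
        using pos by (simp add: b doob_semigroup_def \<phi>_eq[abs_def])
      also have "killed_semigroup P X (positivity_set S h) (t - s) \<phi> z = (\<integral>\<^sup>+\<omega>. \<phi> (X (t - s) \<omega>) \<partial>P z)"
        using st pos(2) by (intro killed_semigroup_absorbed zS) (auto simp: \<phi>_def \<psi>_def)
      finally have "h z * doob_fdd S P X h s (b # bs) z = h z * ((\<integral>\<^sup>+\<omega>. \<phi> (X (t - s) \<omega>) \<partial>P z) / h z)"
        by simp
      also have "\<dots> = (\<integral>\<^sup>+\<omega>. \<phi> (X (t - s) \<omega>) \<partial>P z)"
      proof -
        have "h z \<noteq> 0" "h z \<noteq> \<top>" using h0 True by force+
        then show ?thesis by (simp add: ennreal_times_divide mult.commute[of "h z"] mult_divide_eq_ennreal)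
      qed
      finally show ?thesis by simp
    qed simp
    show "(\<lambda>z. indicator (state_interior S) z * (h z * doob_fdd S P X h s (b # bs) z)) \<in> borel_measurable (state_borel S)"
      unfolding one using transition_nn_measurable[OF \<phi>, of "t - s"] st intS by simp
    have W1: "(\<lambda>\<omega>. W \<omega> * indicator (state_interior S) (X s \<omega>)) \<in> borel_measurable (F (ennreal s))"
      using W measurable_compose[OF adapted[OF P2(1)] borel_measurable_indicator[OF intS]]
      by (rule borel_measurable_times_ennreal)
    have sub: "f \<in> borel_measurable (F (ennreal t))" if "f \<in> borel_measurable (F (ennreal s))" for f :: "_ \<Rightarrow> ennreal"
      using that sets_F_mono[of "ennreal s" "ennreal t"] st
      by (auto simp: measurable_def space_F ennreal_leI)
    have W2: "(\<lambda>\<omega>. W \<omega> * indicator (state_interior S) (X s \<omega>) * indicator B (X t \<omega>)) \<in> borel_measurable (F (ennreal t))"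
      using sub[OF W1] measurable_compose[OF adapted[OF t] borel_measurable_indicator[OF B(1)]]
      by (rule borel_measurable_times_ennreal)
    have "(\<integral>\<^sup>+\<omega>. W \<omega> * (indicator (state_interior S) (X s \<omega>) * (h (X s \<omega>) * doob_fdd S P X h s (b # bs) (X s \<omega>))) \<partial>P x) =
        (\<integral>\<^sup>+\<omega>. W \<omega> * indicator (state_interior S) (X s \<omega>) * (\<integral>\<^sup>+\<omega>'. \<phi> (X (t - s) \<omega>') \<partial>P (X s \<omega>)) \<partial>P x)"
      unfolding one by (simp add: mult.assoc)
    also have "\<dots> = (\<integral>\<^sup>+\<omega>. W \<omega> * indicator (state_interior S) (X s \<omega>) * \<phi> (X (s + (t - s)) \<omega>) \<partial>P x)"
      using st by (intro markov[OF x P2(1) _ W1 \<phi>, symmetric]) auto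
    also have "\<dots> = (\<integral>\<^sup>+\<omega>. W \<omega> * indicator (state_interior S) (X s \<omega>) * indicator B (X t \<omega>) * \<psi> (X t \<omega>) \<partial>P x)"
      by (simp add: \<phi>_def mult.assoc)
    also have "\<dots> = (\<integral>\<^sup>+\<omega>. W \<omega> * indicator (state_interior S) (X s \<omega>) * indicator B (X t \<omega>) *
        (indicator (state_interior S) (X t \<omega>) * (h (X (last (t # map fst bs)) \<omega>) *
        indicator {\<omega>. \<forall>(t, B)\<in>set bs. X t \<omega> \<in> B} \<omega>)) \<partial>P x)"
      unfolding \<psi>_def by (rule Cons.hyps(2)[OF x W2 bs t srt])
    also have "\<dots> = (\<integral>\<^sup>+\<omega>. W \<omega> * (indicator (state_interior S) (X s \<omega>) * (h (X (last (s # map fst (b # bs))) \<omega>) *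
        indicator {\<omega>. \<forall>(t, B)\<in>set (b # bs). X t \<omega> \<in> B} \<omega>)) \<partial>P x)"
      using B(2) by (intro nn_integral_cong) (auto simp: b indicator_def mult.assoc)
    finally show "(\<integral>\<^sup>+\<omega>. W \<omega> * (indicator (state_interior S) (X s \<omega>) * (h (X s \<omega>) * doob_fdd S P X h s (b # bs) (X s \<omega>))) \<partial>P x) =
      (\<integral>\<^sup>+\<omega>. W \<omega> * (indicator (state_interior S) (X s \<omega>) * (h (X (last (s # map fst (b # bs))) \<omega>) *
        indicator {\<omega>. \<forall>(t, B)\<in>set (b # bs). X t \<omega> \<in> B} \<omega>)) \<partial>P x)" .
  qed
  {
    case 1
    have "None \<in> state_space S" by (simp add: state_space_eq)
    from main(1)[OF 1 this, of "\<lambda>_. 0"] show ?case by simp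
  next
    case 2
    then show ?case by (intro main(2)) auto
  }
qed

lemma doob_fdd_eq:
  assumes h: "h \<in> borel_measurable (state_borel S)"
    and h0: "\<forall>x\<in>state_interior S. 0 < h x \<and> h x < \<top>"
    and bs: "\<forall>(t, B)\<in>set bs. B \<in> sets (state_borel S) \<and> B \<subseteq> state_interior S"
    and s: "sorted (0 # map fst bs)" and x: "x \<in> state_interior S"
  shows "h x * doob_fdd S P X h 0 bs x =
    (\<integral>\<^sup>+\<omega>. h (X (last (0 # map fst bs)) \<omega>) * indicator {\<omega>. \<forall>(t, B)\<in>set bs. X t \<omega> \<in> B} \<omega> \<partial>P x)"
proof -
  have x': "x \<in> state_space S" using x state_interior_subset by auto
  have "(\<integral>\<^sup>+\<omega>. h x * doob_fdd S P X h 0 bs x \<partial>P x) = h x * doob_fdd S P X h 0 bs x"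
    using prob_space.emeasure_space_1[OF prob[OF x']] by simp
  moreover have "(\<integral>\<^sup>+\<omega>. h x * doob_fdd S P X h 0 bs x \<partial>P x) =
    (\<integral>\<^sup>+\<omega>. 1 * (indicator (state_interior S) (X 0 \<omega>) * (h (X 0 \<omega>) * doob_fdd S P X h 0 bs (X 0 \<omega>))) \<partial>P x)"
  proof (rule nn_integral_cong_AE)
    show "AE \<omega> in P x. h x * doob_fdd S P X h 0 bs x =
        1 * (indicator (state_interior S) (X 0 \<omega>) * (h (X 0 \<omega>) * doob_fdd S P X h 0 bs (X 0 \<omega>)))"
      using normal[OF x'] by eventually_elim (use x in simp)
  qed
  moreover have "\<dots> = (\<integral>\<^sup>+\<omega>. 1 * (indicator (state_interior S) (X 0 \<omega>) * (h (X (last (0 # map fst bs)) \<omega>) *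
        indicator {\<omega>. \<forall>(t, B)\<in>set bs. X t \<omega> \<in> B} \<omega>)) \<partial>P x)"
    by (rule doob_fdd_markov(2)[OF h h0 bs order.refl s x']) simp
  moreover have "\<dots> = (\<integral>\<^sup>+\<omega>. h (X (last (0 # map fst bs)) \<omega>) * indicator {\<omega>. \<forall>(t, B)\<in>set bs. X t \<omega> \<in> B} \<omega> \<partial>P x)"
  proof (rule nn_integral_cong_AE)
    show "AE \<omega> in P x. 1 * (indicator (state_interior S) (X 0 \<omega>) * (h (X (last (0 # map fst bs)) \<omega>) *
        indicator {\<omega>. \<forall>(t, B)\<in>set bs. X t \<omega> \<in> B} \<omega>)) =
        h (X (last (0 # map fst bs)) \<omega>) * indicator {\<omega>. \<forall>(t, B)\<in>set bs. X t \<omega> \<in> B} \<omega>"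
      using normal[OF x'] by eventually_elim (use x in simp)
  qed
  ultimately show ?thesis by simp
qed

text \<open>From a boundary point \<open>x\<close> the process rests, so the inverted time-changed
  process rests at \<open>z = I x\<close>. By the Inversion Property the h-transform from
  \<open>z\<close> does not charge the interior minus \<open>z\<close>; since \<open>h\<close> is
  positive there, neither does \<open>X\<close>.\<close>

lemma involution_interior:
  assumes IP: "inversion_property S P X I h v" and x: "x \<in> state_space S" and Ix: "I x \<in> state_interior S"
  shows "x \<in> state_interior S"
proof (rule ccontr)
  assume nx: "x \<notin> state_interior S"
  define z where "z = I x"
  have z: "z \<in> state_interior S" "z \<in> state_space S" using Ix state_interior_subset by (auto simp: z_def)
  obtain a where a: "z = Some a" "a \<in> interior S - {0}" using z by (auto simp: state_interior_def)
  define B where "B = Some ` (interior S - {0} - {a})"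
  have B_eq: "B = state_interior S - {z}" by (auto simp: B_def a state_interior_def)
  have oB: "openin (one_point S) B"
    unfolding B_def using interior_subset by (intro openin_one_point_Some open_Diff) auto
  \<comment> \<open>A nonempty open subset of Euclidean space is infinite, so a nonempty target for
    irreducibility is left.\<close>
  have "infinite (interior S - {0} - {a})"
  proof -
    have "\<not> finite (interior S)"
      using a finite_imp_not_open[of "interior S"] by auto
    then show ?thesis by simp
  qed
  then have neB: "B \<noteq> {}" unfolding B_def by (metis finite.emptyI image_is_empty)
  have h: "h \<in> borel_measurable (state_borel S)" and h0: "\<forall>x\<in>state_interior S. 0 < h x \<and> h x < \<top>"
    using IP by (auto simp: inversion_property_def excessive_def)
  have zero: "AE \<omega> in P z. X t \<omega> \<notin> B" if t: "0 \<le> t" for t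
  proof -
    have bs: "\<forall>(t, B)\<in>set [(t, B)]. B \<in> sets (state_borel S) \<and> B \<subseteq> state_interior S"
      using openin_imp_sets[OF oB] B_eq by auto
    have "sorted (0 # map fst [(t, B)])" using t by simp
    then have "emeasure (completion (P x))
          {\<omega>\<in>space (P x). \<forall>(t, B)\<in>set [(t, B)].
             time_change X v t \<omega> < \<top> \<and> I (X (enn2real (time_change X v t \<omega>)) \<omega>) \<in> B} =
        doob_fdd S P X h 0 [(t, B)] (I x)"
      using IP x bs unfolding inversion_property_def by blast
    moreover have "emeasure (completion (P x))
          {\<omega>\<in>space (completion (P x)). \<forall>(t, B)\<in>set [(t, B)].
             time_change X v t \<omega> < \<top> \<and> I (X (enn2real (time_change X v t \<omega>)) \<omega>) \<in> B} = 0"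
    proof (rule emeasure_eq_0_AE)
      show "AE \<omega> in completion (P x). \<not> (\<forall>(t, B)\<in>set [(t, B)].
             time_change X v t \<omega> < \<top> \<and> I (X (enn2real (time_change X v t \<omega>)) \<omega>) \<in> B)"
        using AE_completion[OF AE_regular_path[OF x]]
      proof eventually_elim
        case (elim \<omega>)
        \<comment> \<open>\<open>enn2real\<close> sends an infinite time change to 0, so the point
          reached is \<open>x\<close> in every case.\<close>
        have "X r \<omega> = x" if "0 \<le> r" for r
          using elim that nx x unfolding regular_path_def state_boundary_def by blast
        then have "X (enn2real (time_change X v t \<omega>)) \<omega> = x" by simp
        then show ?case by (simp add: B_eq z_def)
      qed
    qed
    ultimately have "h z * doob_fdd S P X h 0 [(t, B)] z = 0" by (simp add: z_def)
    then have "(\<integral>\<^sup>+\<omega>. h (X t \<omega>) * indicator {\<omega>. X t \<omega> \<in> B} \<omega> \<partial>P z) = 0"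
      unfolding doob_fdd_eq[OF h h0 bs \<open>sorted (0 # map fst [(t, B)])\<close> z(1)] by simp
    moreover have "(\<lambda>\<omega>. h (X t \<omega>) * indicator B (X t \<omega>)) \<in> borel_measurable (P z)"
      using h openin_imp_sets[OF oB] by (intro measurable_compose[OF X_measurable_P[OF z(2) t]]) simp
    moreover have "(\<lambda>\<omega>. h (X t \<omega>) * indicator {\<omega>. X t \<omega> \<in> B} \<omega>) = (\<lambda>\<omega>. h (X t \<omega>) * indicator B (X t \<omega>))"
      by (auto simp: indicator_def)
    ultimately have "AE \<omega> in P z. h (X t \<omega>) * indicator B (X t \<omega>) = 0"
      by (simp add: nn_integral_0_iff_AE)
    then show ?thesis
      by eventually_elim (use h0 B_eq in \<open>fastforce simp: indicator_def split: if_splits\<close>)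
  qed
  \<comment> \<open>As \<open>B\<close> is open and paths are right-continuous, a visit to
    \<open>B\<close> would show at a rational time.\<close>
  have "AE \<omega> in P z. \<forall>q\<in>\<rat> \<inter> {0..}. X q \<omega> \<notin> B"
    using zero by (subst AE_ball_countable) (auto intro: countable_rat countable_Int1)
  then have "AE \<omega> in P z. \<forall>t\<ge>0. X t \<omega> \<notin> B"
    using AE_regular_path[OF z(2)]
  proof eventually_elim
    case (elim \<omega>)
    show ?case
    proof (intro allI impI notI)
      fix t :: real assume t: "0 \<le> t" and "X t \<omega> \<in> B"
      then obtain e where e: "0 < e" "\<And>s. t \<le> s \<Longrightarrow> s < t + e \<Longrightarrow> X s \<omega> \<in> B"
        using regular_path_open[OF elim(2) t oB] by metis
      obtain q where "q \<in> \<rat>" "t < q" "q < t + e" using Rats_dense_in_real[of t "t + e"] e by auto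
      moreover from this have "X q \<omega> \<in> B" by (intro e(2)) auto
      ultimately show False using bspec[OF elim(1), of q] t by auto
    qed
  qed
  with irreducible[OF z(1) oB neB] show False by simp
qed

end

subsection \<open>The time change\<close>

text \<open>Floor plus one gives a grid point strictly to the right of \<open>r\<close>, as limits
  along \<open>at_right r\<close> demand. The lower cut at 0 serves the measurability proofs, in
  which the floor is replaced by an arbitrary integer.\<close>

definition grid_above :: "real \<Rightarrow> nat \<Rightarrow> real \<Rightarrow> real" where
  "grid_above s m r = max 0 (min s ((of_int \<lfloor>r * 2 ^ m\<rfloor> + 1) / 2 ^ m))"

lemma less_grid_above: "r < (of_int \<lfloor>r * 2 ^ m\<rfloor> + 1) / (2 ^ m :: real)"
  by (simp add: pos_less_divide_eq)

lemma grid_above_tendsto: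
  assumes "0 \<le> r" "r < s"
  shows "filterlim (\<lambda>m. grid_above s m r) (at_right r) sequentially"
  unfolding filterlim_at
proof
  have gt: "r < grid_above s m r" for m
    using less_grid_above[of r m] assms by (auto simp: grid_above_def)
  then show "eventually (\<lambda>m. grid_above s m r \<in> {r<..} \<and> grid_above s m r \<noteq> r) sequentially"
    by (simp add: less_imp_neq[THEN not_sym])
  have le: "grid_above s m r \<le> r + (1 / 2) ^ m" for m
  proof -
    have "grid_above s m r \<le> (of_int \<lfloor>r * 2 ^ m\<rfloor> + 1) / 2 ^ m"
      using less_grid_above[of r m] assms by (auto simp: grid_above_def)
    also have "\<dots> \<le> (r * 2 ^ m + 1) / 2 ^ m"
      by (intro divide_right_mono add_right_mono) auto
    also have "\<dots> = r + (1 / 2) ^ m" by (simp add: field_simps)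
    finally show ?thesis .
  qed
  have lim: "(\<lambda>m. r + (1 / 2) ^ m) \<longlonglongrightarrow> r + 0"
    by (intro tendsto_intros LIMSEQ_realpow_zero) auto
  show "(\<lambda>m. grid_above s m r) \<longlonglongrightarrow> r"
    by (rule tendsto_sandwich[OF _ _ tendsto_const lim[unfolded add_0_right]])
      (use gt le in \<open>auto intro!: always_eventually less_imp_le\<close>)
qed

text \<open>At \<open>r = s\<close> all samples equal \<open>g s\<close>; so right-continuity is
  asked for before \<open>s\<close> only, and the value at \<open>s\<close> involves no later
  time.\<close>

lemma liminf_grid_above:
  fixes g :: "real \<Rightarrow> ennreal"
  assumes "0 \<le> r" "r \<le> s" "r < s \<Longrightarrow> (g \<longlongrightarrow> g r) (at_right r)"
  shows "liminf (\<lambda>m. g (grid_above s m r)) = g r"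
proof (cases "r < s")
  case True
  have "(\<lambda>m. g (grid_above s m r)) \<longlonglongrightarrow> g r"
    using filterlim_compose[OF assms(3)[OF True] grid_above_tendsto[OF assms(1) True]] .
  then show ?thesis by (intro lim_imp_Liminf) auto
next
  case False
  then have "r = s" using assms by simp
  then have "grid_above s m r = r" for m
    using less_grid_above[of r m] assms by (auto simp: grid_above_def)
  then show ?thesis by (simp add: Liminf_const)
qed

text \<open>The function is a limit of functions of \<open>\<lfloor>r * 2 ^ m\<rfloor>\<close>,
  which take countably many values. It is needed for the additivity of the integral in
  \<open>additive_functional_strict\<close>.\<close>

lemma right_continuous_borel:
  fixes g :: "real \<Rightarrow> ennreal"
  assumes "\<And>r. 0 \<le> r \<Longrightarrow> r < s \<Longrightarrow> (g \<longlongrightarrow> g r) (at_right r)"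
  shows "(\<lambda>r. g r * indicator {0..s} r) \<in> borel_measurable borel"
proof -
  have "(\<lambda>r. g (grid_above s m r)) \<in> borel_measurable borel" for m
  proof -
    have "(\<lambda>r. r * 2 ^ m :: real) \<in> borel_measurable borel" by simp
    from measurable_compose[OF this measurable_real_floor]
    have "(\<lambda>r::real. \<lfloor>r * 2 ^ m\<rfloor>) \<in> borel \<rightarrow>\<^sub>M count_space UNIV" .
    from measurable_compose_countable[of "\<lambda>i _. g (max 0 (min s ((of_int i + 1) / 2 ^ m)))", OF _ this]
    show ?thesis by (simp add: grid_above_def)
  qed
  then have "(\<lambda>r. liminf (\<lambda>m. g (grid_above s m r)) * indicator {0..s} r) \<in> borel_measurable borel"
    by (intro borel_measurable_times_ennreal borel_measurable_liminf) auto
  moreover have "liminf (\<lambda>m. g (grid_above s m r)) * indicator {0..s} r = g r * indicator {0..s} r" for r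
    using liminf_grid_above[of r s g] assms by (auto simp: indicator_def)
  ultimately show ?thesis by simp
qed

lemma additive_functional_mono:
  "s \<le> s' \<Longrightarrow> additive_functional X v s \<omega> \<le> additive_functional X v s' \<omega>"
  unfolding additive_functional_def by (intro nn_integral_mono) (auto simp: indicator_def)

lemma additive_functional_before:
  assumes "0 \<le> s" "ennreal s < time_change X v t \<omega>"
  shows "additive_functional X v s \<omega> \<le> ennreal t"
proof (rule ccontr)
  assume "\<not> additive_functional X v s \<omega> \<le> ennreal t"
  then have "time_change X v t \<omega> \<le> ennreal s"
    unfolding time_change_def using assms(1) by (intro Inf_lower) auto
  with assms(2) show False by simp
qed

lemma additive_functional_after:
  assumes "time_change X v t \<omega> < ennreal s"
  shows "ennreal t < additive_functional X v s \<omega>"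
proof -
  obtain r where r: "0 \<le> r" "ennreal t < additive_functional X v r \<omega>" "ennreal r < ennreal s"
    using assms unfolding time_change_def Inf_less_iff by auto
  then have "r \<le> s" by (metis ennreal_less_iff less_imp_le)
  with r(2) show ?thesis by (metis additive_functional_mono order_less_le_trans)
qed

context standard_process
begin

text \<open>
  A version of the additive functional with rate \<open>f\<close> that is adapted without any completion: the
  path is sampled at grid points to the right of \<open>r\<close>, cut off at \<open>s\<close>, so that it agrees with the
  original wherever the path is right-continuous.
\<close>

definition clock :: "((real ^ 'n) option \<Rightarrow> ennreal) \<Rightarrow> real \<Rightarrow> 'w \<Rightarrow> ennreal" where
  "clock f s \<omega> = (\<integral>\<^sup>+r\<in>{0..s}. liminf (\<lambda>m. f (X (grid_above s m r) \<omega>)) \<partial>lborel)"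

lemma clock_measurable:
  assumes f: "f \<in> borel_measurable (state_borel S)" and s: "0 \<le> s"
  shows "clock f s \<in> borel_measurable (F (ennreal s))"
proof -
  have "(\<lambda>p. f (X (grid_above s m (snd p)) (fst p))) \<in> borel_measurable (F (ennreal s) \<Otimes>\<^sub>M lborel)" for m
  proof -
    have "(\<lambda>p. snd p * 2 ^ m) \<in> borel_measurable (F (ennreal s) \<Otimes>\<^sub>M (lborel :: real measure))"
      by measurable
    from measurable_compose[OF this measurable_real_floor]
    have fl: "(\<lambda>p. \<lfloor>snd p * 2 ^ m\<rfloor>) \<in> F (ennreal s) \<Otimes>\<^sub>M (lborel :: real measure) \<rightarrow>\<^sub>M count_space UNIV" .
    have "(\<lambda>p. f (X (max 0 (min s ((of_int i + 1) / 2 ^ m))) (fst p))) \<in> borel_measurable (F (ennreal s) \<Otimes>\<^sub>M (lborel :: real measure))" for i :: int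
      by (intro measurable_compose[OF measurable_fst] measurable_compose[OF X_measurable_F f])
        (use s in auto)
    from measurable_compose_countable[of "\<lambda>i p. f (X (max 0 (min s ((of_int i + 1) / 2 ^ m))) (fst p))", OF this fl]
    show ?thesis by (simp add: grid_above_def)
  qed
  then have "(\<lambda>p. liminf (\<lambda>m. f (X (grid_above s m (snd p)) (fst p))) * indicator {0..s} (snd p))
      \<in> borel_measurable (F (ennreal s) \<Otimes>\<^sub>M lborel)"
    by (intro borel_measurable_times_ennreal borel_measurable_liminf
        measurable_compose[OF measurable_snd borel_measurable_indicator]) auto
  then have "(\<lambda>\<omega>. \<integral>\<^sup>+r. liminf (\<lambda>m. f (X (grid_above s m r) \<omega>)) * indicator {0..s} r \<partial>lborel)
      \<in> borel_measurable (F (ennreal s))"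
    by (intro lborel.borel_measurable_nn_integral) (simp add: case_prod_unfold)
  then show ?thesis unfolding clock_def[abs_def] .
qed

lemma rate_right_continuous:
  assumes v: "\<forall>x\<in>state_interior S. 0 < v x"
    "continuous_map (subtopology (one_point S) (state_interior S)) euclidean v"
    and \<omega>: "regular_path x \<omega>" and r: "0 \<le> r" "X r \<omega> \<in> state_interior S"
  shows "((\<lambda>q. v (X q \<omega>)) \<longlongrightarrow> v (X r \<omega>)) (at_right r)"
    and "((\<lambda>q. ennreal (1 / v (X q \<omega>))) \<longlongrightarrow> ennreal (1 / v (X r \<omega>))) (at_right r)"
proof -
  have "limitin euclidean (\<lambda>q. v (X q \<omega>)) (v (X r \<omega>)) (at_right r)"
    using regular_path_limitin[OF \<omega> r(1)] openin_state_interior r(2) v(2)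
    by (rule limitin_continuous_on_open)
  then show *: "((\<lambda>q. v (X q \<omega>)) \<longlongrightarrow> v (X r \<omega>)) (at_right r)" by simp
  have "v (X r \<omega>) \<noteq> 0" using v(1) r(2) by force
  with * show "((\<lambda>q. ennreal (1 / v (X q \<omega>))) \<longlongrightarrow> ennreal (1 / v (X r \<omega>))) (at_right r)"
    by (intro tendsto_ennrealI tendsto_divide tendsto_const)
qed

text \<open>The cutoff to \<open>G\<close> is invisible here: the samples approach \<open>r\<close>
  from the right and eventually lie in the open set \<open>V\<close>, and at the last time
  \<open>r = s\<close> they all coincide with \<open>s\<close>.\<close>

lemma clock_eq_additive_functional:
  assumes v: "\<forall>x\<in>state_interior S. 0 < v x"
    "continuous_map (subtopology (one_point S) (state_interior S)) euclidean v"
    and \<omega>: "regular_path x \<omega>" and V: "openin (one_point S) V" "V \<subseteq> G" "V \<subseteq> state_interior S"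
    and path: "\<And>r. 0 \<le> r \<Longrightarrow> r \<le> s \<Longrightarrow> X r \<omega> \<in> V"
  shows "clock (\<lambda>y. ennreal (1 / v y) * indicator G y) s \<omega> = additive_functional X v s \<omega>"
  unfolding clock_def additive_functional_def
proof (intro nn_integral_cong)
  fix r :: real
  let ?f = "\<lambda>y. ennreal (1 / v y) * indicator G y"
  show "liminf (\<lambda>m. ?f (X (grid_above s m r) \<omega>)) * indicator {0..s} r =
      ennreal (1 / v (X r \<omega>)) * indicator {0..s} r"
  proof (cases "r \<in> {0..s}")
    case True
    then have r: "0 \<le> r" "r \<le> s" by auto
    have Xr: "X r \<omega> \<in> V" using path r by simp
    have ev: "eventually (\<lambda>q. X q \<omega> \<in> V) (at_right r)"
      using regular_path_limitin[OF \<omega> r(1)] V(1) Xr by (auto simp: limitin_def)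
    have "((\<lambda>q. ennreal (1 / v (X q \<omega>))) \<longlongrightarrow> ?f (X r \<omega>)) (at_right r)"
      using rate_right_continuous(2)[OF v \<omega> r(1)] Xr V by (auto simp: subset_iff)
    then have "((\<lambda>q. ?f (X q \<omega>)) \<longlongrightarrow> ?f (X r \<omega>)) (at_right r)"
      by (rule Lim_transform_eventually) (use ev V(2) in \<open>auto elim!: eventually_mono simp: subset_iff\<close>)
    from liminf_grid_above[of r s "\<lambda>q. ?f (X q \<omega>)", OF r this] show ?thesis
      using Xr V(2) by (auto simp: subset_iff)
  qed simp
qed

text \<open>By right-continuity \<open>v\<close> stays below \<open>c\<close>, a number above its
  value at time \<open>s\<close>, for a while; so the integral gains at least
  \<open>(b' - s) / c\<close>. Finiteness at \<open>s\<close> turns this gain into a strict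
  inequality.\<close>

lemma additive_functional_strict:
  assumes v: "\<forall>x\<in>state_interior S. 0 < v x"
    "continuous_map (subtopology (one_point S) (state_interior S)) euclidean v"
    and \<omega>: "regular_path x \<omega>" and s: "0 \<le> s" "s < s'" and int: "X s \<omega> \<in> state_interior S"
    and fin: "additive_functional X v s \<omega> < \<top>"
  shows "additive_functional X v s \<omega> < additive_functional X v s' \<omega>"
proof -
  define c where "c = 2 * v (X s \<omega>)"
  have v0: "0 < v (X s \<omega>)" using v(1) int by simp
  then have c: "0 < c" "v (X s \<omega>) < c" by (auto simp: c_def)
  have "eventually (\<lambda>q. v (X q \<omega>) < c \<and> 0 < v (X q \<omega>)) (at_right s)"
    using order_tendstoD[OF rate_right_continuous(1)[OF v \<omega> s(1) int]] c(2) v0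
    by (auto intro: eventually_conj)
  then obtain b where b: "s < b" "\<And>q. s < q \<Longrightarrow> q < b \<Longrightarrow> v (X q \<omega>) < c \<and> 0 < v (X q \<omega>)"
    unfolding eventually_at_right_field by auto
  define b' where "b' = min b s'"
  have b': "s < b'" using b s by (auto simp: b'_def)
  let ?g = "\<lambda>r. ennreal (1 / v (X r \<omega>))"
  have m: "(\<lambda>r. ?g r * indicator {0..s} r) \<in> borel_measurable borel"
    using rate_right_continuous(2)[OF v \<omega>] regular_path_interior_before[OF \<omega> _ _ int]
    by (intro right_continuous_borel) auto
  have "0 < ennreal (1 / c) * ennreal (b' - s)"
    using c b' by (simp add: ennreal_zero_less_mult_iff)
  then have "additive_functional X v s \<omega> < additive_functional X v s \<omega> + ennreal (1 / c) * ennreal (b' - s)"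
    using fin ennreal_add_left_cancel_less[of "additive_functional X v s \<omega>" 0] by simp
  also have "ennreal (1 / c) * ennreal (b' - s) = (\<integral>\<^sup>+r. ennreal (1 / c) * indicator {s<..<b'} r \<partial>lborel)"
    using b' by (subst nn_integral_cmult_indicator) auto
  also have "additive_functional X v s \<omega> + \<dots> =
      (\<integral>\<^sup>+r. ?g r * indicator {0..s} r + ennreal (1 / c) * indicator {s<..<b'} r \<partial>lborel)"
    unfolding additive_functional_def using m by (intro nn_integral_add[symmetric]) auto
  also have "\<dots> \<le> additive_functional X v s' \<omega>"
    unfolding additive_functional_def
  proof (rule nn_integral_mono)
    fix r :: real
    have "ennreal (1 / c) \<le> ?g r" if "s < r" "r < b'"
      using b(2)[OF that(1)] that c(1) by (intro ennreal_leI divide_left_mono) (auto simp: b'_def)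
    then show "?g r * indicator {0..s} r + ennreal (1 / c) * indicator {s<..<b'} r \<le> ?g r * indicator {0..s'} r"
      using s by (auto simp: indicator_def b'_def)
  qed
  finally show ?thesis .
qed

text \<open>
  The time-changed path is seen only at dyadic multiples of \<open>t\<close>.  As the additive functional is
  strictly increasing, these observations already determine the original path up to the time
  \<open>time_change X v t\<close>.
\<close>

lemma time_change_observes_path:
  assumes v: "\<forall>x\<in>state_interior S. 0 < v x"
    "continuous_map (subtopology (one_point S) (state_interior S)) euclidean v"
    and \<omega>: "regular_path x \<omega>"
    and G: "G \<subseteq> state_interior S" "openin (one_point S) (state_interior S - G)"
    and t: "0 \<le> t"
    and obs: "\<And>N i. i \<le> 2 ^ N \<Longrightarrow> time_change X v (t * real i / 2 ^ N) \<omega> < \<top> \<and>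
        X (enn2real (time_change X v (t * real i / 2 ^ N) \<omega>)) \<omega> \<in> G"
    and s: "0 \<le> s" "s \<le> enn2real (time_change X v t \<omega>)"
  shows "X s \<omega> \<in> G"
proof (rule ccontr)
  assume nG: "X s \<omega> \<notin> G"
  define g where "g = enn2real (time_change X v t \<omega>)"
  have fin: "time_change X v t \<omega> < \<top>" and end_G: "X g \<omega> \<in> G"
    using obs[of 1 0] by (auto simp: g_def)
  have g: "time_change X v t \<omega> = ennreal g" "0 \<le> g"
    using fin by (auto simp: g_def)
  have sg: "s < g" using s(2) nG end_G by (auto simp: g_def order_le_less)
  have Xs: "X s \<omega> \<in> state_interior S"
    using regular_path_interior_before[OF \<omega> s(1), of g] sg end_G G(1) by auto
  then obtain e where e: "0 < e" "\<And>q. s \<le> q \<Longrightarrow> q < s + e \<Longrightarrow> X q \<omega> \<in> state_interior S - G"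
    using regular_path_open[OF \<omega> s(1) G(2)] nG by (metis DiffI)
  \<comment> \<open>On \<open>[s, s']\<close> the path avoids \<open>G\<close>, and
    \<open>s' < g\<close> makes the additive functional at \<open>s'\<close> at most
    \<open>t\<close>, hence finite.\<close>
  obtain s' where s'': "s < s'" "s' < min (s + e) g"
    using dense[of s "min (s + e) g"] e(1) sg by auto
  then have s': "s < s'" "s' < s + e" "s' < g" by auto
  have le_t: "additive_functional X v s' \<omega> \<le> ennreal t"
    using s' s by (intro additive_functional_before) (auto simp: g(1) intro!: ennreal_lessI)
  have lt: "additive_functional X v s \<omega> < additive_functional X v s' \<omega>"
  proof (rule additive_functional_strict[OF v \<omega> s(1) s'(1) Xs])
    have "additive_functional X v s \<omega> \<le> additive_functional X v s' \<omega>"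
      using s' by (intro additive_functional_mono) simp
    also have "\<dots> < \<top>" using le_t by (auto intro: le_less_trans)
    finally show "additive_functional X v s \<omega> < \<top>" .
  qed
  define a where "a = enn2real (additive_functional X v s \<omega>)"
  define b where "b = enn2real (additive_functional X v s' \<omega>)"
  have fin': "additive_functional X v s' \<omega> < \<top>" using le_t by (auto intro: le_less_trans)
  have a: "additive_functional X v s \<omega> = ennreal a" "0 \<le> a"
    using lt fin' by (auto simp: a_def)
  have b: "additive_functional X v s' \<omega> = ennreal b" "0 \<le> b"
    using fin' by (auto simp: b_def)
  have ab: "a < b" "b \<le> t" using lt le_t a b t by (auto simp: ennreal_less_iff)
  \<comment> \<open>The functional climbs from \<open>a\<close> to \<open>b\<close> while the path
    is outside \<open>G\<close>. The time change at any level in between falls into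
    \<open>[s, s']\<close>, and one of these levels is observed.\<close>
  obtain N i :: nat where N: "i \<le> 2 ^ N" "a < t * real i / 2 ^ N" "t * real i / 2 ^ N < b"
    using dyadic_between[OF a(2) ab] by metis
  define r where "r = t * real i / 2 ^ N"
  have r: "a < r" "r < b" using N by (auto simp: r_def)
  have "time_change X v r \<omega> \<le> ennreal s'"
    unfolding time_change_def using r a(2) s' s by (intro Inf_lower imageI CollectI conjI) (auto simp: b(1) intro!: ennreal_lessI)
  moreover have "ennreal s \<le> time_change X v r \<omega>"
    unfolding time_change_def
  proof (intro Inf_greatest)
    fix q' assume "q' \<in> ennreal ` {q. 0 \<le> q \<and> ennreal r < additive_functional X v q \<omega>}"
    then obtain q where q: "q' = ennreal q" "0 \<le> q" "ennreal r < additive_functional X v q \<omega>" by auto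
    have "\<not> q < s"
    proof
      assume "q < s"
      then have "additive_functional X v q \<omega> \<le> ennreal a"
        using additive_functional_mono[of q s X v \<omega>] a by simp
      also have "\<dots> \<le> ennreal r" using r by (intro ennreal_leI) simp
      finally show False using q by simp
    qed
    then show "ennreal s \<le> q'" using q by (auto intro!: ennreal_leI)
  qed
  moreover obtain w where w: "time_change X v r \<omega> = ennreal w" "0 \<le> w"
  proof (cases "time_change X v r \<omega>")
    case (real w)
    with that show thesis by blast
  next
    case top
    with calculation(1) show thesis by (simp add: top_unique)
  qed
  ultimately have "s \<le> w" "w \<le> s'" using s(1) s'(1) by (auto simp: ennreal_le_iff)
  then have "X w \<omega> \<notin> G" using e(2)[of w] s'(2) by auto
  then have "X (enn2real (time_change X v r \<omega>)) \<omega> \<notin> G" using w by simp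
  with obs[OF N(1)] show False by (simp add: r_def)
qed

text \<open>
  The time change is approximated from above by stopping times with values in a grid.  Between the
  time change and its approximation the path may leave \<open>G\<close>, but it stays in the neighbourhood \<open>V\<close>
  for a while; \<open>G'\<close> is needed since the approximating events require a relatively closed set.
\<close>

lemma time_changed_supermartingale:
  assumes v: "\<forall>x\<in>state_interior S. 0 < v x"
    "continuous_map (subtopology (one_point S) (state_interior S)) euclidean v"
    and D: "openin (one_point S) D"
    and cont: "continuous_map (subtopology (one_point S) (D \<inter> state_interior S)) euclidean H"
    and H: "excessive_on S P X D H"
    and G: "G \<subseteq> V" "openin (one_point S) (state_interior S - G)"
    and V: "openin (one_point S) V" "V \<subseteq> G'"
    and G': "G' \<subseteq> D \<inter> state_interior S" "openin (one_point S) (state_interior S - G')"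
    and y: "y \<in> state_space S" and t: "0 \<le> t"
  obtains Z where "Z \<in> borel_measurable M" "(\<integral>\<^sup>+\<omega>. Z \<omega> \<partial>P y) \<le> H y"
    "\<And>\<omega>. regular_path y \<omega> \<Longrightarrow> (\<And>N i. i \<le> 2 ^ N \<Longrightarrow> time_change X v (t * real i / 2 ^ N) \<omega> < \<top> \<and>
        X (enn2real (time_change X v (t * real i / 2 ^ N) \<omega>)) \<omega> \<in> G) \<Longrightarrow>
      H (X (enn2real (time_change X v t \<omega>)) \<omega>) \<le> Z \<omega>"
proof -
  have GS: "G' \<in> sets (state_borel S)" using relatively_closed_sets G' by blast
  define f where "f y = ennreal (1 / v y) * indicator G' y" for y
  have f: "f \<in> borel_measurable (state_borel S)"
  proof -
    have "(\<lambda>y. ennreal (1 / v y)) \<in> borel_measurable (restrict_space (state_borel S) (state_interior S))"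
      using continuous_on_open_borel[OF openin_state_interior v(2)] by measurable
    then show ?thesis unfolding f_def[abs_def] using G' GS by (intro borel_times_indicator) auto
  qed
  define d where "d k = 1 / real (Suc k)" for k
  have d: "0 < d k" for k by (simp add: d_def)
  \<comment> \<open>The clock is adapted, so stopping at the first grid time at which it exceeds
    \<open>t\<close> is decided at that time. On the paths of interest these times approach the time
    change from above as \<open>k\<close> grows.\<close>
  define A where "A k j = {\<omega>\<in>space M. ennreal t < clock f (d k * real j) \<omega> \<and>
      (\<forall>i<j. \<not> ennreal t < clock f (d k * real i) \<omega>)}" for k j
  have A: "A k j \<in> sets (F (ennreal (d k * real j)))" for k j
  proof -
    have m: "clock f (d k * real i) \<in> borel_measurable (F (ennreal (d k * real j)))" if "i \<le> j" for i
    proof -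
      have "ennreal (d k * real i) \<le> ennreal (d k * real j)"
        using that d[of k] by (intro ennreal_leI mult_left_mono) auto
      from sets_F_mono[OF this] show ?thesis
        using clock_measurable[OF f, of "d k * real i"] d[of k] by (auto simp: measurable_def space_F)
    qed
    have "{\<omega>\<in>space (F (ennreal (d k * real j))). ennreal t < clock f (d k * real j) \<omega> \<and>
        (\<forall>i\<in>{..<j}. \<not> ennreal t < clock f (d k * real i) \<omega>)} \<in> sets (F (ennreal (d k * real j)))"
      using m by (intro sets.sets_Collect_conj sets.sets_Collect_finite_All sets.sets_Collect_neg borel_measurable_less)
        auto
    then show ?thesis unfolding A_def space_F by (simp add: Ball_def)
  qed
  have disj: "disjoint_family (A k)" for k
    unfolding disjoint_family_on_def A_def by (auto simp: linorder_neq_iff)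
  define Z where "Z k \<omega> = (\<Sum>j. indicator (A k j) \<omega> * killed_value H G' (d k) j \<omega>)" for k \<omega>
  have Zm: "Z k \<in> borel_measurable M" for k
  proof -
    have "A k j \<in> sets M" for j using A sets_F by blast
    then show ?thesis
      unfolding Z_def[abs_def] using H G' GS d[of k]
      by (intro borel_measurable_suminf_order borel_measurable_times_ennreal borel_measurable_indicator
          killed_value_measurable[of H D]) (auto simp: excessive_on_def)
  qed
  have Zle: "(\<integral>\<^sup>+\<omega>. Z k \<omega> \<partial>P y) \<le> H y" for k
    unfolding Z_def using d[of k] by (intro optional_stopping[OF D G' H y _ A disj]) auto
  show thesis
  proof (rule that[of "\<lambda>\<omega>. liminf (\<lambda>k. Z k \<omega>)"])
    show "(\<lambda>\<omega>. liminf (\<lambda>k. Z k \<omega>)) \<in> borel_measurable M"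
      using Zm by (rule borel_measurable_liminf)
    have "(\<integral>\<^sup>+\<omega>. liminf (\<lambda>k. Z k \<omega>) \<partial>P y) \<le> liminf (\<lambda>k. \<integral>\<^sup>+\<omega>. Z k \<omega> \<partial>P y)"
      using Zm borel_measurable_P[OF y] by (intro nn_integral_liminf) auto
    also have "\<dots> \<le> H y"
      using Zle by (intro Liminf_le always_eventually) auto
    finally show "(\<integral>\<^sup>+\<omega>. liminf (\<lambda>k. Z k \<omega>) \<partial>P y) \<le> H y" .
  next
    fix \<omega> assume \<omega>: "regular_path y \<omega>"
      and obs: "\<And>N i. i \<le> 2 ^ N \<Longrightarrow> time_change X v (t * real i / 2 ^ N) \<omega> < \<top> \<and>
        X (enn2real (time_change X v (t * real i / 2 ^ N) \<omega>)) \<omega> \<in> G"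
    define g where "g = enn2real (time_change X v t \<omega>)"
    have g: "time_change X v t \<omega> = ennreal g" "0 \<le> g" and Xg: "X g \<omega> \<in> G"
      using obs[of 1 0] by (auto simp: g_def)
    have GI: "G \<subseteq> state_interior S" using G V G' by blast
    have path: "X s \<omega> \<in> V" if "0 \<le> s" "s \<le> g" for s
      using time_change_observes_path[OF v \<omega> GI G(2) t obs that(1)] that(2) G(1) by (auto simp: g_def)
    obtain e where e: "0 < e" "\<And>s. g \<le> s \<Longrightarrow> s < g + e \<Longrightarrow> X s \<omega> \<in> V"
      using regular_path_open[OF \<omega> g(2) V(1) path[OF g(2) order.refl]] by metis
    have path': "X s \<omega> \<in> V" if "0 \<le> s" "s < g + e" for s
      using path e that by (cases "s \<le> g") auto
    have clock: "clock f s \<omega> = additive_functional X v s \<omega>" if "s < g + e" for s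
      unfolding f_def[abs_def] using V G' path' that
      by (intro clock_eq_additive_functional[OF v \<omega>]) auto
    \<comment> \<open>Before \<open>g\<close> the clock is at most \<open>t\<close>, and just after
      \<open>g\<close> it exceeds \<open>t\<close>; so the first grid time \<open>q\<close> above
      level \<open>t\<close> lies in \<open>[g, g + d k]\<close>. The path stays in \<open>V\<close>
      up to \<open>q\<close>, so the summand of index \<open>j\<close> equals
      \<open>H (X q \<omega>)\<close>.\<close>
    have near: "\<exists>q. g \<le> q \<and> q \<le> g + d k \<and> H (X q \<omega>) \<le> Z k \<omega>" if k: "d k < e" for k
    proof -
      \<comment> \<open>The first grid index strictly beyond \<open>g\<close>: at \<open>g\<close>
        itself the functional may still equal \<open>t\<close>.\<close>
      define j1 where "j1 = nat (\<lfloor>g / d k\<rfloor> + 1)"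
      have "0 \<le> g / d k" using g(2) d[of k] by simp
      then have "real j1 = of_int \<lfloor>g / d k\<rfloor> + 1" unfolding j1_def by (simp add: of_nat_nat)
      then have "g / d k < real j1" "real j1 \<le> g / d k + 1" by linarith+
      then have j1: "g < d k * real j1" "d k * real j1 \<le> g + d k"
        using d[of k] by (simp_all add: field_simps)
      define j where "j = (LEAST j. ennreal t < clock f (d k * real j) \<omega>)"
      have c1: "ennreal t < clock f (d k * real j1) \<omega>"
        using j1 k g(2) by (subst clock) (auto intro!: additive_functional_after ennreal_lessI simp: g(1))
      have cj: "ennreal t < clock f (d k * real j) \<omega>" unfolding j_def using c1 by (rule LeastI)
      have jj1: "j \<le> j1" unfolding j_def using c1 by (rule Least_le)
      have below: "\<not> ennreal t < clock f (d k * real i) \<omega>" if "i < j" for i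
        using not_less_Least that unfolding j_def by blast
      have jA: "\<omega> \<in> A k j"
        using cj below regular_path_space[OF \<omega>] by (auto simp: A_def)
      define q where "q = d k * real j"
      have "q \<le> d k * real j1" unfolding q_def using jj1 d[of k] by (intro mult_left_mono) auto
      then have q2: "q \<le> g + d k" using j1 by simp
      have q0: "0 \<le> q" using d[of k] by (simp add: q_def)
      have q1: "g \<le> q"
      proof (rule ccontr)
        assume "\<not> g \<le> q"
        then have "additive_functional X v q \<omega> \<le> ennreal t"
          using q0 by (intro additive_functional_before) (auto simp: g(1) intro!: ennreal_lessI)
        moreover have "clock f q \<omega> = additive_functional X v q \<omega>"
          using \<open>\<not> g \<le> q\<close> e(1) by (intro clock) simp
        ultimately show False using cj by (simp add: q_def)
      qed
      have pq: "X s \<omega> \<in> G'" if "0 \<le> s" "s \<le> q" for s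
        using path'[of s] that q2 k V(2) by auto
      have "stays G' (d k) j \<omega>"
        unfolding stays_def on_grid_def
      proof (intro allI impI pq)
        fix l N i :: nat assume l: "l < j" and i: "i \<le> 2 ^ N"
        show "0 \<le> d k * real l + d k * real i / 2 ^ N" using d[of k] by (simp add: less_imp_le)
        have "real i \<le> 2 ^ N" using i by (metis of_nat_le_iff of_nat_numeral of_nat_power)
        then have "d k * real i / 2 ^ N \<le> d k"
          using d[of k] by (simp add: divide_le_eq)
        then have "d k * real l + d k * real i / 2 ^ N \<le> d k * (real l + 1)" by (simp add: algebra_simps)
        also have "\<dots> \<le> q" unfolding q_def using l d[of k] by (intro mult_left_mono) auto
        finally show "d k * real l + d k * real i / 2 ^ N \<le> q" .
      qed
      then have "H (X q \<omega>) = indicator (A k j) \<omega> * killed_value H G' (d k) j \<omega>"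
        using jA pq[OF q0 order.refl] by (simp add: killed_value_def q_def)
      also have "\<dots> \<le> Z k \<omega>"
      proof -
        define T where "T i = indicator (A k i) \<omega> * killed_value H G' (d k) i \<omega>" for i
        have "sum T {j} \<le> suminf T" by (rule sum_le_suminf) auto
        then have "T j \<le> suminf T" by simp
        then show ?thesis unfolding Z_def T_def[symmetric] .
      qed
      finally show ?thesis using q1 q2 by blast
    qed
    have d_lim: "d \<longlonglongrightarrow> 0" unfolding d_def[abs_def] using LIMSEQ_Suc[OF lim_1_over_n] by simp
    have Hlim: "((\<lambda>q. H (X q \<omega>)) \<longlongrightarrow> H (X g \<omega>)) (at_right g)"
    proof -
      have o: "openin (one_point S) (D \<inter> state_interior S)" using D openin_state_interior by blast
      have "X g \<omega> \<in> D \<inter> state_interior S" using Xg G V G' by blast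
      from limitin_continuous_on_open[OF regular_path_limitin[OF \<omega> g(2)] o this cont]
      show ?thesis by simp
    qed
    show "H (X (enn2real (time_change X v t \<omega>)) \<omega>) \<le> liminf (\<lambda>k. Z k \<omega>)"
      unfolding g_def[symmetric] le_Liminf_iff
    proof (intro allI impI)
      fix a assume a: "a < H (X g \<omega>)"
      from order_tendstoD(1)[OF Hlim this] obtain b where
        b: "g < b" "\<And>q. g < q \<Longrightarrow> q < b \<Longrightarrow> a < H (X q \<omega>)"
        unfolding eventually_at_right_field by auto
      have "eventually (\<lambda>k. d k < min e (b - g)) sequentially"
        using order_tendstoD(2)[OF d_lim, of "min e (b - g)"] e b by simp
      then show "eventually (\<lambda>k. a < Z k \<omega>) sequentially"
      proof eventually_elim
        case (elim k)
        then obtain q where q: "g \<le> q" "q \<le> g + d k" "H (X q \<omega>) \<le> Z k \<omega>" using near[of k] by auto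
        have "a < H (X q \<omega>)" using a b(2)[of q] q elim by (cases "q = g") auto
        with q show ?case by simp
      qed
    qed
  qed
qed

subsection \<open>The Kelvin transform\<close>

text \<open>
  The events of the Inversion Property need not be measurable, and then their \<open>emeasure\<close> is 0 by
  convention.  In this case the corresponding probability for the \<open>h\<close>-transform vanishes as well,
  and the empty set serves as \<open>A\<close>.
\<close>

lemma inversion_grid_law:
  assumes IP: "inversion_property S P X I h v" and x: "x \<in> state_interior S" and t: "0 \<le> t"
    and C: "C \<subseteq> state_interior S" "C \<in> sets (state_borel S)"
    and B: "B \<in> sets (state_borel S)" "B \<subseteq> C"
  obtains A where "A \<in> sets (completion (P (I x)))"
    "\<And>\<omega>. \<omega> \<in> A \<Longrightarrow> I (X (enn2real (time_change X v t \<omega>)) \<omega>) \<in> B"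
    "\<And>\<omega> N i. \<omega> \<in> A \<Longrightarrow> i \<le> 2 ^ N \<Longrightarrow> time_change X v (t * real i / 2 ^ N) \<omega> < \<top> \<and>
        I (X (enn2real (time_change X v (t * real i / 2 ^ N) \<omega>)) \<omega>) \<in> C"
    "(\<integral>\<^sup>+\<omega>. h (X t \<omega>) * indicator B (X t \<omega>) * indicator {\<omega>. on_grid C 0 t \<omega>} \<omega> \<partial>P x)
      \<le> h x * emeasure (completion (P (I x))) A"
proof -
  have xS: "x \<in> state_space S" using x state_interior_subset by blast
  have I: "I x \<in> state_space S" "I (I x) = x" using IP xS by (auto simp: inversion_property_def)
  have h: "h \<in> borel_measurable (state_borel S)" and h0: "\<forall>x\<in>state_interior S. 0 < h x \<and> h x < \<top>"
    using IP by (auto simp: inversion_property_def excessive_def)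
  define Q where "Q = completion (P (I x))"
  interpret P: prob_space "P (I x)" by (rule prob[OF I(1)])
  define e where "e = (\<integral>\<^sup>+\<omega>. h (X t \<omega>) * indicator B (X t \<omega>) * indicator {\<omega>. on_grid C 0 t \<omega>} \<omega> \<partial>P x)"
  define tt where "tt N i = t * real i / 2 ^ N" for N i :: nat
  \<comment> \<open>The smaller set \<open>B\<close> is imposed at the last point alone, which is
    time \<open>t\<close> at every level.\<close>
  define BC where "BC N i = (if i = 2 ^ N then B else C)" for N i :: nat
  define bs where "bs N = map (\<lambda>i. (tt N i, BC N i)) [0..<Suc (2 ^ N)]" for N
  have set_bs: "(\<forall>(r, E)\<in>set (bs N). R r E) \<longleftrightarrow> (\<forall>i\<le>2 ^ N. R (tt N i) (BC N i))" for N R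
    by (auto simp: bs_def less_Suc_eq_le simp del: upt_Suc)
  define A where "A N = {\<omega>\<in>space (P (I x)). \<forall>(r, E)\<in>set (bs N). time_change X v r \<omega> < \<top> \<and>
      I (X (enn2real (time_change X v r \<omega>)) \<omega>) \<in> E}" for N
  have tt_end: "tt N (2 ^ N) = t" for N by (simp add: tt_def)
  have step: "e \<le> h x * emeasure Q (A N)" for N
  proof -
    have "map fst (bs N) = map (tt N) [0..<Suc (2 ^ N)]" by (simp add: bs_def del: upt_Suc)
    moreover have "sorted (map (tt N) [0..<Suc (2 ^ N)])"
      unfolding sorted_map
      by (rule sorted_wrt_mono_rel[OF _ sorted_upt])
        (use t in \<open>auto simp: tt_def intro!: divide_right_mono mult_left_mono\<close>)
    moreover have "\<forall>r\<in>set (map (tt N) [0..<Suc (2 ^ N)]). 0 \<le> r"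
      using t by (auto simp: tt_def simp del: upt_Suc)
    ultimately have srt: "sorted (0 # map fst (bs N))" by (simp del: upt_Suc)
    have lst: "last (0 # map fst (bs N)) = t"
      by (simp add: bs_def tt_end)
    have bsS: "\<forall>(r, E)\<in>set (bs N). E \<in> sets (state_borel S) \<and> E \<subseteq> state_interior S"
      unfolding set_bs using B C by (auto simp: BC_def)
    have "emeasure Q (A N) = doob_fdd S P X h 0 (bs N) (I (I x))"
      using IP I(1) srt bsS unfolding inversion_property_def A_def Q_def by blast
    then have "h x * emeasure Q (A N) =
        (\<integral>\<^sup>+\<omega>. h (X t \<omega>) * indicator {\<omega>. \<forall>(r, E)\<in>set (bs N). X r \<omega> \<in> E} \<omega> \<partial>P x)"
      using doob_fdd_eq[OF h h0 bsS srt x] lst I(2) by simp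
    moreover have "e \<le> (\<integral>\<^sup>+\<omega>. h (X t \<omega>) * indicator {\<omega>. \<forall>(r, E)\<in>set (bs N). X r \<omega> \<in> E} \<omega> \<partial>P x)"
      unfolding e_def set_bs
      by (intro nn_integral_mono) (auto simp: indicator_def on_grid_def BC_def tt_def)
    ultimately show ?thesis by simp
  qed
  have grid: "\<omega> \<in> A N \<Longrightarrow> i \<le> 2 ^ N \<Longrightarrow> time_change X v (tt N i) \<omega> < \<top> \<and>
      I (X (enn2real (time_change X v (tt N i) \<omega>)) \<omega>) \<in> BC N i" for \<omega> N i
    unfolding A_def set_bs by blast
  \<comment> \<open>Point \<open>i\<close> of level \<open>N\<close> is point \<open>2 * i\<close>
    of the next level, and end points correspond to end points.\<close>
  have dec: "A (Suc N) \<subseteq> A N" for N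
  proof
    fix \<omega> assume \<omega>: "\<omega> \<in> A (Suc N)"
    have "time_change X v (tt N i) \<omega> < \<top> \<and> I (X (enn2real (time_change X v (tt N i) \<omega>)) \<omega>) \<in> BC N i"
      if "i \<le> 2 ^ N" for i
    proof -
      have "tt (Suc N) (2 * i) = tt N i" "BC (Suc N) (2 * i) = BC N i"
        by (auto simp: tt_def BC_def)
      moreover have "2 * i \<le> 2 ^ Suc N" using that by simp
      ultimately show ?thesis using grid[OF \<omega>, of "2 * i"] by simp
    qed
    moreover have "\<omega> \<in> space (P (I x))" using \<omega> by (simp add: A_def)
    ultimately show "\<omega> \<in> A N" unfolding A_def set_bs by blast
  qed
  have BC_sub: "BC N i \<subseteq> C" for N i using B(2) by (auto simp: BC_def)
  show thesis
  proof (cases "\<forall>N. A N \<in> sets Q")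
    case True
    have "decseq A" using dec by (intro decseq_SucI)
    moreover have "emeasure Q (A N) \<noteq> \<infinity>" for N
    proof -
      have "emeasure Q (A N) \<le> emeasure Q (space Q)" by (rule emeasure_space)
      also have "\<dots> = 1" using P.emeasure_space_1 by (simp add: Q_def)
      finally show ?thesis by (auto simp: top_unique)
    qed
    ultimately have "(\<lambda>N. emeasure Q (A N)) \<longlonglongrightarrow> emeasure Q (\<Inter>N. A N)"
      using True by (intro Lim_emeasure_decseq) auto
    then have "(\<lambda>N. h x * emeasure Q (A N)) \<longlonglongrightarrow> h x * emeasure Q (\<Inter>N. A N)"
      using h0 x by (intro ennreal_tendsto_cmult) auto
    then have le: "e \<le> h x * emeasure Q (\<Inter>N. A N)"
      using step by (intro LIMSEQ_le_const) auto
    show thesis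
    proof (rule that[of "\<Inter>N. A N"])
      show "(\<Inter>N. A N) \<in> sets (completion (P (I x)))" using True by (auto simp: Q_def)
      show "I (X (enn2real (time_change X v t \<omega>)) \<omega>) \<in> B" if "\<omega> \<in> (\<Inter>N. A N)" for \<omega>
        using grid[of \<omega> 0 1] that tt_end[of 0] by (auto simp: BC_def)
      show "time_change X v (t * real i / 2 ^ N) \<omega> < \<top> \<and>
          I (X (enn2real (time_change X v (t * real i / 2 ^ N) \<omega>)) \<omega>) \<in> C"
        if "\<omega> \<in> (\<Inter>N. A N)" "i \<le> 2 ^ N" for \<omega> N i
        using grid[of \<omega> N i] that BC_sub by (auto simp: tt_def)
    qed (use le in \<open>auto simp: e_def Q_def\<close>)
  next
    case False
    then obtain N where "A N \<notin> sets Q" by auto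
    then have "e = 0" using step[of N] by (simp add: emeasure_notin_sets)
    then show thesis by (intro that[of "{}"]) (auto simp: e_def)
  qed
qed

text \<open>The Inversion Property speaks of events, so the integral of \<open>H\<close> composed
  with \<open>I\<close> is reached through simple functions below it. Each level set with value
  \<open>c\<close> provides an event \<open>A c\<close> for \<open>X\<close> started at
  \<open>I x\<close>, on which \<open>H\<close> at the time change is almost surely at least
  \<open>c\<close>. These events do not overlap, so the resulting sum lies below the variable
  \<open>Z\<close> of \<open>time_changed_supermartingale\<close>.\<close>

lemma kelvin_grid_le:
  assumes IP: "inversion_property S P X I h v"
    and D: "openin (one_point S) D"
    and cont: "continuous_map (subtopology (one_point S) (D \<inter> state_interior S)) euclidean H"
    and H: "excessive_on S P X D H"
    and x: "x \<in> state_interior S" and t: "0 \<le> t"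
    and G: "G \<subseteq> V" "openin (one_point S) (state_interior S - G)"
    and V: "openin (one_point S) V" "V \<subseteq> G'"
    and G': "G' \<subseteq> D \<inter> state_interior S" "openin (one_point S) (state_interior S - G')"
    and C: "C \<subseteq> state_interior S" "C \<in> sets (state_borel S)" "I ` C \<subseteq> G"
    and g: "(\<lambda>z. H (I z) * indicator C z) \<in> borel_measurable (state_borel S)"
  shows "(\<integral>\<^sup>+\<omega>. kelvin I h H (X t \<omega>) * indicator C (X t \<omega>) * indicator {\<omega>. on_grid C 0 t \<omega>} \<omega> \<partial>P x)
      \<le> kelvin I h H x"
proof -
  have xS: "x \<in> state_space S" using x state_interior_subset by blast
  have I: "\<And>z. z \<in> state_space S \<Longrightarrow> I z \<in> state_space S \<and> I (I z) = z"
    using IP by (auto simp: inversion_property_def)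
  have y: "I x \<in> state_space S" using I xS by blast
  have v: "\<forall>x\<in>state_interior S. 0 < v x"
    "continuous_map (subtopology (one_point S) (state_interior S)) euclidean v"
    using IP by (auto simp: inversion_property_def)
  have h: "h \<in> borel_measurable (state_borel S)"
    using IP by (auto simp: inversion_property_def excessive_def)
  obtain Z where Z: "Z \<in> borel_measurable M" "(\<integral>\<^sup>+\<omega>. Z \<omega> \<partial>P (I x)) \<le> H (I x)"
    "\<And>\<omega>. regular_path (I x) \<omega> \<Longrightarrow> (\<And>N i. i \<le> 2 ^ N \<Longrightarrow> time_change X v (t * real i / 2 ^ N) \<omega> < \<top> \<and>
        X (enn2real (time_change X v (t * real i / 2 ^ N) \<omega>)) \<omega> \<in> G) \<Longrightarrow>
      H (X (enn2real (time_change X v t \<omega>)) \<omega>) \<le> Z \<omega>"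
    using time_changed_supermartingale[OF v D cont H G V G' y t] by blast
  define w where "w \<omega> = h (X t \<omega>) * indicator {\<omega>. on_grid C 0 t \<omega>} \<omega>" for \<omega>
  have w: "w \<in> borel_measurable (P x)"
    unfolding w_def[abs_def]
    using measurable_compose[OF X_measurable_P[OF xS t] h] on_grid_measurable_P[OF xS order.refl t C(2)]
    by (intro borel_measurable_times_ennreal) (auto intro: borel_measurable_indicator')
  \<comment> \<open>The law of \<open>X t\<close> under \<open>P x\<close>, weighted by
    \<open>h\<close> at time \<open>t\<close> and restricted to the grid event; this is what
    \<open>inversion_grid_law\<close> bounds on Borel subsets of \<open>C\<close>.\<close>
  define N where "N = distr (density (P x) w) (state_borel S) (X t)"
  have Xt: "X t \<in> density (P x) w \<rightarrow>\<^sub>M state_borel S" using X_measurable_P[OF xS t] by simp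
  have N_space: "space N = state_space S" "sets N = sets (state_borel S)"
    by (simp_all add: N_def space_state_borel)
  have N_int: "(\<integral>\<^sup>+z. f z \<partial>N) = (\<integral>\<^sup>+\<omega>. w \<omega> * f (X t \<omega>) \<partial>P x)" if "f \<in> borel_measurable (state_borel S)" for f
    unfolding N_def using that Xt w measurable_compose[OF X_measurable_P[OF xS t] that]
    by (subst nn_integral_distr) (auto simp: nn_integral_density)
  define k where "k z = H (I z) * indicator C z" for z
  have "(\<integral>\<^sup>+\<omega>. kelvin I h H (X t \<omega>) * indicator C (X t \<omega>) * indicator {\<omega>. on_grid C 0 t \<omega>} \<omega> \<partial>P x) = (\<integral>\<^sup>+z. k z \<partial>N)"
    using N_int[OF g] by (simp add: k_def w_def kelvin_def mult_ac)
  also have "\<dots> \<le> h x * (\<integral>\<^sup>+\<omega>. Z \<omega> \<partial>P (I x))"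
    unfolding nn_integral_def[of N]
  proof (rule SUP_least)
    fix s assume "s \<in> {s. simple_function N s \<and> s \<le> k}"
    then have s: "simple_function N s" and sk: "\<And>z. s z \<le> k z" by (auto simp: le_fun_def)
    define Bc where "Bc c = s -` {c} \<inter> space N" for c
    define R where "R = s ` space N - {0}"
    have fin: "finite (s ` space N)" "finite R" using s by (auto simp: simple_function_def R_def)
    have Bc: "Bc c \<in> sets (state_borel S)" "Bc c \<subseteq> C" if "c \<in> R" for c
    proof -
      show "Bc c \<in> sets (state_borel S)"
        using that s unfolding R_def Bc_def by (metis simple_functionD(2) N_space(2))
      show "Bc c \<subseteq> C"
      proof
        fix z assume z: "z \<in> Bc c"
        then have "s z \<noteq> 0" using that by (auto simp: Bc_def R_def)
        with sk[of z] have "k z \<noteq> 0" by auto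
        then show "z \<in> C" by (auto simp: k_def indicator_def split: if_splits)
      qed
    qed
    define \<Phi> where "\<Phi> c A \<longleftrightarrow> A \<in> sets (completion (P (I x))) \<and>
        (\<forall>\<omega>\<in>A. I (X (enn2real (time_change X v t \<omega>)) \<omega>) \<in> Bc c) \<and>
        (\<forall>\<omega>\<in>A. \<forall>N i. i \<le> 2 ^ N \<longrightarrow> time_change X v (t * real i / 2 ^ N) \<omega> < \<top> \<and>
            I (X (enn2real (time_change X v (t * real i / 2 ^ N) \<omega>)) \<omega>) \<in> C) \<and>
        emeasure N (Bc c) \<le> h x * emeasure (completion (P (I x))) A" for c A
    have "\<exists>A. \<Phi> c A" if c: "c \<in> R" for c
    proof -
      have "emeasure N (Bc c) = (\<integral>\<^sup>+z. indicator (Bc c) z \<partial>N)"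
        using Bc(1)[OF c] N_space by simp
      also have "\<dots> = (\<integral>\<^sup>+\<omega>. h (X t \<omega>) * indicator (Bc c) (X t \<omega>) * indicator {\<omega>. on_grid C 0 t \<omega>} \<omega> \<partial>P x)"
        using Bc(1)[OF c] by (subst N_int) (auto simp: w_def mult_ac)
      finally have eq: "emeasure N (Bc c) = \<dots>" .
      show ?thesis
      proof (rule inversion_grid_law[OF IP x t C(1,2) Bc[OF c]])
        fix A assume "A \<in> sets (completion (P (I x)))"
          and "\<And>\<omega>. \<omega> \<in> A \<Longrightarrow> I (X (enn2real (time_change X v t \<omega>)) \<omega>) \<in> Bc c"
          and "\<And>\<omega> N i. \<omega> \<in> A \<Longrightarrow> i \<le> 2 ^ N \<Longrightarrow> time_change X v (t * real i / 2 ^ N) \<omega> < \<top> \<and>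
            I (X (enn2real (time_change X v (t * real i / 2 ^ N) \<omega>)) \<omega>) \<in> C"
          and "(\<integral>\<^sup>+\<omega>. h (X t \<omega>) * indicator (Bc c) (X t \<omega>) * indicator {\<omega>. on_grid C 0 t \<omega>} \<omega> \<partial>P x)
            \<le> h x * emeasure (completion (P (I x))) A"
        then have "\<Phi> c A" unfolding \<Phi>_def eq by blast
        then show ?thesis ..
      qed
    qed
    then obtain A where A': "\<And>c. c \<in> R \<Longrightarrow> \<Phi> c (A c)" by metis
    have A: "\<And>c. c \<in> R \<Longrightarrow> A c \<in> sets (completion (P (I x)))"
      "\<And>c \<omega>. c \<in> R \<Longrightarrow> \<omega> \<in> A c \<Longrightarrow> I (X (enn2real (time_change X v t \<omega>)) \<omega>) \<in> Bc c"
      "\<And>c \<omega> N i. c \<in> R \<Longrightarrow> \<omega> \<in> A c \<Longrightarrow> i \<le> 2 ^ N \<Longrightarrow> time_change X v (t * real i / 2 ^ N) \<omega> < \<top> \<and>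
            I (X (enn2real (time_change X v (t * real i / 2 ^ N) \<omega>)) \<omega>) \<in> C"
      "\<And>c. c \<in> R \<Longrightarrow> emeasure N (Bc c) \<le> h x * emeasure (completion (P (I x))) (A c)"
      using A' unfolding \<Phi>_def by blast+
    have "simple_integral N s = (\<Sum>c\<in>s ` space N. c * emeasure N (Bc c))"
      by (simp add: simple_integral_def Bc_def)
    also have "\<dots> = (\<Sum>c\<in>R. c * emeasure N (Bc c))"
      using fin by (intro sum.mono_neutral_right) (auto simp: R_def)
    also have "\<dots> \<le> (\<Sum>c\<in>R. c * (h x * emeasure (completion (P (I x))) (A c)))"
      by (intro sum_mono mult_left_mono A) auto
    also have "\<dots> = h x * (\<Sum>c\<in>R. c * emeasure (completion (P (I x))) (A c))"
      by (simp add: sum_distrib_left mult_ac)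
    also have "(\<Sum>c\<in>R. c * emeasure (completion (P (I x))) (A c)) =
        (\<Sum>c\<in>R. \<integral>\<^sup>+\<omega>. c * indicator (A c) \<omega> \<partial>completion (P (I x)))"
      using A(1) by (intro sum.cong refl) (simp add: nn_integral_cmult_indicator)
    also have "\<dots> = (\<integral>\<^sup>+\<omega>. (\<Sum>c\<in>R. c * indicator (A c) \<omega>) \<partial>completion (P (I x)))"
      using A(1) by (intro nn_integral_sum[symmetric]) auto
    also have "\<dots> \<le> (\<integral>\<^sup>+\<omega>. Z \<omega> \<partial>completion (P (I x)))"
    proof (rule nn_integral_mono_AE)
      show "AE \<omega> in completion (P (I x)). (\<Sum>c\<in>R. c * indicator (A c) \<omega>) \<le> Z \<omega>"
        using AE_completion[OF AE_regular_path[OF y]]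
      proof eventually_elim
        case (elim \<omega>)
        show ?case
        proof (cases "\<exists>c\<in>R. \<omega> \<in> A c")
          case False
          then have "(\<Sum>c\<in>R. c * indicator (A c) \<omega>) = 0" by (intro sum.neutral) auto
          then show ?thesis by simp
        next
          case True
          then obtain c where c: "c \<in> R" "\<omega> \<in> A c" by blast
          define q where "q = X (enn2real (time_change X v t \<omega>)) \<omega>"
          have twice: "X (enn2real r) \<omega> = I (I (X (enn2real r) \<omega>))" for r
            using I path_in_state_space[OF regular_path_space[OF elim], of "enn2real r"] by simp
          have sc: "s (I q) = c'" if "c' \<in> R" "\<omega> \<in> A c'" for c'
            using A(2)[OF that] by (auto simp: Bc_def q_def)
          \<comment> \<open>The value \<open>s (I q)\<close> determines \<open>c\<close>, so a
            single summand survives.\<close>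
          have "(\<Sum>c\<in>R. c * indicator (A c) \<omega>) = (\<Sum>c'\<in>{c}. c' * indicator (A c') \<omega>)"
            using fin(2) c sc by (intro sum.mono_neutral_right) (auto simp: indicator_def)
          also have "\<dots> = s (I q)" using c sc by simp
          also have "\<dots> \<le> H (I (I q))" by (rule order_trans[OF sk]) (simp add: k_def indicator_def)
          also have "I (I q) = q" using twice by (simp add: q_def)
          also have "H q \<le> Z \<omega>"
            unfolding q_def
          proof (rule Z(3)[OF elim])
            fix N i :: nat assume "i \<le> 2 ^ N"
            from A(3)[OF c this] show "time_change X v (t * real i / 2 ^ N) \<omega> < \<top> \<and>
                X (enn2real (time_change X v (t * real i / 2 ^ N) \<omega>)) \<omega> \<in> G"
              using C(3) twice by (metis image_subset_iff)
          qed
          finally show ?thesis .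
        qed
      qed
    qed
    finally show "simple_integral N s \<le> h x * (\<integral>\<^sup>+\<omega>. Z \<omega> \<partial>P (I x))"
      by (simp add: nn_integral_completion mult_left_mono)
  qed
  also have "\<dots> \<le> kelvin I h H x" using Z(2) by (simp add: kelvin_def mult_left_mono)
  finally show ?thesis .
qed

text \<open>Over rational times, leaving \<open>C\<close> is a countable union. The infimum is at
  most \<open>a\<close> exactly if there are exits before every \<open>r m\<close>, where
  \<open>r m\<close> tends to \<open>a\<close> from above; this looks slightly beyond
  \<open>a\<close>, and right-continuity of the filtration removes the excess.\<close>

lemma rational_hitting_stopping_time:
  assumes C: "C \<in> sets (state_borel S)"
  shows "stopping_time F (\<lambda>\<omega>. Inf (ennreal ` {q \<in> \<rat>. 0 \<le> q \<and> X q \<omega> \<notin> C}))"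
proof
  fix s :: ennreal
  define T where "T \<omega> = Inf (ennreal ` {q \<in> \<rat>. 0 \<le> q \<and> X q \<omega> \<notin> C})" for \<omega>
  show "Measurable.pred (F s) (\<lambda>\<omega>. T \<omega> \<le> s)"
  proof (cases "s = \<top>")
    case False
    then obtain a where a: "s = ennreal a" "0 \<le> a" by (cases s) auto
    have "{\<omega>\<in>space M. T \<omega> \<le> s} \<in> sets (F s')" if s': "s < s'" for s'
    proof -
      obtain u where "s < u" "u < s'" using dense[OF s'] by blast
      then obtain b where b: "a < b" "ennreal b \<le> s'"
        using a by (cases u) (auto simp: ennreal_less_iff less_imp_le)
      \<comment> \<open>All \<open>r m\<close> lie in \<open>(a, b]\<close>, so that the single
        sigma-algebra \<open>F (ennreal b)\<close> serves every \<open>m\<close>.\<close>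
      define r where "r m = a + (b - a) / real (Suc m)" for m
      have r: "a < r m" "r m \<le> b" for m
        using b(1) by (auto simp: r_def field_simps intro!: mult_right_mono)
      have "(\<lambda>m. (b - a) * (1 / real (Suc m))) \<longlonglongrightarrow> (b - a) * 0"
        by (intro tendsto_intros LIMSEQ_Suc[OF lim_1_over_n])
      then have lim: "r \<longlonglongrightarrow> a"
        unfolding r_def[abs_def] using tendsto_add[OF tendsto_const, of _ 0 sequentially a] by simp
      have "T \<omega> \<le> s \<longleftrightarrow> (\<forall>m. \<exists>q\<in>\<rat> \<inter> {0..<r m}. X q \<omega> \<notin> C)" for \<omega>
      proof
        assume T: "T \<omega> \<le> s"
        show "\<forall>m. \<exists>q\<in>\<rat> \<inter> {0..<r m}. X q \<omega> \<notin> C"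
        proof
          fix m
          have "s < ennreal (r m)" unfolding a using r[of m] a(2) by (intro ennreal_lessI) auto
          with T have "T \<omega> < ennreal (r m)" by simp
          then show "\<exists>q\<in>\<rat> \<inter> {0..<r m}. X q \<omega> \<notin> C"
            unfolding T_def Inf_less_iff by (auto simp: ennreal_less_iff)
        qed
      next
        assume *: "\<forall>m. \<exists>q\<in>\<rat> \<inter> {0..<r m}. X q \<omega> \<notin> C"
        have "T \<omega> \<le> ennreal (r m)" for m
        proof -
          obtain q where q: "q \<in> \<rat>" "0 \<le> q" "q < r m" "X q \<omega> \<notin> C" using spec[OF *, of m] by auto
          then have "T \<omega> \<le> ennreal q" unfolding T_def by (intro Inf_lower) auto
          also have "\<dots> \<le> ennreal (r m)" using q by (intro ennreal_leI) auto
          finally show ?thesis .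
        qed
        moreover have "(\<lambda>m. ennreal (r m)) \<longlonglongrightarrow> ennreal a" using lim by (rule tendsto_ennrealI)
        ultimately show "T \<omega> \<le> s" unfolding a by (intro LIMSEQ_le_const) auto
      qed
      then have "{\<omega>\<in>space M. T \<omega> \<le> s} = {\<omega>\<in>space (F (ennreal b)). \<forall>m. \<exists>q\<in>\<rat> \<inter> {0..<r m}. X q \<omega> \<notin> C}"
        by (simp add: space_F)
      also have "\<dots> \<in> sets (F (ennreal b))"
      proof (intro sets.sets_Collect_countable_All sets.sets_Collect_countable_Ex')
        fix m q assume q: "q \<in> \<rat> \<inter> {0..<r m}"
        then have "X q \<in> F (ennreal b) \<rightarrow>\<^sub>M state_borel S" using r[of m] by (intro X_measurable_F) auto
        then have "Measurable.pred (F (ennreal b)) (\<lambda>\<omega>. X q \<omega> \<in> C)" by (rule pred_sets2[OF C])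
        then show "{\<omega>\<in>space (F (ennreal b)). X q \<omega> \<notin> C} \<in> sets (F (ennreal b))"
          by (intro sets.sets_Collect_neg) (simp add: pred_def)
      qed (auto intro: countable_rat countable_Int1)
      finally show ?thesis using sets_F_mono[OF b(2)] by blast
    qed
    then have "{\<omega>\<in>space M. T \<omega> \<le> s} \<in> (\<Inter>s'\<in>{s<..}. sets (F s'))" by auto
    then have "{\<omega>\<in>space M. T \<omega> \<le> s} \<in> sets (F s)"
      using F_right_continuous[of s] False by (simp only: top.not_eq_extremum)
    then show ?thesis by (simp add: pred_def space_F)
  qed simp
qed

text \<open>
  A path in \<open>U\<close> could fail to stay in one of the \<open>C n\<close> only if a left limit were on the boundary
  of \<open>U\<close>; quasi-left-continuity excludes this.
\<close>

lemma grid_exhaustion: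
  assumes x: "x \<in> state_space S" and U: "U \<subseteq> state_interior S"
    and W: "\<And>n. openin (one_point S) (W n)" "\<And>n. W n \<subseteq> C n" "\<And>n. C n \<subseteq> W (Suc n)" "(\<Union>n. C n) = U"
    and C: "\<And>n. openin (one_point S) (state_interior S - C n)"
    and t: "0 \<le> t"
  shows "AE \<omega> in P x. (\<forall>s\<in>{0..t}. X s \<omega> \<in> U) \<longrightarrow> (\<exists>n. on_grid (C n) 0 t \<omega>)"
proof -
  have CI: "C n \<subseteq> state_interior S" for n using W(4) U by blast
  have C_sets: "C n \<in> sets (state_borel S)" for n using relatively_closed_sets CI C by blast
  have "C n \<subseteq> C (Suc n)" for n using W by blast
  then have C_mono: "m \<le> n \<Longrightarrow> C m \<subseteq> C n" for m n by (rule lift_Suc_mono_le)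
  define T where "T n \<omega> = Inf (ennreal ` {q \<in> \<rat>. 0 \<le> q \<and> X q \<omega> \<notin> C n})" for n \<omega>
  have T: "stopping_time F (T n)" for n
    unfolding T_def[abs_def] by (rule rational_hitting_stopping_time[OF C_sets])
  have inc: "incseq (\<lambda>n. T n \<omega>)" for \<omega>
    unfolding T_def incseq_def using C_mono by (auto intro!: Inf_superset_mono)
  have "AE \<omega> in P x. (SUP k. T k \<omega>) < lifetime S X \<omega> \<longrightarrow>
        limitin (one_point S) (\<lambda>k. X (enn2real (T k \<omega>)) \<omega>)
          (X (enn2real (SUP k. T k \<omega>)) \<omega>) sequentially"
    by (rule quasi_left_continuous[OF x T inc])
  then show ?thesis
    using AE_regular_path[OF x]
  proof eventually_elim
    case (elim \<omega>)
    note \<omega> = elim(2)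
    show ?case
    proof (rule impI, rule ccontr)
      assume path: "\<forall>s\<in>{0..t}. X s \<omega> \<in> U" and no: "\<nexists>n. on_grid (C n) 0 t \<omega>"
      \<comment> \<open>The complement of \<open>C n\<close> in the interior is open, so a grid time
        outside \<open>C n\<close> is followed at once by rational times outside
        \<open>C n\<close>.\<close>
      have T_le: "T n \<omega> \<le> ennreal t" for n
      proof -
        obtain N i :: nat where N: "i \<le> 2 ^ N" "X (0 + t * real i / 2 ^ N) \<omega> \<notin> C n"
          using no unfolding on_grid_def by blast
        define r where "r = t * real i / 2 ^ N"
        have "real i \<le> 2 ^ N" using N by (metis of_nat_le_iff of_nat_numeral of_nat_power)
        then have r: "0 \<le> r" "r \<le> t" using t by (auto simp: r_def divide_le_eq mult_left_mono)
        have "X r \<omega> \<in> state_interior S - C n" using N path r U by (auto simp: r_def)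
        then obtain e where e: "0 < e" "\<And>q. r \<le> q \<Longrightarrow> q < r + e \<Longrightarrow> X q \<omega> \<in> state_interior S - C n"
          using regular_path_open[OF \<omega> r(1) C] by metis
        have eps: "T n \<omega> \<le> ennreal t + ennreal d" if d: "0 < d" for d
        proof -
          obtain q where q: "q \<in> \<rat>" "r < q" "q < r + min e d"
            using Rats_dense_in_real[of r "r + min e d"] e d by auto
          have "T n \<omega> \<le> ennreal q"
            unfolding T_def using q r e(2)[of q] by (intro Inf_lower imageI) auto
          also have "\<dots> \<le> ennreal (t + d)" using q r by (intro ennreal_leI) auto
          finally show ?thesis using t d by simp
        qed
        show ?thesis by (rule ennreal_le_epsilon) (rule eps)
      qed
      define z where "z = enn2real (SUP k. T k \<omega>)"
      have SUP_le: "(SUP k. T k \<omega>) \<le> ennreal t" by (rule SUP_least[OF T_le])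
      have z: "0 \<le> z" "z \<le> t"
        using SUP_le t by (auto simp: z_def intro: enn2real_leI)
      \<comment> \<open>Quasi-left-continuity is available before the lifetime; a path in the
        interior up to \<open>t\<close> stays there a little longer, so its lifetime is beyond
        \<open>t\<close>.\<close>
      have life: "ennreal t < lifetime S X \<omega>"
        unfolding lifetime_def
        by (rule regular_path_exit_time[OF \<omega> t openin_state_interior]) (use path U t in auto)
      then have lim: "limitin (one_point S) (\<lambda>k. X (enn2real (T k \<omega>)) \<omega>) (X z \<omega>) sequentially"
        using elim(1) SUP_le by (auto simp: z_def)
      have "X z \<omega> \<in> U" using path z by auto
      then obtain m where "X z \<omega> \<in> C m" using W(4) by blast
      then have "X z \<omega> \<in> W (Suc m)" using W(3) by blast
      then have "eventually (\<lambda>k. X (enn2real (T k \<omega>)) \<omega> \<in> W (Suc m)) sequentially"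
        using lim W(1) by (auto simp: limitin_def)
      moreover have "eventually (\<lambda>k. Suc m \<le> k) sequentially" by (rule eventually_ge_at_top)
      ultimately have "eventually (\<lambda>k. X (enn2real (T k \<omega>)) \<omega> \<in> W (Suc m) \<and> Suc m \<le> k) sequentially"
        by (rule eventually_conj)
      then obtain k where k: "X (enn2real (T k \<omega>)) \<omega> \<in> W (Suc m)" "Suc m \<le> k"
        by (auto dest: eventually_happens)
      define y where "y = enn2real (T k \<omega>)"
      have "T k \<omega> < \<top>" using T_le[of k] by (auto intro: le_less_trans)
      then have y: "T k \<omega> = ennreal y" "0 \<le> y" by (auto simp: y_def)
      obtain e where e: "0 < e" "\<And>q. y \<le> q \<Longrightarrow> q < y + e \<Longrightarrow> X q \<omega> \<in> W (Suc m)"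
        using regular_path_open[OF \<omega> y(2) W(1)] k(1) by (metis y_def)
      \<comment> \<open>Rational times outside \<open>C k\<close> occur at or arbitrarily soon after
        \<open>y\<close>, while the open set \<open>W (Suc m)\<close>, a part of \<open>C k\<close>,
        holds the path for a while after \<open>y\<close>.\<close>
      have "Inf (ennreal ` {q \<in> \<rat>. 0 \<le> q \<and> X q \<omega> \<notin> C k}) < ennreal (y + e)"
        unfolding T_def[symmetric] y(1) using y(2) e(1) by (intro ennreal_lessI) auto
      then obtain q where q: "q \<in> \<rat>" "0 \<le> q" "X q \<omega> \<notin> C k" "ennreal q < ennreal (y + e)"
        unfolding Inf_less_iff by auto
      have "T k \<omega> \<le> ennreal q" unfolding T_def using q by (intro Inf_lower) auto
      then have "y \<le> q" using y q by simp
      moreover have "q < y + e" using q by (simp add: ennreal_less_iff)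
      ultimately have "X q \<omega> \<in> W (Suc m)" by (rule e(2))
      then have "X q \<omega> \<in> C k" using W(2) C_mono[OF k(2)] by blast
      with q(3) show False by simp
    qed
  qed
qed

end

text \<open>An exhaustion by compact sets of Euclidean space, with \<open>W n\<close> the interior
  of \<open>C n\<close>. The open sets in between provide the chain
  \<open>C n \<subseteq> W (Suc n) \<subseteq> C (Suc n)\<close> that \<open>kelvin_layer_le\<close>
  is applied to.\<close>

lemma interior_exhaustion:
  assumes "openin (one_point S) U" "U \<subseteq> state_interior S"
  obtains W C where "\<And>n. openin (one_point S) (W n)" "\<And>n. W n \<subseteq> C n"
    "\<And>n. C n \<subseteq> W (Suc n)" "(\<Union>n. C n) = U"
    "\<And>n. openin (one_point S) (state_interior S - C n)"
proof -
  define u where "u = {z. Some z \<in> U}"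
  have Su: "Some ` u = U" using assms(2) by (auto simp: u_def state_interior_def)
  have "open u"
  proof -
    have uS: "u \<subseteq> interior S" using assms(2) by (auto simp: u_def state_interior_def)
    have "openin (top_of_set S) u"
      using assms(1) unfolding Su[symmetric] one_point_def by simp
    then have "openin (top_of_set (interior S)) u"
      using openin_subset_trans[OF _ uS interior_subset] by blast
    then show ?thesis using openin_open_trans open_interior by blast
  qed
  then obtain C where C: "\<And>n. compact (C n)" "\<And>n. C n \<subseteq> u" "\<And>n. C n \<subseteq> interior (C (Suc n))" "\<Union>(range C) = u"
    by (rule open_Union_compact_subsets) blast
  have u_sub: "u \<subseteq> interior S - {0}" using assms(2) by (auto simp: u_def state_interior_def)
  show thesis
  proof (rule that[of "\<lambda>n. Some ` interior (C n)" "\<lambda>n. Some ` C n"])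
    fix n
    have "interior (C n) \<subseteq> S"
      using C(2)[of n] u_sub interior_subset[of S] interior_subset[of "C n"] by blast
    then show "openin (one_point S) (Some ` interior (C n))"
      by (intro openin_one_point_Some) auto
    have "state_interior S - Some ` C n = Some ` (interior S - {0} - C n)"
      by (auto simp: state_interior_def)
    then show "openin (one_point S) (state_interior S - Some ` C n)"
      using C(1)[of n] interior_subset[of S]
      by (auto intro!: openin_one_point_Some open_Diff compact_imp_closed)
    show "Some ` interior (C n) \<subseteq> Some ` C n" using interior_subset by blast
    show "Some ` C n \<subseteq> Some ` interior (C (Suc n))" using C(3) by blast
    show "(\<Union>n. Some ` C n) = U" using C(4) Su by blast
  qed
qed

section \<open>Excessivity of the Kelvin transform on I(D)\<close>

locale kelvin_setting = standard_process M F S X P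
  for M :: "'w measure"
    and F :: "ennreal \<Rightarrow> 'w measure"
    and S :: "(real ^ 'n) set"
    and X :: "real \<Rightarrow> 'w \<Rightarrow> (real ^ 'n) option"
    and P :: "(real ^ 'n) option \<Rightarrow> 'w measure" +
  fixes I :: "(real ^ 'n) option \<Rightarrow> (real ^ 'n) option"
    and h :: "(real ^ 'n) option \<Rightarrow> ennreal"
    and v :: "(real ^ 'n) option \<Rightarrow> real"
    and D :: "(real ^ 'n) option set"
    and H :: "(real ^ 'n) option \<Rightarrow> ennreal"
  assumes IP: "inversion_property S P X I h v"
    and characteristics: "continuous_characteristics S I h"
    and D: "openin (one_point S) D"
    and H_bdry: "\<forall>x\<in>state_boundary S. H x = 0"
    and H_cont: "continuous_map (subtopology (one_point S) (D \<inter> state_interior S)) euclidean H"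
    and H: "excessive_on S P X D H"
begin

abbreviation K :: "(real ^ 'n) option \<Rightarrow> ennreal" where "K \<equiv> kelvin I h H"

text \<open>The interior part of I(D), as \<open>image_D_interior_iff\<close> shows. Written as a
  preimage, it is open by continuity of \<open>I\<close>, whereas I(D) may also contain boundary
  points.\<close>

definition kelvin_domain :: "(real ^ 'n) option set" where "kelvin_domain = {z \<in> state_interior S. I z \<in> D}"

lemma I_involution: "\<And>z. z \<in> state_space S \<Longrightarrow> I z \<in> state_space S \<and> I (I z) = z"
  using IP by (auto simp: inversion_property_def)

lemma h_borel: "h \<in> borel_measurable (state_borel S)" and h_pos_finite: "\<forall>x\<in>state_interior S. 0 < h x \<and> h x < \<top>"
  using IP by (auto simp: inversion_property_def excessive_def)

lemma I_interior_iff: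
  assumes "z \<in> state_space S"
  shows "I z \<in> state_interior S \<longleftrightarrow> z \<in> state_interior S"
  using involution_interior[OF IP] I_involution assms by metis

lemma D_subset: "D \<subseteq> state_space S" using D openin_subset by (auto simp: state_space_def)

lemma I_continuous: "continuous_map (subtopology (one_point S) (state_interior S)) (one_point S) I"
  and h_continuous: "continuous_map (subtopology (one_point S) (state_interior S)) euclidean h"
  using characteristics by (auto simp: continuous_characteristics_def)

lemma topspace_interior: "topspace (subtopology (one_point S) (state_interior S)) = state_interior S"
  using state_interior_subset[of S] by (auto simp: state_space_def)

lemma kelvin_domain_interior: "kelvin_domain \<subseteq> state_interior S" by (auto simp: kelvin_domain_def)

lemma kelvin_domain_space: "kelvin_domain \<subseteq> state_space S" using kelvin_domain_interior state_interior_subset by blast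

lemma openin_I_preimage:
  assumes "openin (one_point S) V"
  shows "openin (one_point S) {z \<in> state_interior S. I z \<in> V}"
proof -
  have "openin (subtopology (one_point S) (state_interior S)) {z \<in> state_interior S. I z \<in> V}"
    using I_continuous assms unfolding continuous_map_def topspace_interior by blast
  then show ?thesis using openin_state_interior by (rule openin_trans_full)
qed

lemma openin_kelvin_domain: "openin (one_point S) kelvin_domain" unfolding kelvin_domain_def by (rule openin_I_preimage[OF D])

lemma image_D_interior_iff:
  assumes "z \<in> state_interior S"
  shows "z \<in> I ` D \<longleftrightarrow> z \<in> kelvin_domain"
proof
  assume "z \<in> I ` D"
  then obtain d where "d \<in> D" "z = I d" by blast
  then show "z \<in> kelvin_domain" using I_involution D_subset assms by (auto simp: kelvin_domain_def)
next
  assume "z \<in> kelvin_domain"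
  then have "z = I (I z)" "I z \<in> D" using I_involution kelvin_domain_space by (auto simp: kelvin_domain_def)
  then show "z \<in> I ` D" by blast
qed

text \<open>\<open>I\<close> preserves the boundary, where \<open>H\<close> vanishes; the product is
  0 even where \<open>h\<close> is infinite, by the convention for \<open>ennreal\<close>.\<close>

lemma kelvin_zero:
  assumes "z \<in> state_space S" "z \<notin> state_interior S"
  shows "K z = 0"
proof -
  have "I z \<in> state_boundary S" using I_involution I_interior_iff assms by (auto simp: state_boundary_def)
  then show ?thesis using H_bdry by (simp add: kelvin_def)
qed

lemma H_I_continuous: "continuous_map (subtopology (one_point S) kelvin_domain) euclidean (\<lambda>z. H (I z))"
proof -
  have "continuous_map (subtopology (one_point S) kelvin_domain) (one_point S) I"
    using continuous_map_from_subtopology_mono[OF I_continuous kelvin_domain_interior] .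
  moreover have "I ` topspace (subtopology (one_point S) kelvin_domain) \<subseteq> D \<inter> state_interior S"
    using kelvin_domain_space I_interior_iff by (auto simp: kelvin_domain_def)
  ultimately have "continuous_map (subtopology (one_point S) kelvin_domain) (subtopology (one_point S) (D \<inter> state_interior S)) I"
    by (auto simp: continuous_map_in_subtopology)
  from continuous_map_compose[OF this H_cont] show ?thesis by (simp add: comp_def)
qed

lemma H_I_borel: "(\<lambda>z. H (I z)) \<in> borel_measurable (restrict_space (state_borel S) kelvin_domain)"
  by (rule continuous_on_open_borel[OF openin_kelvin_domain H_I_continuous])

lemma kelvin_borel:
  assumes "C \<subseteq> kelvin_domain" "C \<in> sets (state_borel S)"
  shows "(\<lambda>z. K z * indicator C z) \<in> borel_measurable (state_borel S)"
proof -
  have "(\<lambda>z. h z * (H (I z) * indicator C z)) \<in> borel_measurable (state_borel S)"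
    by (intro borel_measurable_times_ennreal h_borel borel_times_indicator[OF H_I_borel assms])
  then show ?thesis by (simp add: kelvin_def mult.assoc)
qed

lemma kelvin_right_continuous:
  assumes \<omega>: "regular_path x \<omega>" and r: "0 \<le> r" "X r \<omega> \<in> kelvin_domain"
  shows "((\<lambda>s. K (X s \<omega>)) \<longlongrightarrow> K (X r \<omega>)) (at_right r)"
proof -
  have "limitin euclidean (\<lambda>s. H (I (X s \<omega>))) (H (I (X r \<omega>))) (at_right r)"
    using regular_path_limitin[OF \<omega> r(1)] openin_kelvin_domain r(2) H_I_continuous by (rule limitin_continuous_on_open)
  moreover have "limitin euclidean (\<lambda>s. h (X s \<omega>)) (h (X r \<omega>)) (at_right r)"
    using regular_path_limitin[OF \<omega> r(1)] openin_state_interior _ h_continuous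
    by (rule limitin_continuous_on_open) (use r kelvin_domain_interior in auto)
  \<comment> \<open>This excludes a product of 0 and infinity, the one obstacle to continuity of
    multiplication.\<close>
  moreover have "h (X r \<omega>) \<noteq> 0" "h (X r \<omega>) \<noteq> \<infinity>" using h_pos_finite r(2) kelvin_domain_interior by force+
  ultimately show ?thesis
    unfolding kelvin_def by (intro tendsto_mult_ennreal) auto
qed

lemma I_image_eq:
  assumes "A \<subseteq> state_interior S"
  shows "I ` A = {z \<in> state_interior S. I z \<in> A}"
proof
  show "I ` A \<subseteq> {z \<in> state_interior S. I z \<in> A}"
    using assms I_involution I_interior_iff state_interior_subset[of S] by (auto simp: subset_iff)
  show "{z \<in> state_interior S. I z \<in> A} \<subseteq> I ` A"
  proof
    fix z assume "z \<in> {z \<in> state_interior S. I z \<in> A}"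
    then have "z = I (I z)" "I z \<in> A" using I_involution state_interior_subset[of S] by auto
    then show "z \<in> I ` A" by blast
  qed
qed

lemma kelvin_grid_measurable:
  assumes C: "C \<subseteq> kelvin_domain" "C \<in> sets (state_borel S)" and x: "x \<in> state_space S" and t: "0 \<le> t"
  shows "(\<lambda>\<omega>. K (X t \<omega>) * indicator C (X t \<omega>) * indicator {\<omega>. on_grid C 0 t \<omega>} \<omega>) \<in> borel_measurable (P x)"
proof (rule borel_measurable_times_ennreal)
  show "(\<lambda>\<omega>. K (X t \<omega>) * indicator C (X t \<omega>)) \<in> borel_measurable (P x)"
    using measurable_compose[OF X_measurable_P[OF x t] kelvin_borel[OF C]] .
  show "indicator {\<omega>. on_grid C 0 t \<omega>} \<in> borel_measurable (P x)"
    using on_grid_measurable_P[OF x order.refl t C(2)]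
    by (auto intro: borel_measurable_indicator')
qed

text \<open>\<open>I\<close> is a continuous involution of the interior, so images under
  \<open>I\<close> are preimages. Open sets go to open sets and relatively closed sets to relatively
  closed ones, and the chain around \<open>C\<close> becomes the chain inside \<open>D\<close> that
  \<open>kelvin_grid_le\<close> requires.\<close>

lemma kelvin_layer_le:
  assumes C: "C \<subseteq> W" "openin (one_point S) (state_interior S - C)"
    and W: "openin (one_point S) W" "W \<subseteq> C'"
    and C': "C' \<subseteq> kelvin_domain" "openin (one_point S) (state_interior S - C')"
    and x: "x \<in> kelvin_domain" and t: "0 \<le> t"
  shows "(\<integral>\<^sup>+\<omega>. K (X t \<omega>) * indicator C (X t \<omega>) * indicator {\<omega>. on_grid C 0 t \<omega>} \<omega> \<partial>P x) \<le> K x"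
proof (rule kelvin_grid_le[OF IP D H_cont H _ t, where G = "I ` C" and V = "I ` W" and G' = "I ` C'"])
  have CU: "C \<subseteq> kelvin_domain" and C_int: "C \<subseteq> state_interior S" "C' \<subseteq> state_interior S" and W_int: "W \<subseteq> state_interior S"
    using C(1) W(2) C'(1) kelvin_domain_interior by blast+
  have C_sets: "C \<in> sets (state_borel S)" by (rule relatively_closed_sets[OF C_int(1) C(2)])
  show "x \<in> state_interior S" using x kelvin_domain_interior by blast
  show "I ` C \<subseteq> I ` W" "I ` W \<subseteq> I ` C'" by (intro image_mono C W)+
  show "openin (one_point S) (I ` W)"
    unfolding I_image_eq[OF W_int] by (rule openin_I_preimage[OF W(1)])
  have compl: "openin (one_point S) (state_interior S - I ` B)"
    if B: "B \<subseteq> state_interior S" "openin (one_point S) (state_interior S - B)" for B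
  proof -
    have "state_interior S - I ` B = {z \<in> state_interior S. I z \<in> state_interior S - B}"
      using I_interior_iff state_interior_subset[of S] by (auto simp: I_image_eq[OF B(1)])
    then show ?thesis using openin_I_preimage[OF B(2)] by simp
  qed
  show "openin (one_point S) (state_interior S - I ` C)" "openin (one_point S) (state_interior S - I ` C')"
    by (rule compl[OF C_int(1) C(2)], rule compl[OF C_int(2) C'(2)])
  show "I ` C' \<subseteq> D \<inter> state_interior S"
    using C'(1) kelvin_domain_space I_interior_iff by (auto simp: kelvin_domain_def)
  show "C \<subseteq> state_interior S" "C \<in> sets (state_borel S)" by (rule C_int, rule C_sets)
  show "(\<lambda>z. H (I z) * indicator C z) \<in> borel_measurable (state_borel S)"
    by (rule borel_times_indicator[OF H_I_borel CU C_sets])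
qed simp

text \<open>Almost every path that survives in I(D) and is in the interior at time \<open>t\<close>
  has stayed in one layer of the exhaustion. The bound for the layers passes to their supremum by
  monotone convergence.\<close>

lemma killed_kelvin_le:
  assumes x: "x \<in> kelvin_domain" and t: "0 \<le> t"
  shows "killed_semigroup P X (I ` D) t K x \<le> K x"
proof -
  obtain W C where exh: "\<And>n. openin (one_point S) (W n)" "\<And>n. W n \<subseteq> C n"
    "\<And>n. C n \<subseteq> W (Suc n)" "(\<Union>n. C n) = kelvin_domain"
    "\<And>n. openin (one_point S) (state_interior S - C n)"
    by (rule interior_exhaustion[OF openin_kelvin_domain kelvin_domain_interior]) blast
  have C_sub: "C n \<subseteq> kelvin_domain" for n using exh(4) by blast
  have C_int: "C n \<subseteq> state_interior S" for n using C_sub kelvin_domain_interior by blast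
  have C_sets: "C n \<in> sets (state_borel S)" for n by (rule relatively_closed_sets[OF C_int exh(5)])
  have C_Suc: "C n \<subseteq> C (Suc n)" for n using exh by blast
  have xS: "x \<in> state_space S" using x kelvin_domain_space by blast
  let ?g = "\<lambda>n \<omega>. K (X t \<omega>) * indicator (C n) (X t \<omega>) * indicator {\<omega>. on_grid (C n) 0 t \<omega>} \<omega>"
  have "killed_semigroup P X (I ` D) t K x \<le> (\<integral>\<^sup>+\<omega>. (SUP n. ?g n \<omega>) \<partial>P x)"
    unfolding killed_semigroup_def nn_integral_completion
  proof (rule nn_integral_mono_AE)
    show "AE \<omega> in P x. K (X t \<omega>) * indicator {\<omega>. ennreal t < exit_time X (I ` D) \<omega>} \<omega> \<le> (SUP n. ?g n \<omega>)"
      using grid_exhaustion[OF xS kelvin_domain_interior exh t] AE_regular_path[OF xS]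
    proof eventually_elim
      case (elim \<omega>)
      show ?case
      proof (cases "X t \<omega> \<in> state_interior S \<and> ennreal t < exit_time X (I ` D) \<omega>")
        case False
        have "X t \<omega> \<in> state_space S"
          using path_in_state_space[OF regular_path_space[OF elim(2)] t] .
        with False kelvin_zero have eq0: "K (X t \<omega>) * indicator {\<omega>. ennreal t < exit_time X (I ` D) \<omega>} \<omega> = 0"
          by (auto simp: indicator_def)
        show ?thesis unfolding eq0 by (rule zero_le)
      next
        case True
        \<comment> \<open>\<open>exit_time\<close> looks at positive times only; at time 0 the
          starting point decides.\<close>
        have "X s \<omega> \<in> kelvin_domain" if "s \<in> {0..t}" for s
        proof (cases "s = 0")
          case True
          then show ?thesis using x regular_path_start[OF elim(2)] by simp
        next
          case False
          then have "X s \<omega> \<in> I ` D" using True that by (intro less_exit_timeD[of t X]) auto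
          moreover have "X s \<omega> \<in> state_interior S"
            using True that by (intro regular_path_interior_before[OF elim(2), of s t]) auto
          ultimately show ?thesis using image_D_interior_iff by blast
        qed
        then obtain n where n: "on_grid (C n) 0 t \<omega>" using elim(1) by blast
        then have "K (X t \<omega>) = ?g n \<omega>" using on_grid_end[OF n] by simp
        also have "\<dots> \<le> (SUP n. ?g n \<omega>)" by (rule SUP_upper) simp
        finally show ?thesis using True by simp
      qed
    qed
  qed
  also have "\<dots> = (SUP n. \<integral>\<^sup>+\<omega>. ?g n \<omega> \<partial>P x)"
  proof (rule nn_integral_monotone_convergence_SUP)
    show "incseq ?g"
    proof (rule incseq_SucI, rule le_funI)
      fix n \<omega>
      have "on_grid (C n) 0 t \<omega> \<Longrightarrow> on_grid (C (Suc n)) 0 t \<omega>"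
        using C_Suc unfolding on_grid_def by blast
      then show "?g n \<omega> \<le> ?g (Suc n) \<omega>"
        using C_Suc[of n] by (auto simp: indicator_def)
    qed
    show "?g n \<in> borel_measurable (P x)" for n by (rule kelvin_grid_measurable[OF C_sub C_sets xS t])
  qed
  also have "\<dots> \<le> K x" by (rule SUP_least[OF kelvin_layer_le[OF exh(3,5,1,2) C_sub exh(5) x t]])
  finally show ?thesis .
qed

text \<open>One layer around \<open>x\<close> suffices: the path stays in \<open>W n\<close> for
  small times, so the integrand restricted to that layer converges to \<open>K x\<close> along
  almost every path. Fatou's lemma transfers this to the integrals, which the killed semigroup
  dominates.\<close>

lemma kelvin_le_liminf_killed:
  assumes x: "x \<in> kelvin_domain" and \<tau>: "\<And>k. 0 < \<tau> k" "\<tau> \<longlonglongrightarrow> 0"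
  shows "K x \<le> liminf (\<lambda>k. killed_semigroup P X (I ` D) (\<tau> k) K x)"
proof -
  obtain W C where exh: "\<And>n. openin (one_point S) (W n)" "\<And>n. W n \<subseteq> C n"
    "\<And>n. C n \<subseteq> W (Suc n)" "(\<Union>n. C n) = kelvin_domain"
    "\<And>n. openin (one_point S) (state_interior S - C n)"
    by (rule interior_exhaustion[OF openin_kelvin_domain kelvin_domain_interior]) blast
  have C_sub: "C n \<subseteq> kelvin_domain" for n using exh(4) by blast
  have C_int: "C n \<subseteq> state_interior S" for n using C_sub kelvin_domain_interior by blast
  have C_sets: "C n \<in> sets (state_borel S)" for n by (rule relatively_closed_sets[OF C_int exh(5)])
  have xS: "x \<in> state_space S" using x kelvin_domain_space by blast
  obtain m where "x \<in> C m" using x exh(4) by blast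
  then obtain n where n: "x \<in> W n" using exh(3) by blast
  let ?g = "\<lambda>t \<omega>. K (X t \<omega>) * indicator (C n) (X t \<omega>) * indicator {\<omega>. on_grid (C n) 0 t \<omega>} \<omega>"
  have killed: "(\<integral>\<^sup>+\<omega>. ?g t \<omega> \<partial>P x) \<le> killed_semigroup P X (I ` D) t K x" if t: "0 \<le> t" for t
    unfolding killed_semigroup_def nn_integral_completion
  proof (rule nn_integral_mono_AE)
    show "AE \<omega> in P x. ?g t \<omega> \<le> K (X t \<omega>) * indicator {\<omega>. ennreal t < exit_time X (I ` D) \<omega>} \<omega>"
      using AE_regular_path[OF xS]
    proof eventually_elim
      case (elim \<omega>)
      show ?case
      proof (cases "on_grid (C n) 0 t \<omega>")
        case True
        have Xt: "X (0 + t) \<omega> \<in> state_interior S" using on_grid_end[OF True] C_int by blast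
        have "ennreal t < exit_time X (I ` D) \<omega>"
        proof (rule regular_path_exit_time[OF elim t openin_kelvin_domain])
          show "X t \<omega> \<in> kelvin_domain" using on_grid_end[OF True] C_sub by auto
          show "kelvin_domain \<subseteq> I ` D" using image_D_interior_iff kelvin_domain_interior by blast
          then show "X s \<omega> \<in> I ` D" if "0 < s" "s \<le> t" for s
            using on_grid_imp[OF elim exh(5) order.refl Xt True, of s] that C_sub by auto
        qed
        then show ?thesis by (simp add: indicator_def)
      qed simp
    qed
  qed
  have "K x = (\<integral>\<^sup>+\<omega>. K x \<partial>P x)" using prob_space.emeasure_space_1[OF prob[OF xS]] by simp
  also have "\<dots> \<le> (\<integral>\<^sup>+\<omega>. liminf (\<lambda>k. ?g (\<tau> k) \<omega>) \<partial>P x)"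
  proof (rule nn_integral_mono_AE)
    show "AE \<omega> in P x. K x \<le> liminf (\<lambda>k. ?g (\<tau> k) \<omega>)"
      using AE_regular_path[OF xS]
    proof eventually_elim
      case (elim \<omega>)
      have X0: "X 0 \<omega> = x" by (rule regular_path_start[OF elim])
      obtain e where e: "0 < e" "\<And>s. 0 \<le> s \<Longrightarrow> s < 0 + e \<Longrightarrow> X s \<omega> \<in> W n"
        using regular_path_open[OF elim order.refl exh(1)] n X0 by metis
      have g_eq: "?g t \<omega> = K (X t \<omega>)" if t: "0 \<le> t" "t < e" for t
      proof -
        have gb: "0 \<le> t * real i / 2 ^ N" "t * real i / 2 ^ N \<le> t" if "i \<le> 2 ^ N" for i N :: nat
        proof -
          have "real i \<le> 2 ^ N" using that by (metis of_nat_le_iff of_nat_numeral of_nat_power)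
          then show "0 \<le> t * real i / 2 ^ N" "t * real i / 2 ^ N \<le> t"
            using t by (auto simp: divide_le_eq mult_left_mono)
        qed
        have "on_grid (C n) 0 t \<omega>"
          unfolding on_grid_def
        proof (intro allI impI)
          fix N i :: nat assume i: "i \<le> 2 ^ N"
          have "X (t * real i / 2 ^ N) \<omega> \<in> W n" using gb[OF i] t(2) by (intro e(2)) auto
          then show "X (0 + t * real i / 2 ^ N) \<omega> \<in> C n" using exh(2) by auto
        qed
        then show ?thesis using on_grid_end[of "C n" 0 t \<omega>] by simp
      qed
      have "filterlim \<tau> (at_right 0) sequentially"
        using \<tau> by (auto simp: filterlim_at intro!: always_eventually less_imp_neq[THEN not_sym])
      from filterlim_compose[OF kelvin_right_continuous[OF elim order.refl] this]
      have "(\<lambda>k. K (X (\<tau> k) \<omega>)) \<longlonglongrightarrow> K x" using x X0 by simp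
      moreover have "eventually (\<lambda>k. ?g (\<tau> k) \<omega> = K (X (\<tau> k) \<omega>)) sequentially"
        using order_tendstoD(2)[OF \<tau>(2) e(1)]
        by eventually_elim (use \<tau>(1) g_eq in \<open>auto simp: less_imp_le\<close>)
      ultimately have "(\<lambda>k. ?g (\<tau> k) \<omega>) \<longlonglongrightarrow> K x"
        by (simp add: tendsto_cong)
      then have "liminf (\<lambda>k. ?g (\<tau> k) \<omega>) = K x" by (intro lim_imp_Liminf) auto
      then show ?case by simp
    qed
  qed
  also have "\<dots> \<le> liminf (\<lambda>k. \<integral>\<^sup>+\<omega>. ?g (\<tau> k) \<omega> \<partial>P x)"
    using \<tau>(1) by (intro nn_integral_liminf kelvin_grid_measurable[OF C_sub C_sets xS]) (simp add: less_imp_le)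
  also have "\<dots> \<le> liminf (\<lambda>k. killed_semigroup P X (I ` D) (\<tau> k) K x)"
    using \<tau>(1) by (intro Liminf_mono always_eventually allI killed) (simp add: less_imp_le)
  finally show ?thesis .
qed

lemma excessive_on_kelvin: "excessive_on S P X (I ` D) K"
proof -
  have image_space: "I ` D \<subseteq> state_space S" using I_involution D_subset by blast
  \<comment> \<open>At boundary points in I(D) the path rests and \<open>K\<close> vanishes, so both
    sides are 0.\<close>
  have outside: "killed_semigroup P X (I ` D) t K x = K x" if x: "x \<in> I ` D" "x \<notin> kelvin_domain" and t: "0 \<le> t" for x t
  proof -
    have xS: "x \<in> state_space S" and xI: "x \<notin> state_interior S" using x image_space image_D_interior_iff by auto
    have "killed_semigroup P X (I ` D) t K x = (\<integral>\<^sup>+\<omega>. 0 \<partial>P x)"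
      unfolding killed_semigroup_def nn_integral_completion
    proof (rule nn_integral_cong_AE)
      show "AE \<omega> in P x. K (X t \<omega>) * indicator {\<omega>. ennreal t < exit_time X (I ` D) \<omega>} \<omega> = 0"
        using AE_regular_path[OF xS]
      proof eventually_elim
        case (elim \<omega>)
        have "X t \<omega> = x"
          using elim t xI xS unfolding regular_path_def state_boundary_def by blast
        then show ?case using kelvin_zero[OF xS xI] by simp
      qed
    qed
    then show ?thesis using kelvin_zero[OF xS xI] by simp
  qed
  have le: "killed_semigroup P X (I ` D) t K x \<le> K x" if "x \<in> I ` D" "0 \<le> t" for x t
    using killed_kelvin_le outside that by (cases "x \<in> kelvin_domain") auto
  have lim: "((\<lambda>t. killed_semigroup P X (I ` D) t K x) \<longlongrightarrow> K x) (at_right 0)" if x: "x \<in> I ` D" for x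
  proof (cases "x \<in> kelvin_domain")
    case True
    \<comment> \<open>Fatou's lemma works along sequences, hence the sequential form of the right
      limit.\<close>
    show ?thesis
      unfolding tendsto_at_iff_sequentially
    proof (intro allI impI)
      fix \<tau> :: "nat \<Rightarrow> real" assume "\<forall>i. \<tau> i \<in> {0<..} - {0}" and \<tau>0: "\<tau> \<longlonglongrightarrow> 0"
      then have \<tau>: "\<And>i. 0 < \<tau> i" by auto
      show "((\<lambda>t. killed_semigroup P X (I ` D) t K x) \<circ> \<tau>) \<longlonglongrightarrow> K x"
      proof (rule order_tendstoI)
        fix a assume "a < K x"
        also have "\<dots> \<le> liminf (\<lambda>k. killed_semigroup P X (I ` D) (\<tau> k) K x)" by (rule kelvin_le_liminf_killed[OF True \<tau> \<tau>0])
        finally show "eventually (\<lambda>k. a < ((\<lambda>t. killed_semigroup P X (I ` D) t K x) \<circ> \<tau>) k) sequentially"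
          using less_LiminfD by fastforce
      next
        fix a assume "K x < a"
        then show "eventually (\<lambda>k. ((\<lambda>t. killed_semigroup P X (I ` D) t K x) \<circ> \<tau>) k < a) sequentially"
          using le[OF x] \<tau> by (intro always_eventually allI) (auto intro: le_less_trans less_imp_le)
      qed
    qed
  next
    case False
    have "eventually (\<lambda>t. killed_semigroup P X (I ` D) t K x = K x) (at_right 0)"
      using eventually_at_right_less by eventually_elim (use outside[OF x False] in simp)
    then show ?thesis by (simp add: tendsto_eventually)
  qed
  have "K \<in> borel_measurable (restrict_space (state_borel S) (I ` D))"
  proof -
    have "(\<lambda>z. K z * indicator kelvin_domain z) \<in> borel_measurable (restrict_space (state_borel S) (I ` D))"
      using kelvin_borel[OF order.refl openin_imp_sets[OF openin_kelvin_domain]] by (rule measurable_restrict_space1)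
    moreover have "K z = K z * indicator kelvin_domain z" if "z \<in> space (restrict_space (state_borel S) (I ` D))" for z
      using that kelvin_zero image_D_interior_iff by (auto simp: space_restrict_space space_state_borel indicator_def)
    ultimately show ?thesis by (simp cong: measurable_cong)
  qed
  then show ?thesis
    unfolding excessive_on_def by (intro conjI ballI allI impI le lim)
qed

end

theorem theorem2:
  fixes S :: "(real ^ 'n) set"
    and M :: "'w measure"
    and F :: "ennreal \<Rightarrow> 'w measure"
    and X :: "real \<Rightarrow> 'w \<Rightarrow> (real ^ 'n) option"
    and P :: "(real ^ 'n) option \<Rightarrow> 'w measure"
    and I :: "(real ^ 'n) option \<Rightarrow> (real ^ 'n) option"
    and h :: "(real ^ 'n) option \<Rightarrow> ennreal"
    and v :: "(real ^ 'n) option \<Rightarrow> real"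
    and D :: "(real ^ 'n) option set"
    and H :: "(real ^ 'n) option \<Rightarrow> ennreal"
  assumes "standard_process M F S X P"
    and "inversion_property S P X I h v"
    and "continuous_characteristics S I h"
    and "openin (one_point S) D"
    and "D \<subseteq> positivity_set S h"
    and "\<forall>x\<in>state_boundary S. H x = 0"
    and "continuous_map (subtopology (one_point S) (D \<inter> state_interior S)) euclidean H"
    and "excessive_on S P X D H"
  shows "excessive_on S P X (I ` D) (kelvin I h H)"
proof -
  interpret kelvin_setting M F S X P I h v D H
    using assms by (intro kelvin_setting.intro kelvin_setting_axioms.intro)
  show ?thesis by (rule excessive_on_kelvin)
qed

end
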